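(* Let $n\ge1$ and $m,k\ge0$ be integers. The Hilbert series of $H^0\left(\mathrm{Hilb}^{n,n+1}(\mathbb{C}^2),\mathcal{O}(m,k)\right)$ is given by $$H_{m,k}(q,t)=\frac{1}{(1-q)(1-t)}\sum_{(a_1,\dots,a_n,b_1,\dots,b_n)\in\mathcal{P}(m+k,k)}q^{a_1+\cdots+a_n}t^{b_1+\cdots+b_n},$$ where $\mathcal{P}(m+k,k)$ is the set of points $(a_1,\dots,a_n,b_1,\dots,b_n)\in\mathbb{Z}_{\ge0}^{2n}$ such that (i) $0\le a_1\le a_2\le\cdots\le a_n$; (ii) for any $j=1,\dots,n-1$ for which $a_j=a_{j+1}$, we have $b_{j+1}\ge b_j+m+k$; and (iii) for each $j=1,\dots,n$, we have $b_j\ge\max\{k-a_j,0\}+\sum_{i=1}^{j-1}\max\{m+k-(a_j-a_i),0\}$.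
   Context: The nested Hilbert scheme $\mathrm{Hilb}^{n,n+1}(\mathbb{C}^2)$ parametrizes pairs of subschemes $Z\subset Z'$ of $\mathbb{C}^2$ of lengths $n$ and $n+1$, with projections $\pi_n,\pi_{n+1}$ to $\mathrm{Hilb}^n(\mathbb{C}^2)$ and $\mathrm{Hilb}^{n+1}(\mathbb{C}^2)$. On a Hilbert scheme of points $\mathcal{O}(1)$ is the determinant of the tautological bundle (fiber $\mathbb{C}[x,y]/\mathcal{I}$ at $\mathcal{I}$), $\mathcal{O}(d)=\mathcal{O}(1)^{\otimes d}$, and $\mathcal{O}(m,k)=\pi_n^*\mathcal{O}(m)\otimes\pi_{n+1}^*\mathcal{O}(k)$. For $m,k\ge0$, $H^0(\mathrm{Hilb}^{n,n+1}(\mathbb{C}^2),\mathcal{O}(m,k))$ is identified with the $\mathrm{sgn}(m+k)$-component of $J^{m+k}\cap I^k\subseteq\mathbb{C}[x_1,y_1,\dots,x_n,y_n,x,y]$, where $J=\bigcap_{i<j}(x_i-x_j,y_i-y_j)$ (for $n=1$ the whole ring) and $I=\bigcap_{i=1}^n(x_i-x,y_i-y)$; $S_n$ permutes the pairs $(x_i,y_i)$ simultaneously and fixes $x,y$, and $\mathrm{sgn}(d)$ is the trivial character for $d$ even and the sign character for $d$ odd. The bigrading is $\deg(x_i)=\deg(x)=q$, $\deg(y_i)=\deg(y)=t$ (corresponding to the $(\mathbb{C}^\times)^2$-action on $\mathbb{C}^2$), and the Hilbert series of a bigraded space $V=\bigoplus V_{i,j}$ is $\sum_{i,j}\dim(V_{i,j})q^it^j$.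 *)

theory Defs
  imports
    "HOL-Algebra.Ideal_Product"
    "HOL-Combinatorics.Permutations"
    "HOL-Computational_Algebra.Formal_Power_Series"
    "HOL-Library.FuncSet"
    "HOL-Library.Poly_Mapping"
    Complex_Main
begin

section \<open>The polynomial ring\<close>

text \<open>
  The variables \<open>XVar i\<close>, \<open>YVar i\<close> with \<open>1 \<le> i \<le> n\<close> are
  \<open>x\<^sub>i\<close>, \<open>y\<^sub>i\<close>; the index \<open>0\<close> is used for the extra pair
  \<open>x\<close>, \<open>y\<close>. A monomial is a finitely supported exponent function.
\<close>

datatype coord = XVar nat | YVar nat

type_synonym cpoly = "(coord \<Rightarrow>\<^sub>0 nat) \<Rightarrow>\<^sub>0 complex"

definition pvar :: "coord \<Rightarrow> cpoly" where
  "pvar v = Poly_Mapping.single (Poly_Mapping.single v 1) 1"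

definition coords :: "nat \<Rightarrow> coord set" where
  "coords n = XVar ` {0..n} \<union> YVar ` {0..n}"

text \<open>\<open>\<complex>[x\<^sub>1, y\<^sub>1, \<dots>, x\<^sub>n, y\<^sub>n, x, y]\<close>\<close>

definition point_ring :: "nat \<Rightarrow> cpoly ring" where
  "point_ring n =
    \<lparr>carrier = {f. \<forall>\<mu>\<in>Poly_Mapping.keys f. Poly_Mapping.keys \<mu> \<subseteq> coords n},
     monoid.mult = (*), one = 1, zero = 0, add = (+)\<rparr>"

lemma point_ring_simps [simp]:
  "f \<in> carrier (point_ring n) \<longleftrightarrow>
     (\<forall>\<mu>\<in>Poly_Mapping.keys f. Poly_Mapping.keys \<mu> \<subseteq> coords n)"
  "monoid.mult (point_ring n) = (*)" "one (point_ring n) = 1"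
  "zero (point_ring n) = 0" "add (point_ring n) = (+)"
  by (simp_all add: point_ring_def)

lemma cring_point_ring: "cring (point_ring n)"
proof (rule cringI)
  show "abelian_group (point_ring n)"
  proof (rule abelian_groupI)
    fix f g assume "f \<in> carrier (point_ring n)" "g \<in> carrier (point_ring n)"
    then show "f \<oplus>\<^bsub>point_ring n\<^esub> g \<in> carrier (point_ring n)"
      using Poly_Mapping.keys_add[of f g] by auto
  next
    fix f assume "f \<in> carrier (point_ring n)"
    then show "\<exists>g\<in>carrier (point_ring n). g \<oplus>\<^bsub>point_ring n\<^esub> f = \<zero>\<^bsub>point_ring n\<^esub>"
      by (intro bexI[of _ "- f"]) auto
  qed (auto simp: algebra_simps)
  show "comm_monoid (point_ring n)"
  proof (rule comm_monoidI)
    fix f g assume fg: "f \<in> carrier (point_ring n)" "g \<in> carrier (point_ring n)"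
    have "Poly_Mapping.keys \<mu> \<subseteq> coords n" if \<mu>: "\<mu> \<in> Poly_Mapping.keys (f * g)" for \<mu>
    proof -
      obtain a b where "\<mu> = a + b" "a \<in> Poly_Mapping.keys f" "b \<in> Poly_Mapping.keys g"
        using \<mu> Poly_Mapping.keys_mult[of f g] by blast
      then show ?thesis
        using fg Poly_Mapping.keys_add[of a b] by fastforce
    qed
    then show "f \<otimes>\<^bsub>point_ring n\<^esub> g \<in> carrier (point_ring n)"
      by simp
  qed (auto simp: algebra_simps)
qed (auto simp: algebra_simps)

definition cscale :: "complex \<Rightarrow> cpoly \<Rightarrow> cpoly" where
  "cscale c f = Poly_Mapping.map ((*) c) f"

lemma lookup_cscale [simp]:
  "Poly_Mapping.lookup (cscale c f) \<mu> = c * Poly_Mapping.lookup f \<mu>"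
  by (simp add: cscale_def Poly_Mapping.map.rep_eq when_def)

global_interpretation cpoly: vector_space cscale
  by unfold_locales
    (auto intro!: poly_mapping_eqI simp: lookup_add algebra_simps)


section \<open>The bigrading and Hilbert series\<close>

definition xdeg :: "(coord \<Rightarrow>\<^sub>0 nat) \<Rightarrow> nat" where
  "xdeg \<mu> = (\<Sum>v\<in>Poly_Mapping.keys \<mu>. case v of XVar _ \<Rightarrow> Poly_Mapping.lookup \<mu> v | YVar _ \<Rightarrow> 0)"

definition ydeg :: "(coord \<Rightarrow>\<^sub>0 nat) \<Rightarrow> nat" where
  "ydeg \<mu> = (\<Sum>v\<in>Poly_Mapping.keys \<mu>. case v of XVar _ \<Rightarrow> 0 | YVar _ \<Rightarrow> Poly_Mapping.lookup \<mu> v)"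

definition bihomogeneous :: "nat \<Rightarrow> nat \<Rightarrow> cpoly set" where
  "bihomogeneous i j = {f. \<forall>\<mu>\<in>Poly_Mapping.keys f. xdeg \<mu> = i \<and> ydeg \<mu> = j}"

text \<open>
  Power series in \<open>q\<close> and \<open>t\<close> are represented as power series in \<open>t\<close>
  whose coefficients are power series in \<open>q\<close>.
\<close>

definition qser :: "rat fps fps" where "qser = fps_const fps_X"

definition tser :: "rat fps fps" where "tser = fps_X"

definition bivariate_series :: "(nat \<Rightarrow> nat \<Rightarrow> nat) \<Rightarrow> rat fps fps" where
  "bivariate_series c = Abs_fps (\<lambda>j. Abs_fps (\<lambda>i. of_nat (c i j)))"

text \<open>Division of nested power series behaves as expected for the denominator used below.\<close>

lemma inverse_one_minus_q_one_minus_t: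
  "(1 / ((1 - qser) * (1 - tser))) * ((1 - qser) * (1 - tser)) = 1"
proof -
  let ?g = "(1 - qser) * (1 - tser)"
  have g0: "fps_nth ?g 0 = 1 - fps_X"
    by (simp add: qser_def tser_def)
  have "fps_nth ?g 0 \<noteq> 0"
    unfolding g0 by (metis diff_0_right eq_iff_diff_eq_0 fps_X_neq_one)
  then have sd: "subdegree ?g = 0"
    by (simp add: subdegree_eq_0_iff)
  have u: "unit_factor ?g = ?g"
    using sd by (simp add: fps_unit_factor_def)
  have X: "(1 - fps_X :: rat fps) * inverse (1 - fps_X) = 1"
    by (rule inverse_mult_eq_1') simp
  have "?g * inverse ?g = 1"
    unfolding fps_inverse_def
    by (rule fps_right_inverse, unfold g0) (rule X[unfolded fps_inverse_def])
  then show ?thesis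
    unfolding fps_divide_def u sd by (simp add: mult.commute)
qed

text \<open>
  For \<open>V \<subseteq> point_ring n\<close> the bihomogeneous pieces are finite-dimensional, so
  the dimension is the genuine one (it is \<open>0\<close> by convention in infinite dimension).
\<close>

definition hilbert_series :: "cpoly set \<Rightarrow> rat fps fps" where
  "hilbert_series V = bivariate_series (\<lambda>i j. cpoly.dim (V \<inter> bihomogeneous i j))"


section \<open>Sections of line bundles on the nested Hilbert scheme\<close>

fun permute_coord :: "(nat \<Rightarrow> nat) \<Rightarrow> coord \<Rightarrow> coord" where
  "permute_coord \<sigma> (XVar i) = XVar (\<sigma> i)"
| "permute_coord \<sigma> (YVar i) = YVar (\<sigma> i)"

text \<open>
  The coefficient of \<open>\<mu>\<close> in \<open>permute_points \<sigma> f\<close> is the coefficient of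
  \<open>\<mu> \<circ> permute_coord \<sigma>\<close> in \<open>f\<close>.
\<close>

definition permute_points :: "(nat \<Rightarrow> nat) \<Rightarrow> cpoly \<Rightarrow> cpoly" where
  "permute_points \<sigma> f = Poly_Mapping.map_key (Poly_Mapping.map_key (permute_coord \<sigma>)) f"

lemma inj_permute_coord:
  assumes "inj \<sigma>" shows "inj (permute_coord \<sigma>)"
proof (rule injI)
  fix v w show "permute_coord \<sigma> v = permute_coord \<sigma> w \<Longrightarrow> v = w"
    using assms by (cases v; cases w) (auto dest: injD)
qed

lemma inj_map_key_permute_coord:
  assumes "bij \<sigma>" shows "inj (Poly_Mapping.map_key (permute_coord \<sigma>) :: _ \<Rightarrow> (coord \<Rightarrow>\<^sub>0 nat))"
proof (rule injI)
  fix \<mu> \<nu> :: "coord \<Rightarrow>\<^sub>0 nat"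
  assume eq: "Poly_Mapping.map_key (permute_coord \<sigma>) \<mu> = Poly_Mapping.map_key (permute_coord \<sigma>) \<nu>"
  show "\<mu> = \<nu>"
  proof (rule poly_mapping_eqI)
    fix v
    obtain w where w: "v = permute_coord \<sigma> w"
      using assms by (cases v) (metis bij_pointE permute_coord.simps)+
    have "inj (permute_coord \<sigma>)"
      using assms by (simp add: bij_is_inj inj_permute_coord)
    then show "Poly_Mapping.lookup \<mu> v = Poly_Mapping.lookup \<nu> v"
      using arg_cong[OF eq, of "\<lambda>\<mu>. Poly_Mapping.lookup \<mu> w"]
      by (simp add: w map_key.rep_eq)
  qed
qed

lemma permute_points_pvar:
  assumes "bij \<sigma>" shows "permute_points \<sigma> (pvar v) = pvar (permute_coord \<sigma> v)"
proof -
  have inj: "inj (permute_coord \<sigma>)"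
    using assms by (simp add: bij_is_inj inj_permute_coord)
  have "Poly_Mapping.single v 1 =
      Poly_Mapping.map_key (permute_coord \<sigma>) (Poly_Mapping.single (permute_coord \<sigma> v) (1::nat))"
    using map_key_single[OF inj] by metis
  then show ?thesis
    unfolding permute_points_def pvar_def
    using map_key_single[OF inj_map_key_permute_coord[OF assms]] by metis
qed

definition sgn_char :: "nat \<Rightarrow> (nat \<Rightarrow> nat) \<Rightarrow> complex" where
  "sgn_char d \<sigma> = (if even d then 1 else of_int (sign \<sigma>))"

definition sgn_component :: "nat \<Rightarrow> nat \<Rightarrow> cpoly set \<Rightarrow> cpoly set" where
  "sgn_component n d V =
    {f \<in> V. \<forall>\<sigma>. \<sigma> permutes {1..n} \<longrightarrow> permute_points \<sigma> f = cscale (sgn_char d \<sigma>) f}"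

text \<open>\<open>(x\<^sub>i - x\<^sub>j, y\<^sub>i - y\<^sub>j)\<close>\<close>

definition pair_ideal :: "nat \<Rightarrow> nat \<Rightarrow> nat \<Rightarrow> cpoly set" where
  "pair_ideal n i j =
    genideal (point_ring n) {pvar (XVar i) - pvar (XVar j), pvar (YVar i) - pvar (YVar j)}"

definition J_ideal :: "nat \<Rightarrow> cpoly set" where
  "J_ideal n = carrier (point_ring n) \<inter> (\<Inter>i\<in>{1..n}. \<Inter>j\<in>{i<..n}. pair_ideal n i j)"

definition I_ideal :: "nat \<Rightarrow> cpoly set" where
  "I_ideal n = carrier (point_ring n) \<inter> (\<Inter>i\<in>{1..n}. pair_ideal n i 0)"

text \<open>
  The space \<open>H\<^sup>0(Hilb\<^sup>n\<^sup>,\<^sup>n\<^sup>+\<^sup>1(\<complex>\<^sup>2), O(m, k))\<close> in its algebraic description,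
  the \<open>sgn(m + k)\<close>-component of \<open>J\<^sup>m\<^sup>+\<^sup>k \<inter> I\<^sup>k\<close>. Powers are taken in the
  monoid of ideals of the ring, so the zeroth power is the whole ring.
\<close>

definition nested_hilb_sections :: "nat \<Rightarrow> nat \<Rightarrow> nat \<Rightarrow> cpoly set" where
  "nested_hilb_sections n m k = sgn_component n (m + k)
    (J_ideal n [^]\<^bsub>ideals_set (point_ring n)\<^esub> (m + k) \<inter>
     I_ideal n [^]\<^bsub>ideals_set (point_ring n)\<^esub> k)"


section \<open>The lattice points\<close>

text \<open>
  The points \<open>(a\<^sub>1, \<dots>, a\<^sub>n, b\<^sub>1, \<dots>, b\<^sub>n)\<close> of \<open>P(r, k)\<close>; tuples are
  functions on \<open>{1..n}\<close>, extended by \<open>undefined\<close>.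
\<close>

definition P_set :: "nat \<Rightarrow> nat \<Rightarrow> nat \<Rightarrow> ((nat \<Rightarrow> nat) \<times> (nat \<Rightarrow> nat)) set" where
  "P_set n r k = {(a, b).
     a \<in> {1..n} \<rightarrow>\<^sub>E UNIV \<and> b \<in> {1..n} \<rightarrow>\<^sub>E UNIV \<and>
     (\<forall>j\<in>{1..<n}. a j \<le> a (j + 1)) \<and>
     (\<forall>j\<in>{1..<n}. a j = a (j + 1) \<longrightarrow> b (j + 1) \<ge> b j + r) \<and>
     (\<forall>j\<in>{1..n}. int (b j) \<ge> max (int k - int (a j)) 0 +
        (\<Sum>i\<in>{1..<j}. max (int r - (int (a j) - int (a i))) 0))}"

text \<open>
  The formal sum \<open>\<Sum>(a, b)\<in>S. q ^ (\<Sum>i. a\<^sub>i) * t ^ (\<Sum>i. b\<^sub>i)\<close>, whose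
  coefficients count the points with given coordinate sums.
\<close>

definition lattice_series ::
    "nat \<Rightarrow> ((nat \<Rightarrow> nat) \<times> (nat \<Rightarrow> nat)) set \<Rightarrow> rat fps fps" where
  "lattice_series n S = bivariate_series
     (\<lambda>i j. card {(a, b) \<in> S. (\<Sum>l=1..n. a l) = i \<and> (\<Sum>l=1..n. b l) = j})"

lemma finite_P_set_fibre:
  "finite {(a, b) \<in> P_set n r k. (\<Sum>l=1..n. a l) = i \<and> (\<Sum>l=1..n. b l) = j}"
proof (rule finite_subset)
  show "{(a, b) \<in> P_set n r k. (\<Sum>l=1..n. a l) = i \<and> (\<Sum>l=1..n. b l) = j}
      \<subseteq> ({1..n} \<rightarrow>\<^sub>E {..i}) \<times> ({1..n} \<rightarrow>\<^sub>E {..j})"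
  proof
    fix p
    assume "p \<in> {(a, b) \<in> P_set n r k. (\<Sum>l=1..n. a l) = i \<and> (\<Sum>l=1..n. b l) = j}"
    then obtain a b where p: "p = (a, b)" "a \<in> {1..n} \<rightarrow>\<^sub>E UNIV" "b \<in> {1..n} \<rightarrow>\<^sub>E UNIV"
        "i = (\<Sum>l=1..n. a l)" "j = (\<Sum>l=1..n. b l)"
      by (auto simp: P_set_def)
    then show "p \<in> ({1..n} \<rightarrow>\<^sub>E {..i}) \<times> ({1..n} \<rightarrow>\<^sub>E {..j})"
      by (simp add: PiE_iff member_le_sum)
  qed
  show "finite (({1..n} \<rightarrow>\<^sub>E {..i}) \<times> ({1..n} \<rightarrow>\<^sub>E {..j}))"
    by (intro finite_cartesian_product finite_PiE) auto
qed

end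

theory Submission
  imports Defs "HOL-Library.Product_Lexorder"
begin

text \<open>
  Put \<open>d = m + k\<close> and order monomials lexicographically with
  \<open>x\<^sub>n > \<dots> > x\<^sub>1 > x > y\<^sub>n > \<dots> > y\<^sub>1 > y\<close>. The dimension of a bihomogeneous piece of
  the space of sections is the number of leading monomials that occur in it
  (\<open>dim_eq_card_leads\<close>), so the theorem follows once these leading monomials are known: they are
  the \<open>x\<^sup>a y\<^sup>b\<close> with \<open>(a, b)\<close> a lattice point of \<open>P(d, k)\<close>, multiplied by arbitrary powers of the
  two extra variables \<open>x\<close> and \<open>y\<close>. The free powers give the factor \<open>1 / ((1 - q) (1 - t))\<close>.

  No other leading monomial occurs (\<open>lead_in_P_monomials\<close>). Let \<open>f\<close> be a section, \<open>x\<^sup>a\<close> the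
  x-part of its leading monomial, and \<open>p(y)\<close> the coefficient of \<open>x\<^sup>a\<close> in \<open>f\<close>. The symmetry of \<open>f\<close>
  forces \<open>a\<^sub>1 \<le> \<dots> \<le> a\<^sub>n\<close>. As \<open>f\<close> lies in \<open>(x\<^sub>j - x\<^sub>i, y\<^sub>j - y\<^sub>i)\<^sup>d\<close>, it is, modulo
  \<open>(y\<^sub>j - y\<^sub>i)\<^sup>e\<close>, a multiple of the power \<open>d + 1 - e\<close> of \<open>x\<^sub>j - x\<^sub>i\<close>, and the cofactor may be
  chosen symmetric or antisymmetric in the points \<open>i\<close>, \<open>j\<close>. Comparing leading x-monomials
  modulo \<open>(y\<^sub>j - y\<^sub>i)\<^sup>e\<close> shows that \<open>p\<close> vanishes modulo this power for
  \<open>e = max(d - (a\<^sub>j - a\<^sub>i), 0)\<close>. In the same way \<open>p\<close> is divisible by the power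
  \<open>max(k - a\<^sub>j, 0)\<close> of \<open>y\<^sub>j - y\<close>. For fixed \<open>j\<close> these factors are coprime with leading term a power
  of \<open>y\<^sub>j\<close>, which is condition (iii). If \<open>a\<^sub>j = a\<^sub>j\<^sub>+\<^sub>1\<close>, then \<open>p\<close> is \<open>(y\<^sub>j\<^sub>+\<^sub>1 - y\<^sub>j)\<^sup>d\<close> times a
  polynomial symmetric in the points \<open>j\<close> and \<open>j + 1\<close>, which is condition (ii).

  All of them occur (\<open>P_monomials_attained\<close>). A point of \<open>P(d, k)\<close> is a sum of \<open>m\<close> points of
  \<open>P(1, 0)\<close> and \<open>k\<close> points of \<open>P(1, 1)\<close>: the x-exponents are split as
  \<open>a\<^sub>j = \<lfloor>a\<^sub>j / d\<rfloor> + \<lfloor>(a\<^sub>j + 1) / d\<rfloor> + \<dots> + \<lfloor>(a\<^sub>j + d - 1) / d\<rfloor>\<close> (Hermite), and this splitting distributes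
  the lower bounds in (iii) exactly. The points of \<open>P(1, 0)\<close> are the lexicographically strictly
  increasing sequences of \<open>n\<close> exponent pairs, hence the leading monomials of antisymmetrized monomials in
  \<open>x\<^sub>j - x\<close>, \<open>y\<^sub>j - y\<close>, which lie in \<open>J\<close>; for the points of \<open>P(1, 1)\<close> no pair is \<open>(0, 0)\<close> and
  the antisymmetrization lies in \<open>I\<close> as well. The product of the \<open>d\<close> antisymmetrizations lies in
  \<open>J\<^sup>d \<inter> I\<^sup>k\<close> and has the required leading monomial. For \<open>d = 0\<close>, when the sections are the symmetric
  polynomials, a symmetrized monomial has it.
\<close>

abbreviation "lookup \<equiv> Poly_Mapping.lookup"
abbreviation "keys \<equiv> Poly_Mapping.keys"
abbreviation "single \<equiv> Poly_Mapping.single"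
(* From here on inv is the inverse of a function, not of a group element. *)
no_notation m_inv (\<open>(\<open>open_block notation=\<open>prefix inv\<close>\<close>inv\<index> _)\<close> [81] 80)

type_synonym mon = "coord \<Rightarrow>\<^sub>0 nat"

section \<open>The monomial order and leading monomials\<close>

text \<open>
  Finitely supported exponent functions are compared at the least variable at which they differ.
  So the least variable is the most significant one, and the order below makes
  \<open>x\<^sub>n > \<dots> > x\<^sub>1 > x > y\<^sub>n > \<dots> > y\<^sub>1 > y\<close> in the lexicographic order of monomials.
\<close>

instantiation coord :: linorder
begin

fun less_coord :: "coord \<Rightarrow> coord \<Rightarrow> bool" where
  "less_coord (XVar i) (XVar j) = (j < i)"
| "less_coord (YVar i) (YVar j) = (j < i)"
| "less_coord (XVar i) (YVar j) = True"
| "less_coord (YVar i) (XVar j) = False"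

definition less_eq_coord :: "coord \<Rightarrow> coord \<Rightarrow> bool" where
  "less_eq_coord v w \<longleftrightarrow> v < w \<or> v = w"

instance
proof
  fix u v w :: coord
  show "u < v \<longleftrightarrow> u \<le> v \<and> \<not> v \<le> u"
    by (cases u; cases v) (auto simp: less_eq_coord_def)
  show "u \<le> u"
    by (simp add: less_eq_coord_def)
  show "u \<le> v \<Longrightarrow> v \<le> w \<Longrightarrow> u \<le> w"
    by (cases u; cases v; cases w) (auto simp: less_eq_coord_def)
  show "u \<le> v \<Longrightarrow> v \<le> u \<Longrightarrow> u = v"
    by (cases u; cases v) (auto simp: less_eq_coord_def)
  show "u \<le> v \<or> v \<le> u"
    by (cases u; cases v) (auto simp: less_eq_coord_def)
qed

end

lemma mon_lessI:
  fixes \<mu> \<nu> :: mon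
  assumes "lookup \<mu> v < lookup \<nu> v" "\<And>w. w < v \<Longrightarrow> lookup \<mu> w = lookup \<nu> w"
  shows "\<mu> < \<nu>"
  using assms unfolding less_poly_mapping.rep_eq less_fun_def by blast

lemma mon_lessE:
  fixes \<mu> \<nu> :: mon
  assumes "\<mu> < \<nu>"
  obtains v where "lookup \<mu> v < lookup \<nu> v" "\<And>w. w < v \<Longrightarrow> lookup \<mu> w = lookup \<nu> w"
  using assms unfolding less_poly_mapping.rep_eq less_fun_def by blast

definition lead :: "('m::linorder \<Rightarrow>\<^sub>0 'a::zero) \<Rightarrow> 'm \<Rightarrow> bool" where
  "lead f \<mu> \<longleftrightarrow> \<mu> \<in> keys f \<and> (\<forall>\<nu>\<in>keys f. \<nu> \<le> \<mu>)"

lemma lead_exists: "f \<noteq> 0 \<Longrightarrow> \<exists>\<mu>. lead f \<mu>"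
  unfolding lead_def
  by (rule exI[of _ "Max (keys f)"]) (metis Max_ge Max_in finite_keys keys_eq_empty)

lemma lead_unique: "lead f \<mu> \<Longrightarrow> lead f \<nu> \<Longrightarrow> \<mu> = \<nu>"
  unfolding lead_def by force

lemma lead_nonzero: "lead f \<mu> \<Longrightarrow> f \<noteq> 0"
  unfolding lead_def by force

lemma sum_singles: "f = (\<Sum>\<mu>\<in>keys f. single \<mu> (lookup f \<mu>))"
proof (rule poly_mapping_eqI)
  fix \<nu>
  show "lookup f \<nu> = lookup (\<Sum>\<mu>\<in>keys f. single \<mu> (lookup f \<mu>)) \<nu>"
    by (simp add: lookup_sum lookup_single when_def in_keys_iff)
qed

lemma times_conv_sum:
  fixes f g :: "'m::monoid_add \<Rightarrow>\<^sub>0 'a::semiring_0"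
  shows "f * g = (\<Sum>\<mu>\<in>keys f. \<Sum>\<nu>\<in>keys g. single (\<mu> + \<nu>) (lookup f \<mu> * lookup g \<nu>))"
  by (subst (1) sum_singles[of f], subst (1) sum_singles[of g])
     (simp add: sum_product mult_single)

text \<open>
  The top monomials of the two factors are the only pair of monomials with that product, so their
  coefficient cannot cancel.
\<close>

lemma lead_mult:
  fixes f g :: "'m::{ordered_cancel_comm_monoid_add, linorder} \<Rightarrow>\<^sub>0 'a::semiring_no_zero_divisors"
  assumes "lead f \<mu>" "lead g \<nu>"
  shows "lead (f * g) (\<mu> + \<nu>)"
proof -
  have eq: "\<alpha> = \<mu> \<and> \<beta> = \<nu>" if "\<alpha> \<in> keys f" "\<beta> \<in> keys g" "\<alpha> + \<beta> = \<mu> + \<nu>" for \<alpha> \<beta>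
  proof -
    have "\<alpha> \<le> \<mu>" "\<beta> \<le> \<nu>"
      using that assms by (auto simp: lead_def)
    then show ?thesis
      using that(3) add_less_le_mono[of \<alpha> \<mu> \<beta> \<nu>] add_le_less_mono[of \<alpha> \<mu> \<beta> \<nu>]
      by (metis order_less_irrefl le_neq_trans)
  qed
  have "lookup (f * g) (\<mu> + \<nu>) =
      (\<Sum>\<alpha>\<in>keys f. \<Sum>\<beta>\<in>keys g. if \<alpha> = \<mu> then if \<beta> = \<nu> then lookup f \<mu> * lookup g \<nu> else 0 else 0)"
    unfolding times_conv_sum lookup_sum lookup_single when_def
    by (intro sum.cong refl) (use eq in auto)
  also have "\<dots> = (\<Sum>\<alpha>\<in>keys f. if \<alpha> = \<mu> then lookup f \<mu> * lookup g \<nu> else 0)"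
    using assms by (intro sum.cong refl) (simp add: lead_def)
  also have "\<dots> = lookup f \<mu> * lookup g \<nu>"
    using assms by (simp add: lead_def)
  finally have "\<mu> + \<nu> \<in> keys (f * g)"
    using assms by (simp add: lead_def in_keys_iff)
  moreover have "\<kappa> \<le> \<mu> + \<nu>" if "\<kappa> \<in> keys (f * g)" for \<kappa>
    using Poly_Mapping.keys_mult[of f g] that assms
    by (fastforce simp: lead_def intro: add_mono)
  ultimately show ?thesis
    by (simp add: lead_def)
qed

lemma lead_prod:
  fixes f :: "'i \<Rightarrow> 'm::{ordered_cancel_comm_monoid_add, linorder} \<Rightarrow>\<^sub>0 'a::idom"
  assumes "\<And>i. i \<in> I \<Longrightarrow> lead (f i) (\<mu> i)"
  shows "lead (\<Prod>i\<in>I. f i) (\<Sum>i\<in>I. \<mu> i)"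
proof (cases "finite I")
  case True
  then show ?thesis
    using assms by (induction I) (auto simp: lead_mult lead_def[of 1])
qed (auto simp: lead_def)

lemma lead_power:
  fixes f :: cpoly
  assumes "lead f (single v 1)"
  shows "lead (f ^ e) (single v e)"
proof (induction e)
  case (Suc e)
  then show ?case
    using lead_mult[OF assms Suc] by (simp add: single_add[symmetric])
qed (simp add: lead_def)

lemma keys_pvar [simp]: "keys (pvar v) = {single v 1}"
  by (simp add: pvar_def)

lemma pvar_neq: "v \<noteq> w \<Longrightarrow> pvar v \<noteq> pvar w"
  by (metis keys_pvar lookup_single_eq lookup_single_not_eq one_neq_zero singleton_insert_inj_eq)

lemma lead_diff_pvar:
  assumes "v < w"
  shows "lead (pvar v - pvar w) (single v 1)"
proof -
  have "single w 1 < (single v 1 :: mon)"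
    using assms by (intro mon_lessI[of _ v]) (auto simp: lookup_single when_def)
  moreover have "keys (pvar v - pvar w) = {single v 1, single w 1}"
    using calculation by (auto simp: in_keys_iff lookup_minus pvar_def lookup_single when_def split: if_splits)
  ultimately show ?thesis
    by (simp add: lead_def)
qed

lemma lookup_single_mult:
  fixes f :: "'m::cancel_comm_monoid_add \<Rightarrow>\<^sub>0 'a::semiring_0"
  shows "lookup (single \<mu> c * f) (\<mu> + \<nu>) = c * lookup f \<nu>"
proof -
  have "single \<mu> c * f = (\<Sum>\<kappa>\<in>keys f. single (\<mu> + \<kappa>) (c * lookup f \<kappa>))"
    by (subst (1) sum_singles[of f]) (simp add: sum_distrib_left mult_single)
  then have "lookup (single \<mu> c * f) (\<mu> + \<nu>) =
      (\<Sum>\<kappa>\<in>keys f. if \<kappa> = \<nu> then c * lookup f \<nu> else 0)"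
    by (auto simp: lookup_sum lookup_single when_def intro!: sum.cong)
  then show ?thesis
    by (simp add: in_keys_iff)
qed

lemma lookup_pvar_mult:
  "lookup (pvar v * f) \<mu> = (if lookup \<mu> v = 0 then 0 else lookup f (\<mu> - single v 1))"
proof (cases "lookup \<mu> v = 0")
  case True
  have "\<mu> \<notin> keys (pvar v * f)"
  proof
    assume "\<mu> \<in> keys (pvar v * f)"
    then obtain \<nu> where "\<mu> = single v 1 + \<nu>"
      using Poly_Mapping.keys_mult[of "pvar v" f] by auto
    then show False
      using True by (simp add: lookup_add)
  qed
  then show ?thesis
    using True by (simp add: in_keys_iff)
next
  case False
  have "\<mu> = single v 1 + (\<mu> - single v 1)"
    using False by (intro poly_mapping_eqI) (auto simp: lookup_add lookup_minus lookup_single when_def)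
  then show ?thesis
    using False lookup_single_mult[of "single v 1" 1 f "\<mu> - single v 1"] by (simp add: pvar_def)
qed

section \<open>Monomial substitutions\<close>

text \<open>
  The linear extension of a map on monomials. Permutations of the points and the substitution of
  one variable for another are both of this form, and for additive \<open>T\<close> it is a ring homomorphism.
\<close>

definition push :: "('m \<Rightarrow> 'm) \<Rightarrow> ('m \<Rightarrow>\<^sub>0 'a::comm_monoid_add) \<Rightarrow> ('m \<Rightarrow>\<^sub>0 'a)" where
  "push T f = (\<Sum>\<mu>\<in>keys f. single (T \<mu>) (lookup f \<mu>))"

lemma push_superset:
  assumes "finite S" "keys f \<subseteq> S"
  shows "push T f = (\<Sum>\<mu>\<in>S. single (T \<mu>) (lookup f \<mu>))"
  unfolding push_def using assms
  by (intro sum.mono_neutral_left) (auto simp: in_keys_iff)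

lemma push_zero [simp]: "push T 0 = 0"
  by (simp add: push_def)

lemma push_add: "push T (f + g) = push T f + push T g"
proof -
  have "keys (f + g) \<subseteq> keys f \<union> keys g"
    by (rule Poly_Mapping.keys_add)
  then show ?thesis
    by (simp add: push_superset[of "keys f \<union> keys g"] lookup_add single_add sum.distrib)
qed

lemma push_sum: "push T (\<Sum>i\<in>I. f i) = (\<Sum>i\<in>I. push T (f i))"
  by (induction I rule: infinite_finite_induct) (auto simp: push_add)

lemma push_single [simp]: "push T (single \<mu> c) = single (T \<mu>) c"
  by (cases "c = 0") (auto simp: push_def)

lemma push_mult:
  fixes f g :: "'m::monoid_add \<Rightarrow>\<^sub>0 'a::semiring_0"
  assumes "\<And>\<mu> \<nu>. T (\<mu> + \<nu>) = T \<mu> + T \<nu>"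
  shows "push T (f * g) = push T f * push T g"
proof -
  have "push T (f * g) = (\<Sum>\<mu>\<in>keys f. \<Sum>\<nu>\<in>keys g. single (T \<mu> + T \<nu>) (lookup f \<mu> * lookup g \<nu>))"
    unfolding times_conv_sum push_sum by (simp add: assms)
  also have "\<dots> = push T f * push T g"
    by (simp add: push_def sum_product mult_single)
  finally show ?thesis .
qed

text \<open>
  The inverse makes this the action that sends the variable \<open>v\<close> to \<open>permute_coord \<sigma> v\<close>, in
  accordance with \<open>permute_points\<close>.
\<close>

definition permute_mon :: "(nat \<Rightarrow> nat) \<Rightarrow> mon \<Rightarrow> mon" where
  "permute_mon \<sigma> \<mu> = Poly_Mapping.map_key (permute_coord (inv \<sigma>)) \<mu>"

lemma inj_permute_coord_inv: "bij \<sigma> \<Longrightarrow> inj (permute_coord (inv \<sigma>))"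
  by (simp add: bij_imp_bij_inv bij_is_inj inj_permute_coord)

lemma lookup_permute_mon:
  "bij \<sigma> \<Longrightarrow> lookup (permute_mon \<sigma> \<mu>) v = lookup \<mu> (permute_coord (inv \<sigma>) v)"
  by (simp add: permute_mon_def map_key.rep_eq inj_permute_coord_inv)

lemma permute_mon_add: "bij \<sigma> \<Longrightarrow> permute_mon \<sigma> (\<mu> + \<nu>) = permute_mon \<sigma> \<mu> + permute_mon \<sigma> \<nu>"
  by (rule poly_mapping_eqI) (simp add: lookup_permute_mon lookup_add)

lemma permute_coord_inv [simp]:
  "bij \<sigma> \<Longrightarrow> permute_coord (inv \<sigma>) (permute_coord \<sigma> v) = v"
  "bij \<sigma> \<Longrightarrow> permute_coord \<sigma> (permute_coord (inv \<sigma>) v) = v"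
  by (cases v; simp add: bij_is_inj bij_is_surj surj_f_inv_f)+

lemma lookup_permute_points_mon:
  assumes "bij \<sigma>"
  shows "lookup (permute_points \<sigma> f) (permute_mon \<sigma> \<mu>) = lookup f \<mu>"
proof -
  have "Poly_Mapping.map_key (permute_coord \<sigma>) (permute_mon \<sigma> \<mu>) = \<mu>"
    using assms
    by (intro poly_mapping_eqI)
      (simp add: map_key.rep_eq lookup_permute_mon bij_is_inj inj_permute_coord)
  then show ?thesis
    using assms by (simp add: permute_points_def map_key.rep_eq inj_map_key_permute_coord)
qed

lemma permute_mon_surj:
  assumes "bij \<sigma>"
  obtains \<nu> where "\<mu> = permute_mon \<sigma> \<nu>"
proof
  show "\<mu> = permute_mon \<sigma> (Poly_Mapping.map_key (permute_coord \<sigma>) \<mu>)"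
    using assms
    by (intro poly_mapping_eqI)
      (simp add: map_key.rep_eq lookup_permute_mon bij_is_inj inj_permute_coord)
qed

lemma permute_mon_inj: "bij \<sigma> \<Longrightarrow> permute_mon \<sigma> \<mu> = permute_mon \<sigma> \<nu> \<longleftrightarrow> \<mu> = \<nu>"
  by (metis lookup_permute_mon permute_coord_inv(1) poly_mapping_eqI)

lemma permute_points_conv_push:
  assumes "bij \<sigma>"
  shows "permute_points \<sigma> f = push (permute_mon \<sigma>) f"
proof (rule poly_mapping_eqI)
  fix \<mu>
  obtain \<nu> where \<nu>: "\<mu> = permute_mon \<sigma> \<nu>"
    using permute_mon_surj[OF assms] .
  show "lookup (permute_points \<sigma> f) \<mu> = lookup (push (permute_mon \<sigma>) f) \<mu>"
    unfolding \<nu> lookup_permute_points_mon[OF assms] push_def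
    by (simp add: lookup_sum lookup_single permute_mon_inj assms when_def in_keys_iff)
qed

lemma permute_points_mult:
  "bij \<sigma> \<Longrightarrow> permute_points \<sigma> (f * g) = permute_points \<sigma> f * permute_points \<sigma> g"
  by (simp add: permute_points_conv_push push_mult permute_mon_add)

lemma permute_points_add:
  "bij \<sigma> \<Longrightarrow> permute_points \<sigma> (f + g) = permute_points \<sigma> f + permute_points \<sigma> g"
  by (simp add: permute_points_conv_push push_add)

lemma permute_points_single:
  "bij \<sigma> \<Longrightarrow> permute_points \<sigma> (single \<mu> c) = single (permute_mon \<sigma> \<mu>) c"
  by (simp add: permute_points_conv_push)

lemma permute_mon_zero [simp]: "bij \<sigma> \<Longrightarrow> permute_mon \<sigma> 0 = 0"
  by (rule poly_mapping_eqI) (simp add: lookup_permute_mon)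

lemma permute_points_one [simp]: "bij \<sigma> \<Longrightarrow> permute_points \<sigma> 1 = 1"
  using permute_points_single[of \<sigma> 0 1] by simp

lemma permute_points_zero [simp]: "bij \<sigma> \<Longrightarrow> permute_points \<sigma> 0 = 0"
  by (simp add: permute_points_conv_push)

lemma permute_points_power:
  "bij \<sigma> \<Longrightarrow> permute_points \<sigma> (f ^ e) = permute_points \<sigma> f ^ e"
  by (induction e) (simp_all add: permute_points_mult)

lemma permute_points_prod:
  "bij \<sigma> \<Longrightarrow> permute_points \<sigma> (\<Prod>i\<in>I. f i) = (\<Prod>i\<in>I. permute_points \<sigma> (f i))"
  by (induction I rule: infinite_finite_induct) (simp_all add: permute_points_mult)

lemma permute_points_sum:
  "bij \<sigma> \<Longrightarrow> permute_points \<sigma> (\<Sum>i\<in>I. f i) = (\<Sum>i\<in>I. permute_points \<sigma> (f i))"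
  by (induction I rule: infinite_finite_induct) (simp_all add: permute_points_add)

lemma permute_points_cscale:
  assumes "bij \<sigma>" shows "permute_points \<sigma> (cscale c f) = cscale c (permute_points \<sigma> f)"
proof (rule poly_mapping_eqI)
  fix \<mu>
  obtain \<nu> where "\<mu> = permute_mon \<sigma> \<nu>"
    using permute_mon_surj[OF assms] .
  then show "lookup (permute_points \<sigma> (cscale c f)) \<mu> = lookup (cscale c (permute_points \<sigma> f)) \<mu>"
    using assms by (simp add: lookup_permute_points_mon)
qed

lemma permute_points_uminus:
  assumes "bij \<sigma>" shows "permute_points \<sigma> (- f) = - permute_points \<sigma> f"
  using permute_points_add[OF assms, of f "-f"] assms by (simp add: eq_neg_iff_add_eq_0 add.commute)

lemma permute_points_diff:
  assumes "bij \<sigma>" shows "permute_points \<sigma> (f - g) = permute_points \<sigma> f - permute_points \<sigma> g"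
  using permute_points_add[OF assms, of f "-g"] assms by (simp add: permute_points_uminus)

lemma permute_mon_single:
  assumes "bij \<sigma>"
  shows "permute_mon \<sigma> (single v e) = single (permute_coord \<sigma> v) e"
proof (rule poly_mapping_eqI)
  fix w
  have "v = permute_coord (inv \<sigma>) w \<longleftrightarrow> permute_coord \<sigma> v = w"
    using assms by auto
  then show "lookup (permute_mon \<sigma> (single v e)) w = lookup (single (permute_coord \<sigma> v) e) w"
    by (simp add: lookup_permute_mon assms lookup_single when_def)
qed

lemma permute_mon_sum:
  "bij \<sigma> \<Longrightarrow> permute_mon \<sigma> (\<Sum>i\<in>I. f i) = (\<Sum>i\<in>I. permute_mon \<sigma> (f i))"
  by (induction I rule: infinite_finite_induct) (simp_all add: permute_mon_add)

lemma permute_points_compose: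
  assumes "bij \<sigma>" "bij \<tau>"
  shows "permute_points (\<sigma> \<circ> \<tau>) f = permute_points \<sigma> (permute_points \<tau> f)"
proof (rule poly_mapping_eqI)
  fix \<mu>
  have b: "bij (\<sigma> \<circ> \<tau>)"
    using assms by (simp add: bij_comp)
  obtain \<nu> where \<nu>: "\<mu> = permute_mon (\<sigma> \<circ> \<tau>) \<nu>"
    using permute_mon_surj[OF b] .
  have "permute_mon (\<sigma> \<circ> \<tau>) \<nu> = permute_mon \<sigma> (permute_mon \<tau> \<nu>)"
  proof (rule poly_mapping_eqI)
    fix v
    show "lookup (permute_mon (\<sigma> \<circ> \<tau>) \<nu>) v = lookup (permute_mon \<sigma> (permute_mon \<tau> \<nu>)) v"
      using assms b by (cases v) (simp_all add: lookup_permute_mon o_inv_distrib)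
  qed
  then show "lookup (permute_points (\<sigma> \<circ> \<tau>) f) \<mu> = lookup (permute_points \<sigma> (permute_points \<tau> f)) \<mu>"
    using assms b by (metis \<nu> lookup_permute_points_mon)
qed

text \<open>
  Moving the larger exponent pair to the larger index raises a monomial. Hence leading monomials of
  polynomials that are symmetric up to a scalar are sorted (\<open>lead_sorted\<close>).
\<close>

lemma mon_less_transpose:
  fixes \<mu> :: mon
  assumes "i < j"
    and "lookup \<mu> (XVar j) < lookup \<mu> (XVar i) \<or>
      lookup \<mu> (XVar i) = lookup \<mu> (XVar j) \<and> lookup \<mu> (YVar j) < lookup \<mu> (YVar i)"
  shows "\<mu> < permute_mon (transpose i j) \<mu>"
  using assms(2)
proof
  assume *: "lookup \<mu> (XVar j) < lookup \<mu> (XVar i)"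
  show ?thesis
  proof (rule mon_lessI[of _ "XVar j"])
    fix w assume "w < XVar j"
    then show "lookup \<mu> w = lookup (permute_mon (transpose i j) \<mu>) w"
      using assms(1) by (cases w) (auto simp: lookup_permute_mon transpose_def)
  qed (use * in \<open>simp add: lookup_permute_mon\<close>)
next
  assume *: "lookup \<mu> (XVar i) = lookup \<mu> (XVar j) \<and> lookup \<mu> (YVar j) < lookup \<mu> (YVar i)"
  show ?thesis
  proof (rule mon_lessI[of _ "YVar j"])
    fix w assume "w < YVar j"
    then show "lookup \<mu> w = lookup (permute_mon (transpose i j) \<mu>) w"
      using assms(1) * by (cases w) (auto simp: lookup_permute_mon transpose_def)
  qed (use * in \<open>simp add: lookup_permute_mon\<close>)
qed

lemma lead_sorted:
  assumes "permute_points (transpose i j) f = cscale c f" "i < j" "lead f \<mu>"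
  shows "lookup \<mu> (XVar i) \<le> lookup \<mu> (XVar j)"
    and "lookup \<mu> (XVar i) = lookup \<mu> (XVar j) \<Longrightarrow> lookup \<mu> (YVar i) \<le> lookup \<mu> (YVar j)"
proof -
  have "lookup f \<mu> = c * lookup f (permute_mon (transpose i j) \<mu>)"
    using lookup_permute_points_mon[of "transpose i j" f \<mu>] assms(1) by simp
  moreover have "lookup f \<mu> \<noteq> 0"
    using assms(3) by (simp add: lead_def in_keys_iff)
  ultimately have "permute_mon (transpose i j) \<mu> \<in> keys f"
    by (auto simp: in_keys_iff)
  then have "\<not> \<mu> < permute_mon (transpose i j) \<mu>"
    using assms(3) by (auto simp: lead_def not_less)
  then show "lookup \<mu> (XVar i) \<le> lookup \<mu> (XVar j)"
    and "lookup \<mu> (XVar i) = lookup \<mu> (XVar j) \<Longrightarrow> lookup \<mu> (YVar i) \<le> lookup \<mu> (YVar j)"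
    using mon_less_transpose[OF assms(2)] by (meson not_less)+
qed

section \<open>Divisibility by differences of variables\<close>

text \<open>
  The effect of the substitution of \<open>w\<close> for \<open>v\<close> on exponents.
\<close>

definition merge_var :: "coord \<Rightarrow> coord \<Rightarrow> mon \<Rightarrow> mon" where
  "merge_var v w \<mu> = (\<mu> - single v (lookup \<mu> v)) + single w (lookup \<mu> v)"

lemma merge_var_add: "merge_var v w (\<mu> + \<nu>) = merge_var v w \<mu> + merge_var v w \<nu>"
  by (rule poly_mapping_eqI)
    (simp add: merge_var_def lookup_add lookup_minus lookup_single when_def)

lemma push_merge_mult: "push (merge_var v w) (f * g) = push (merge_var v w) f * push (merge_var v w) g"
  by (rule push_mult) (rule merge_var_add)

lemma push_merge_pvar:
  "push (merge_var v w) (pvar u) = (if u = v then pvar w else pvar u)"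
  by (auto simp: pvar_def merge_var_def lookup_single when_def)

lemma push_uminus:
  fixes f :: "'m \<Rightarrow>\<^sub>0 'a::ab_group_add"
  shows "push T (- f) = - push T f"
  using push_add[of T f "-f"] by (simp add: eq_neg_iff_add_eq_0 add.commute)

lemma push_diff:
  fixes f :: "'m \<Rightarrow>\<^sub>0 'a::ab_group_add"
  shows "push T (f - g) = push T f - push T g"
  using push_add[of T f "-g"] by (simp add: push_uminus)

lemma push_merge_one [simp]: "push (merge_var v w) 1 = (1 :: cpoly)"
proof -
  have "merge_var v w 0 = 0"
    by (simp add: merge_var_def)
  then show ?thesis
    by (metis push_single single_one)
qed

lemma push_merge_power: "push (merge_var v w) (f ^ e) = push (merge_var v w) f ^ e"
  for f :: cpoly
  by (induction e) (simp_all add: push_merge_mult)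

lemma push_merge_prod: "push (merge_var v w) (\<Prod>i\<in>I. f i) = (\<Prod>i\<in>I. push (merge_var v w) (f i))"
  for f :: "_ \<Rightarrow> cpoly"
  by (induction I rule: infinite_finite_induct) (simp_all add: push_merge_mult)

lemma pvar_power: "pvar v ^ e = single (single v e) 1"
  by (induction e) (simp_all add: pvar_def mult_single single_add[symmetric])

lemma diff_dvd_diff_power: "x - y dvd x ^ e - (y :: 'a::comm_ring_1) ^ e"
  by (simp only: power_diff_sumr2 dvd_triv_left)

lemma diff_pvar_dvd_minus_merge: "pvar v - pvar w dvd f - push (merge_var v w) f"
proof -
  have "pvar v - pvar w dvd single \<mu> c - single (merge_var v w \<mu>) c" for \<mu> and c :: complex
  proof -
    let ?e = "lookup \<mu> v" and ?r = "\<mu> - single v (lookup \<mu> v)"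
    have "\<mu> = ?r + single v ?e"
      by (rule poly_mapping_eqI) (simp add: lookup_add lookup_minus lookup_single when_def)
    then have "single \<mu> c - single (merge_var v w \<mu>) c = single ?r c * (pvar v ^ ?e - pvar w ^ ?e)"
      unfolding pvar_power right_diff_distrib mult_single
      by (metis merge_var_def mult.right_neutral)
    then show ?thesis
      by (simp add: diff_dvd_diff_power)
  qed
  moreover have "f - push (merge_var v w) f =
      (\<Sum>\<mu>\<in>keys f. single \<mu> (lookup f \<mu>) - single (merge_var v w \<mu>) (lookup f \<mu>))"
    unfolding sum_subtractf push_def using sum_singles[of f] by simp
  ultimately show ?thesis
    by (metis (no_types, lifting) dvd_sum)
qed

text \<open>
  The factor theorem. As the ring has no zero divisors, it shows that the difference of two
  variables is a prime element, and it decides divisibility by a substitution.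
\<close>

lemma diff_pvar_dvd_iff: "pvar v - pvar w dvd f \<longleftrightarrow> push (merge_var v w) f = 0"
proof
  assume "pvar v - pvar w dvd f"
  then obtain g where "f = (pvar v - pvar w) * g" ..
  then show "push (merge_var v w) f = 0"
    by (simp add: push_merge_mult push_diff push_merge_pvar)
qed (use diff_pvar_dvd_minus_merge[of v w f] in simp)

lemma diff_pvar_power_dvd_mult_cancel:
  assumes "v \<noteq> w" "push (merge_var v w) g \<noteq> 0" "(pvar v - pvar w) ^ e dvd g * h"
  shows "(pvar v - pvar w) ^ e dvd h"
  using assms(3)
proof (induction e arbitrary: h)
  case (Suc e)
  have nz: "pvar v - pvar w \<noteq> 0"
    using pvar_neq[OF assms(1)] by simp
  have "pvar v - pvar w dvd g * h"
    using Suc.prems unfolding power_Suc by (rule dvd_mult_left)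
  then have "pvar v - pvar w dvd h"
    using assms(2) by (simp add: diff_pvar_dvd_iff push_merge_mult)
  then obtain h' where h': "h = (pvar v - pvar w) * h'" ..
  then have "(pvar v - pvar w) ^ e dvd g * h'"
    using Suc.prems nz unfolding h' power_Suc mult.left_commute[of g] by (auto simp only: dvd_mult_cancel_left)
  then have "(pvar v - pvar w) ^ e dvd h'"
    by (rule Suc.IH)
  then show ?case
    unfolding h' power_Suc by (rule mult_dvd_mono[OF dvd_refl])
qed simp

text \<open>
  The factors are pairwise coprime: setting \<open>v\<close> to one of the \<open>w\<close> does not annihilate the factors
  that belong to the others.
\<close>

lemma prod_diff_pvar_dvd:
  assumes "finite S" "v \<notin> S" "\<And>w. w \<in> S \<Longrightarrow> (pvar v - pvar w) ^ e w dvd f"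
  shows "(\<Prod>w\<in>S. (pvar v - pvar w) ^ e w) dvd f"
  using assms
proof (induction S)
  case (insert w S)
  then have "(\<Prod>w\<in>S. (pvar v - pvar w) ^ e w) dvd f"
    by simp
  then obtain h where h: "f = (\<Prod>w\<in>S. (pvar v - pvar w) ^ e w) * h" ..
  have "push (merge_var v w) (\<Prod>w\<in>S. (pvar v - pvar w) ^ e w) =
      (\<Prod>u\<in>S. (pvar w - pvar u) ^ e u)"
    unfolding push_merge_prod using insert.prems
    by (intro prod.cong refl) (auto simp: push_merge_power push_diff push_merge_pvar)
  also have "\<dots> \<noteq> 0"
    using insert.hyps pvar_neq[of w] by fastforce
  finally have nz: "push (merge_var v w) (\<Prod>w\<in>S. (pvar v - pvar w) ^ e w) \<noteq> 0" .
  have "v \<noteq> w" "(pvar v - pvar w) ^ e w dvd f"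
    using insert.prems by auto
  then have "(pvar v - pvar w) ^ e w dvd h"
    using diff_pvar_power_dvd_mult_cancel[OF _ nz] h by blast
  then have "(pvar v - pvar w) ^ e w * (\<Prod>w\<in>S. (pvar v - pvar w) ^ e w) dvd
      h * (\<Prod>w\<in>S. (pvar v - pvar w) ^ e w)"
    by (rule mult_dvd_mono[OF _ dvd_refl])
  then show ?case
    unfolding prod.insert[OF insert.hyps] by (simp only: h mult.commute[of _ h])
qed simp

section \<open>Coefficients with respect to the x-variables\<close>

definition x_only :: "mon \<Rightarrow> bool" where
  "x_only \<mu> \<longleftrightarrow> (\<forall>i. lookup \<mu> (YVar i) = 0)"

definition y_only :: "mon \<Rightarrow> bool" where
  "y_only \<mu> \<longleftrightarrow> (\<forall>i. lookup \<mu> (XVar i) = 0)"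

definition x_part :: "mon \<Rightarrow> mon" where
  "x_part \<mu> = Poly_Mapping.mapp (\<lambda>v e. case v of XVar _ \<Rightarrow> e | YVar _ \<Rightarrow> 0) \<mu>"

definition y_part :: "mon \<Rightarrow> mon" where
  "y_part \<mu> = Poly_Mapping.mapp (\<lambda>v e. case v of XVar _ \<Rightarrow> 0 | YVar _ \<Rightarrow> e) \<mu>"

lemma lookup_x_part [simp]:
  "lookup (x_part \<mu>) (XVar i) = lookup \<mu> (XVar i)" "lookup (x_part \<mu>) (YVar i) = 0"
  by (auto simp: x_part_def lookup_mapp when_def in_keys_iff)

lemma lookup_y_part [simp]:
  "lookup (y_part \<mu>) (XVar i) = 0" "lookup (y_part \<mu>) (YVar i) = lookup \<mu> (YVar i)"
  by (auto simp: y_part_def lookup_mapp when_def in_keys_iff)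

lemma x_only_x_part [simp]: "x_only (x_part \<mu>)"
  by (simp add: x_only_def)

lemma y_only_y_part [simp]: "y_only (y_part \<mu>)"
  by (simp add: y_only_def)

lemma mon_eqI_XY:
  assumes "\<And>i. lookup \<mu> (XVar i) = lookup \<nu> (XVar i)" "\<And>i. lookup \<mu> (YVar i) = lookup \<nu> (YVar i)"
  shows "\<mu> = (\<nu> :: mon)"
proof (rule poly_mapping_eqI)
  fix v show "lookup \<mu> v = lookup \<nu> v"
    using assms by (cases v) auto
qed

lemma x_part_plus_y_part: "x_part \<mu> + y_part \<mu> = \<mu>"
  by (rule mon_eqI_XY) (simp_all add: lookup_add)

lemma x_part_eq: "x_only \<alpha> \<Longrightarrow> y_only \<beta> \<Longrightarrow> x_part (\<alpha> + \<beta>) = \<alpha>"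
  by (rule mon_eqI_XY) (simp_all add: lookup_add x_only_def y_only_def)

text \<open>
  The x-variables are the significant ones, so the x-part of the leading monomial is the largest
  x-monomial with a nonzero coefficient.
\<close>

lemma x_dominates:
  assumes "x_only \<alpha>" "x_only \<alpha>'" "y_only \<beta>" "y_only \<beta>'" "\<alpha> < \<alpha>'"
  shows "\<alpha> + \<beta> < \<alpha>' + \<beta>'"
proof -
  obtain v where v: "lookup \<alpha> v < lookup \<alpha>' v" "\<And>w. w < v \<Longrightarrow> lookup \<alpha> w = lookup \<alpha>' w"
    by (rule mon_lessE[OF assms(5)]) (rule that)
  obtain i where i: "v = XVar i"
    using v(1) assms(2) by (cases v) (auto simp: x_only_def)
  show ?thesis
  proof (rule mon_lessI)
    show "lookup (\<alpha> + \<beta>) v < lookup (\<alpha>' + \<beta>') v"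
      using v(1) i assms by (simp add: lookup_add y_only_def)
    fix w assume "w < v"
    then show "lookup (\<alpha> + \<beta>) w = lookup (\<alpha>' + \<beta>') w"
      using v(2)[of w] i assms by (cases w) (simp_all add: lookup_add y_only_def)
  qed
qed

text \<open>
  Polynomials are regarded as polynomials in the x-variables whose coefficients are polynomials in
  the y-variables; this is the coefficient of an x-monomial.
\<close>

definition x_coeff :: "mon \<Rightarrow> cpoly \<Rightarrow> cpoly" where
  "x_coeff \<alpha> f = Abs_poly_mapping (\<lambda>\<nu>. if y_only \<nu> then lookup f (\<alpha> + \<nu>) else 0)"

lemma lookup_x_coeff: "lookup (x_coeff \<alpha> f) \<nu> = (if y_only \<nu> then lookup f (\<alpha> + \<nu>) else 0)"
proof -
  have "finite ((\<lambda>\<nu>. \<alpha> + \<nu>) -` keys f)"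
    by (rule finite_vimageI) (auto intro: injI)
  moreover have "{\<nu>. (if y_only \<nu> then lookup f (\<alpha> + \<nu>) else 0) \<noteq> 0} \<subseteq> (\<lambda>\<nu>. \<alpha> + \<nu>) -` keys f"
    by (auto simp: in_keys_iff)
  ultimately have "finite {\<nu>. (if y_only \<nu> then lookup f (\<alpha> + \<nu>) else 0) \<noteq> 0}"
    by (rule finite_subset[rotated])
  then show ?thesis
    unfolding x_coeff_def by (simp only: lookup_Abs_poly_mapping)
qed

lemma x_coeff_add: "x_coeff \<alpha> (f + g) = x_coeff \<alpha> f + x_coeff \<alpha> g"
  by (rule poly_mapping_eqI) (simp add: lookup_x_coeff lookup_add)

lemma x_coeff_diff: "x_coeff \<alpha> (f - g) = x_coeff \<alpha> f - x_coeff \<alpha> g"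
  by (rule poly_mapping_eqI) (simp add: lookup_x_coeff lookup_minus)

lemma x_coeff_uminus: "x_coeff \<alpha> (- f) = - x_coeff \<alpha> f"
  by (rule poly_mapping_eqI) (simp add: lookup_x_coeff)

lemma x_coeff_cscale: "x_coeff \<alpha> (cscale c f) = cscale c (x_coeff \<alpha> f)"
  by (rule poly_mapping_eqI) (simp add: lookup_x_coeff)

lemma x_coeff_XVar_mult:
  "x_coeff \<alpha> (pvar (XVar j) * f) =
    (if lookup \<alpha> (XVar j) = 0 then 0 else x_coeff (\<alpha> - single (XVar j) 1) f)"
proof (rule poly_mapping_eqI)
  fix \<nu>
  have "\<alpha> + \<nu> - single (XVar j) 1 = \<alpha> - single (XVar j) 1 + \<nu>" if "lookup \<alpha> (XVar j) \<noteq> 0"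
    using that by (intro poly_mapping_eqI) (auto simp: lookup_add lookup_minus lookup_single when_def)
  then show "lookup (x_coeff \<alpha> (pvar (XVar j) * f)) \<nu> = lookup (if lookup \<alpha> (XVar j) = 0 then 0
      else x_coeff (\<alpha> - single (XVar j) 1) f) \<nu>"
    by (auto simp: lookup_x_coeff lookup_pvar_mult lookup_add y_only_def)
qed

lemma x_coeff_YVar_mult:
  assumes "x_only \<alpha>"
  shows "x_coeff \<alpha> (pvar (YVar j) * f) = pvar (YVar j) * x_coeff \<alpha> f"
proof (rule poly_mapping_eqI)
  fix \<nu>
  have "\<alpha> + \<nu> - single (YVar j) 1 = \<alpha> + (\<nu> - single (YVar j) 1)" if "lookup \<nu> (YVar j) \<noteq> 0"
    using that by (intro poly_mapping_eqI) (auto simp: lookup_add lookup_minus lookup_single when_def)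
  moreover have "y_only (\<nu> - single (YVar j) 1) \<longleftrightarrow> y_only \<nu>"
    by (auto simp: y_only_def lookup_minus lookup_single when_def)
  ultimately show "lookup (x_coeff \<alpha> (pvar (YVar j) * f)) \<nu> = lookup (pvar (YVar j) * x_coeff \<alpha> f) \<nu>"
    using assms by (auto simp: lookup_x_coeff lookup_pvar_mult lookup_add x_only_def)
qed

lemma x_coeff_diff_YVar_power_mult:
  assumes "x_only \<alpha>"
  shows "x_coeff \<alpha> ((pvar (YVar j) - pvar (YVar i)) ^ e * f) =
    (pvar (YVar j) - pvar (YVar i)) ^ e * x_coeff \<alpha> f"
  using assms
  by (induction e) (simp_all add: left_diff_distrib x_coeff_diff x_coeff_YVar_mult mult.assoc)

lemma x_coeff_permute:
  assumes "bij \<sigma>"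
  shows "x_coeff (permute_mon \<sigma> \<alpha>) (permute_points \<sigma> f) = permute_points \<sigma> (x_coeff \<alpha> f)"
proof (rule poly_mapping_eqI)
  fix \<mu>
  obtain \<nu> where \<nu>: "\<mu> = permute_mon \<sigma> \<nu>"
    using permute_mon_surj[OF assms] .
  have "y_only \<mu> \<longleftrightarrow> y_only \<nu>"
  proof
    assume y: "y_only \<mu>"
    have "lookup \<nu> (XVar i) = lookup \<mu> (XVar (\<sigma> i))" for i
      using assms by (simp add: \<nu> lookup_permute_mon bij_is_inj)
    then show "y_only \<nu>"
      using y by (simp add: y_only_def)
  qed (use assms in \<open>simp add: \<nu> y_only_def lookup_permute_mon\<close>)
  then show "lookup (x_coeff (permute_mon \<sigma> \<alpha>) (permute_points \<sigma> f)) \<mu> =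
      lookup (permute_points \<sigma> (x_coeff \<alpha> f)) \<mu>"
    using assms by (simp add: lookup_x_coeff \<nu> permute_mon_add[symmetric] lookup_permute_points_mon)
qed

lemma x_only_permute [simp]: "bij \<sigma> \<Longrightarrow> x_only \<alpha> \<Longrightarrow> x_only (permute_mon \<sigma> \<alpha>)"
  by (simp add: x_only_def lookup_permute_mon)

lemma lead_x_coeff:
  assumes "lead f \<mu>"
  shows "lead (x_coeff (x_part \<mu>) f) (y_part \<mu>)"
proof -
  have "lookup (x_coeff (x_part \<mu>) f) (y_part \<mu>) \<noteq> 0"
    using assms by (simp add: lookup_x_coeff x_part_plus_y_part lead_def in_keys_iff)
  moreover have "\<nu> \<le> y_part \<mu>" if "\<nu> \<in> keys (x_coeff (x_part \<mu>) f)" for \<nu>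
  proof -
    have "x_part \<mu> + \<nu> \<in> keys f"
      using that by (simp add: in_keys_iff lookup_x_coeff split: if_splits)
    then have "x_part \<mu> + \<nu> \<le> x_part \<mu> + y_part \<mu>"
      using assms by (simp add: lead_def x_part_plus_y_part)
    then show ?thesis
      by simp
  qed
  ultimately show ?thesis
    by (simp add: lead_def in_keys_iff)
qed

section \<open>Leading x-monomials modulo a polynomial\<close>

text \<open>
  The x-monomials of \<open>f\<close> over the coefficient ring \<open>\<complex>[y]/(\<delta>)\<close>. That ring has zero divisors when
  \<open>\<delta>\<close> is a proper power, so leading x-monomials are not multiplicative in general; they are for
  the monic factors \<open>x\<^sub>j - x\<^sub>i\<close> below.
\<close>

definition x_support_mod :: "cpoly \<Rightarrow> cpoly \<Rightarrow> mon set" where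
  "x_support_mod \<delta> f = {\<alpha>. x_only \<alpha> \<and> \<not> \<delta> dvd x_coeff \<alpha> f}"

definition lead_mod :: "cpoly \<Rightarrow> cpoly \<Rightarrow> mon \<Rightarrow> bool" where
  "lead_mod \<delta> f \<alpha> \<longleftrightarrow> \<alpha> \<in> x_support_mod \<delta> f \<and> (\<forall>\<beta>\<in>x_support_mod \<delta> f. \<beta> \<le> \<alpha>)"

lemma lead_mod_exists:
  assumes "x_support_mod \<delta> f \<noteq> {}"
  shows "\<exists>\<alpha>. lead_mod \<delta> f \<alpha>"
proof -
  have "x_support_mod \<delta> f \<subseteq> x_part ` keys f"
  proof
    fix \<alpha> assume \<alpha>: "\<alpha> \<in> x_support_mod \<delta> f"
    then have "x_coeff \<alpha> f \<noteq> 0"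
      by (auto simp: x_support_mod_def)
    then obtain \<nu> where "lookup (x_coeff \<alpha> f) \<nu> \<noteq> 0"
      by (metis lookup_zero poly_mapping_eqI)
    then have "y_only \<nu>" "\<alpha> + \<nu> \<in> keys f"
      by (auto simp: lookup_x_coeff in_keys_iff split: if_splits)
    moreover have "x_part (\<alpha> + \<nu>) = \<alpha>"
      using \<alpha> \<open>y_only \<nu>\<close> by (intro x_part_eq) (auto simp: x_support_mod_def)
    ultimately show "\<alpha> \<in> x_part ` keys f"
      by force
  qed
  then have "finite (x_support_mod \<delta> f)"
    using finite_surj finite_keys by blast
  then show ?thesis
    unfolding lead_mod_def using assms
    by (intro exI[of _ "Max (x_support_mod \<delta> f)"]) auto
qed

lemma lead_mod_unique: "lead_mod \<delta> f \<alpha> \<Longrightarrow> lead_mod \<delta> f \<beta> \<Longrightarrow> \<alpha> = \<beta>"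
  unfolding lead_mod_def by force

lemma single_XVar_less:
  assumes "i < j" shows "single (XVar i) 1 < (single (XVar j) 1 :: mon)"
  by (rule mon_lessI[of _ "XVar j"]) (use assms in \<open>auto simp: lookup_single when_def\<close>)

lemma x_coeff_diff_XVar_mult:
  "x_coeff \<alpha> ((pvar (XVar j) - pvar (XVar i)) * f) =
    (if lookup \<alpha> (XVar j) = 0 then 0 else x_coeff (\<alpha> - single (XVar j) 1) f) -
    (if lookup \<alpha> (XVar i) = 0 then 0 else x_coeff (\<alpha> - single (XVar i) 1) f)"
  by (simp only: left_diff_distrib x_coeff_diff x_coeff_XVar_mult)

lemma x_only_minus [simp]: "x_only \<alpha> \<Longrightarrow> x_only (\<alpha> - \<beta>)"
  by (simp add: x_only_def lookup_minus)

lemma mon_minus_single_add: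
  "lookup \<alpha> v \<noteq> 0 \<Longrightarrow> \<alpha> - single v 1 + single v 1 = (\<alpha> :: mon)"
  by (rule poly_mapping_eqI) (auto simp: lookup_add lookup_minus lookup_single when_def)

text \<open>
  The leading x-monomial of \<open>x\<^sub>j - x\<^sub>i\<close> has coefficient \<open>1\<close>, so multiplication by it shifts the leading
  x-monomial over every coefficient ring.
\<close>

lemma lead_mod_diff_XVar_mult:
  assumes "i < j" "lead_mod \<delta> f \<alpha>"
  shows "lead_mod \<delta> ((pvar (XVar j) - pvar (XVar i)) * f) (\<alpha> + single (XVar j) 1)"
proof -
  let ?u = "pvar (XVar j) - pvar (XVar i)"
  have less: "\<beta> + single (XVar i) 1 < \<beta> + single (XVar j) 1" for \<beta> :: mon
    using single_XVar_less[OF assms(1)] by simp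
  have x: "x_only \<alpha>" and nd: "\<not> \<delta> dvd x_coeff \<alpha> f"
    using assms(2) by (auto simp: lead_mod_def x_support_mod_def)
  have above: "\<delta> dvd x_coeff \<beta> f" if "x_only \<beta>" "\<alpha> < \<beta>" for \<beta>
    using assms(2) that by (force simp: lead_mod_def x_support_mod_def)
  define \<alpha>' where "\<alpha>' = \<alpha> + single (XVar j) 1"
  have x': "x_only \<alpha>'"
    using x by (simp add: \<alpha>'_def x_only_def lookup_add lookup_single when_def)
  have "\<not> \<delta> dvd x_coeff \<alpha>' (?u * f)"
  proof
    assume "\<delta> dvd x_coeff \<alpha>' (?u * f)"
    moreover have "\<delta> dvd (if lookup \<alpha>' (XVar i) = 0 then 0 else x_coeff (\<alpha>' - single (XVar i) 1) f)"
    proof (cases "lookup \<alpha>' (XVar i) = 0")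
      case False
      then have "\<alpha>' - single (XVar i) 1 + single (XVar i) 1 = \<alpha> + single (XVar j) 1"
        using mon_minus_single_add[OF False] by (simp only: \<alpha>'_def)
      then have "\<alpha> < \<alpha>' - single (XVar i) 1"
        using less[of \<alpha>] by (metis add_less_cancel_right)
      then show ?thesis
        using above x' by simp
    qed simp
    moreover have "lookup \<alpha>' (XVar j) \<noteq> 0" "\<alpha>' - single (XVar j) 1 = \<alpha>"
      by (simp_all add: \<alpha>'_def lookup_add)
    ultimately have "\<delta> dvd x_coeff \<alpha> f"
      unfolding x_coeff_diff_XVar_mult
      by (simp only: if_False) (metis dvd_add diff_add_cancel)
    then show False
      using nd by simp
  qed
  moreover have "\<delta> dvd x_coeff \<beta> (?u * f)" if \<beta>: "x_only \<beta>" "\<alpha>' < \<beta>" for \<beta>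
  proof -
    have "\<delta> dvd (if lookup \<beta> (XVar l) = 0 then 0 else x_coeff (\<beta> - single (XVar l) 1) f)"
      if l: "l = i \<or> l = j" for l
    proof (cases "lookup \<beta> (XVar l) = 0")
      case False
      have "\<alpha> + single (XVar l) 1 \<le> \<alpha>'"
        using l less[of \<alpha>] by (auto simp: \<alpha>'_def)
      then have "\<alpha> + single (XVar l) 1 < \<beta> - single (XVar l) 1 + single (XVar l) 1"
        using \<beta>(2) mon_minus_single_add[OF False] by (metis order_le_less_trans)
      then show ?thesis
        using above \<beta>(1) by simp
    qed simp
    then show ?thesis
      unfolding x_coeff_diff_XVar_mult by (intro dvd_diff) auto
  qed
  ultimately show ?thesis
    using x' unfolding lead_mod_def x_support_mod_def \<alpha>'_def[symmetric]
    by (auto simp: not_less[symmetric])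
qed

lemma lead_mod_diff_XVar_power_mult:
  assumes "i < j" "lead_mod \<delta> f \<alpha>"
  shows "lead_mod \<delta> ((pvar (XVar j) - pvar (XVar i)) ^ c * f) (\<alpha> + single (XVar j) c)"
proof (induction c)
  case (Suc c)
  have "\<alpha> + single (XVar j) (Suc c) = \<alpha> + single (XVar j) c + single (XVar j) 1"
    by (simp add: add.assoc single_add[symmetric])
  then show ?case
    using lead_mod_diff_XVar_mult[OF assms(1) Suc] by (simp add: mult.assoc)
qed (use assms in simp)

lemma x_support_mod_empty_mult:
  assumes "x_support_mod \<delta> f = {}"
  shows "x_support_mod \<delta> ((pvar (XVar j) - pvar (XVar i)) ^ c * f) = {}"
proof (induction c)
  case (Suc c)
  let ?f = "(pvar (XVar j) - pvar (XVar i)) ^ c * f"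
  have "\<delta> dvd x_coeff \<alpha> ?f" if "x_only \<alpha>" for \<alpha>
    using Suc that by (auto simp: x_support_mod_def)
  then have "\<delta> dvd x_coeff \<alpha> ((pvar (XVar j) - pvar (XVar i)) * ?f)" if "x_only \<alpha>" for \<alpha>
    unfolding x_coeff_diff_XVar_mult using that by (intro dvd_diff) auto
  then show ?case
    by (auto simp: x_support_mod_def mult.assoc)
qed (use assms in simp)

lemma lead_mod_lead:
  assumes "lead f \<mu>" "\<not> \<delta> dvd x_coeff (x_part \<mu>) f"
  shows "lead_mod \<delta> f (x_part \<mu>)"
proof -
  have "\<beta> \<le> x_part \<mu>" if "\<beta> \<in> x_support_mod \<delta> f" for \<beta>
  proof (rule ccontr)
    assume "\<not> \<beta> \<le> x_part \<mu>"
    have "x_coeff \<beta> f \<noteq> 0" and x: "x_only \<beta>"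
      using that by (auto simp: x_support_mod_def)
    then obtain \<nu> where "lookup (x_coeff \<beta> f) \<nu> \<noteq> 0"
      by (metis lookup_zero poly_mapping_eqI)
    then have \<nu>: "y_only \<nu>" "\<beta> + \<nu> \<in> keys f"
      by (auto simp: lookup_x_coeff in_keys_iff split: if_splits)
    have "x_part \<mu> + y_part \<mu> < \<beta> + \<nu>"
      using \<open>\<not> \<beta> \<le> x_part \<mu>\<close> x \<nu> by (intro x_dominates) auto
    then show False
      using assms(1) \<nu>(2) by (simp add: lead_def x_part_plus_y_part not_less[symmetric])
  qed
  then show ?thesis
    using assms(2) by (simp add: lead_mod_def x_support_mod_def)
qed

text \<open>
  Modulo the power \<open>e\<close> of \<open>y\<^sub>j - y\<^sub>i\<close> only the second summand survives, so the exponent \<open>c\<close> is visible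
  in the leading x-monomial, unless the leading coefficient vanishes modulo that power.
\<close>

lemma lead_mod_decomposition:
  assumes "i < j" "lead f \<mu>"
    and f: "f = (pvar (YVar j) - pvar (YVar i)) ^ e * F + (pvar (XVar j) - pvar (XVar i)) ^ c * G"
    and nd: "\<not> (pvar (YVar j) - pvar (YVar i)) ^ e dvd x_coeff (x_part \<mu>) f"
  obtains \<gamma> where "lead_mod ((pvar (YVar j) - pvar (YVar i)) ^ e) G \<gamma>"
    "x_part \<mu> = \<gamma> + single (XVar j) c"
proof -
  let ?\<delta> = "(pvar (YVar j) - pvar (YVar i)) ^ e" and ?u = "(pvar (XVar j) - pvar (XVar i)) ^ c"
  have "?\<delta> dvd x_coeff \<alpha> f \<longleftrightarrow> ?\<delta> dvd x_coeff \<alpha> (?u * G)" if "x_only \<alpha>" for \<alpha>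
    unfolding f x_coeff_add x_coeff_diff_YVar_power_mult[OF that]
    by (rule dvd_add_right_iff) simp
  then have eq: "x_support_mod ?\<delta> (?u * G) = x_support_mod ?\<delta> f"
    by (auto simp: x_support_mod_def)
  have l: "lead_mod ?\<delta> (?u * G) (x_part \<mu>)"
    using lead_mod_lead[OF assms(2) nd] eq by (simp add: lead_mod_def)
  have "x_support_mod ?\<delta> G \<noteq> {}"
    using l x_support_mod_empty_mult[of ?\<delta> G j i c] by (auto simp: lead_mod_def)
  then obtain \<gamma> where \<gamma>: "lead_mod ?\<delta> G \<gamma>"
    using lead_mod_exists by blast
  show ?thesis
    using that[OF \<gamma>] lead_mod_unique[OF l lead_mod_diff_XVar_power_mult[OF assms(1) \<gamma>]] by blast
qed

lemma permute_transpose_diff: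
  "permute_points (transpose i j) (pvar (XVar j) - pvar (XVar i)) = - (pvar (XVar j) - pvar (XVar i))"
  "permute_points (transpose i j) (pvar (YVar j) - pvar (YVar i)) = - (pvar (YVar j) - pvar (YVar i))"
  by (simp_all add: permute_points_diff permute_points_pvar)

lemma permute_transpose_transpose:
  "permute_points (transpose i j) (permute_points (transpose i j) f) = f"
proof -
  have "permute_mon id \<mu> = \<mu>" for \<mu>
    by (rule mon_eqI_XY) (simp_all add: lookup_permute_mon)
  then have "permute_points id f = f"
    using lookup_permute_points_mon[of id f] by (intro poly_mapping_eqI) simp
  then show ?thesis
    using permute_points_compose[of "transpose i j" "transpose i j" f] by simp
qed

lemma neg_one_power_mult_self: "(- 1) ^ e * ((- 1) ^ e * f) = (f :: cpoly)"
  by (metis (no_types, lifting) left_minus_one_mult_self)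

lemma permute_transpose_diff_power:
  "permute_points (transpose i j) ((pvar (XVar j) - pvar (XVar i)) ^ e) =
    (- 1) ^ e * (pvar (XVar j) - pvar (XVar i)) ^ e"
  "permute_points (transpose i j) ((pvar (YVar j) - pvar (YVar i)) ^ e) =
    (- 1) ^ e * (pvar (YVar j) - pvar (YVar i)) ^ e"
  unfolding permute_points_power[OF bij_transpose] permute_transpose_diff by (rule power_minus)+

lemma permute_neg_one_power: "bij \<sigma> \<Longrightarrow> permute_points \<sigma> ((- 1) ^ e * f) = (- 1) ^ e * permute_points \<sigma> f"
  by (simp add: permute_points_mult permute_points_power permute_points_uminus)

lemma neg_one_power_dvd_iff: "p dvd (- 1) ^ e * f \<longleftrightarrow> p dvd (f :: cpoly)"
  by (metis dvd_mult neg_one_power_mult_self)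

text \<open>
  The transposition maps \<open>y\<^sub>j - y\<^sub>i\<close> to its negative, so it acts on coefficients modulo the power
  \<open>e\<close> of this difference, and the argument for \<open>lead_sorted\<close> applies.
\<close>

lemma lead_mod_antisymmetric_sorted:
  assumes "i < j" "lead_mod ((pvar (YVar j) - pvar (YVar i)) ^ e) G \<gamma>"
    and sym: "permute_points (transpose i j) G = (- 1) ^ s * G"
  shows "lookup \<gamma> (XVar i) \<le> lookup \<gamma> (XVar j)"
proof (rule ccontr)
  let ?v = "pvar (YVar j) - pvar (YVar i)" and ?\<tau> = "transpose i j"
  assume "\<not> lookup \<gamma> (XVar i) \<le> lookup \<gamma> (XVar j)"
  then have less: "\<gamma> < permute_mon ?\<tau> \<gamma>"
    using assms(1) by (intro mon_less_transpose) auto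
  have x: "x_only \<gamma>" and nd: "\<not> ?v ^ e dvd x_coeff \<gamma> G"
    using assms(2) by (auto simp: lead_mod_def x_support_mod_def)
  have "permute_mon ?\<tau> \<gamma> \<notin> x_support_mod (?v ^ e) G"
    using assms(2) less unfolding lead_mod_def by (meson not_le)
  then have "?v ^ e dvd x_coeff (permute_mon ?\<tau> \<gamma>) G"
    using x by (simp add: x_support_mod_def)
  moreover have "x_coeff (permute_mon ?\<tau> \<gamma>) G = (- 1) ^ s * permute_points ?\<tau> (x_coeff \<gamma> G)"
  proof -
    have "(- 1) ^ s * permute_points ?\<tau> G = G"
      unfolding sym by (rule neg_one_power_mult_self)
    moreover have "x_coeff \<alpha> ((- 1) ^ s * f) = (- 1) ^ s * x_coeff \<alpha> f" for \<alpha> f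
      by (cases "even s") (simp_all add: x_coeff_uminus)
    ultimately show ?thesis
      using x_coeff_permute[of ?\<tau> \<gamma> G] by (metis bij_transpose)
  qed
  ultimately obtain h where "permute_points ?\<tau> (x_coeff \<gamma> G) = ?v ^ e * h"
    by (auto simp: neg_one_power_dvd_iff elim: dvdE)
  then have "x_coeff \<gamma> G = permute_points ?\<tau> (?v ^ e * h)"
    by (metis permute_transpose_transpose)
  also have "\<dots> = (- 1) ^ e * (?v ^ e * permute_points ?\<tau> h)"
    by (simp only: permute_points_mult bij_transpose permute_transpose_diff_power mult.assoc)
  finally show False
    using nd by (simp add: neg_one_power_dvd_iff)
qed

section \<open>Powers of the ideals of pairs\<close>

abbreviation xdiff :: "nat \<Rightarrow> nat \<Rightarrow> cpoly" where
  "xdiff j i \<equiv> pvar (XVar j) - pvar (XVar i)"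

abbreviation ydiff :: "nat \<Rightarrow> nat \<Rightarrow> cpoly" where
  "ydiff j i \<equiv> pvar (YVar j) - pvar (YVar i)"

text \<open>
  The consequence of membership in \<open>(x\<^sub>j - x\<^sub>i, y\<^sub>j - y\<^sub>i)\<^sup>r\<close> that is needed: for every \<open>e \<le> r + 1\<close>, a
  product of \<open>r\<close> generators contains \<open>e\<close> factors \<open>y\<^sub>j - y\<^sub>i\<close> or \<open>r + 1 - e\<close> factors \<open>x\<^sub>j - x\<^sub>i\<close>. The
  cofactors may involve variables outside the ring of \<open>n + 1\<close> points.
\<close>

definition in_pair_power :: "nat \<Rightarrow> nat \<Rightarrow> nat \<Rightarrow> cpoly \<Rightarrow> bool" where
  "in_pair_power i j r f \<longleftrightarrow>
    (\<forall>e\<le>Suc r. \<exists>F G. f = ydiff j i ^ e * F + xdiff j i ^ (Suc r - e) * G)"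

lemma in_pair_power_0: "in_pair_power i j 0 f"
  unfolding in_pair_power_def
proof (intro allI impI)
  fix e :: nat assume "e \<le> Suc 0"
  then consider "e = 0" | "e = 1" by linarith
  then show "\<exists>F G. f = ydiff j i ^ e * F + xdiff j i ^ (Suc 0 - e) * G"
    by cases (rule exI[of _ f], rule exI[of _ 0], simp, rule exI[of _ 0], rule exI[of _ f], simp)
qed

lemma in_pair_power_add:
  assumes "in_pair_power i j r f" "in_pair_power i j r g"
  shows "in_pair_power i j r (f + g)"
  unfolding in_pair_power_def
proof (intro allI impI)
  fix e assume e: "e \<le> Suc r"
  obtain F G where "f = ydiff j i ^ e * F + xdiff j i ^ (Suc r - e) * G"
    using assms(1) e by (auto simp: in_pair_power_def)
  moreover obtain F' G' where "g = ydiff j i ^ e * F' + xdiff j i ^ (Suc r - e) * G'"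
    using assms(2) e by (auto simp: in_pair_power_def)
  ultimately have "f + g = ydiff j i ^ e * (F + F') + xdiff j i ^ (Suc r - e) * (G + G')"
    by (simp only: distrib_left add_ac)
  then show "\<exists>F G. f + g = ydiff j i ^ e * F + xdiff j i ^ (Suc r - e) * G"
    by blast
qed

lemma in_pair_power_Suc:
  assumes "in_pair_power i j r g"
  shows "in_pair_power i j (Suc r) (g * (xdiff j i * A + ydiff j i * B))"
  unfolding in_pair_power_def
proof (intro allI impI)
  fix e assume e: "e \<le> Suc (Suc r)"
  let ?h = "xdiff j i * A + ydiff j i * B"
  consider "e = Suc (Suc r)" | "e = 0" | e' where "e = Suc e'" "e' \<le> r"
    using e by (metis le_Suc_eq not0_implies_Suc Suc_le_mono)
  then show "\<exists>F G. g * ?h = ydiff j i ^ e * F + xdiff j i ^ (Suc (Suc r) - e) * G"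
  proof cases
    case 1
    then show ?thesis
      by (intro exI[of _ 0] exI[of _ "g * ?h"]) simp
  next
    case 2
    then show ?thesis
      by (intro exI[of _ "g * ?h"] exI[of _ 0]) simp
  next
    case 3
    have c: "Suc (Suc r) - e = Suc (Suc r - e)" "Suc r - e' = Suc (Suc r - e)"
      using 3 by auto
    \<comment> \<open>The summand with \<open>A\<close> gains a factor \<open>xdiff j i\<close> and uses the decomposition of \<open>g\<close> for \<open>e\<close>;
      the summand with \<open>B\<close> gains a factor \<open>ydiff j i\<close> and uses the one for \<open>e - 1\<close>.\<close>
    obtain F G where 1: "g = ydiff j i ^ e * F + xdiff j i ^ (Suc r - e) * G"
      using assms 3 by (auto simp: in_pair_power_def)
    obtain F' G' where 2: "g = ydiff j i ^ e' * F' + xdiff j i ^ Suc (Suc r - e) * G'"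
      using assms 3(2) c(2) by (metis in_pair_power_def le_SucI)
    have "g * (xdiff j i * A) = ydiff j i ^ e * (F * (xdiff j i * A)) + xdiff j i ^ Suc (Suc r - e) * (G * A)"
      unfolding 1 distrib_right power_Suc by (simp only: ac_simps)
    moreover have "g * (ydiff j i * B) = ydiff j i ^ e * (F' * B) + xdiff j i ^ Suc (Suc r - e) * (G' * (ydiff j i * B))"
      unfolding 2 distrib_right power_Suc 3(1) by (simp only: ac_simps)
    ultimately have "g * ?h = ydiff j i ^ e * (F * (xdiff j i * A) + F' * B) +
        xdiff j i ^ Suc (Suc r - e) * (G * A + G' * (ydiff j i * B))"
      by (simp only: distrib_left ac_simps)
    then show ?thesis
      unfolding c by blast
  qed
qed

lemma pvar_carrier: "v \<in> coords n \<Longrightarrow> pvar v \<in> carrier (point_ring n)"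
  by simp

lemma carrier_diff:
  assumes "f \<in> carrier (point_ring n)" "g \<in> carrier (point_ring n)"
  shows "f - g \<in> carrier (point_ring n)"
proof -
  have "keys (f - g) \<subseteq> keys f \<union> keys g"
    by (auto simp: in_keys_iff lookup_minus)
  then show ?thesis
    using assms by auto
qed

lemma diff_pvar_carrier:
  "i \<le> n \<Longrightarrow> j \<le> n \<Longrightarrow> xdiff j i \<in> carrier (point_ring n)"
  "i \<le> n \<Longrightarrow> j \<le> n \<Longrightarrow> ydiff j i \<in> carrier (point_ring n)"
  by (intro carrier_diff pvar_carrier; simp add: coords_def)+

lemma pair_ideal_subset:
  assumes "i \<le> n" "j \<le> n"
  shows "pair_ideal n i j \<subseteq> {xdiff i j * A + ydiff i j * B | A B. True}"
proof -
  interpret R: cring "point_ring n" by (rule cring_point_ring)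
  let ?u = "xdiff i j" and ?v = "ydiff i j"
  let ?P = "PIdl\<^bsub>point_ring n\<^esub> ?u <+>\<^bsub>point_ring n\<^esub> PIdl\<^bsub>point_ring n\<^esub> ?v"
  have uv: "?u \<in> carrier (point_ring n)" "?v \<in> carrier (point_ring n)"
    using assms diff_pvar_carrier by blast+
  have "ideal ?P (point_ring n)"
    using uv by (intro R.add_ideals R.cgenideal_ideal)
  moreover have "{?u, ?v} \<subseteq> ?P"
  proof -
    have "?u \<in> PIdl\<^bsub>point_ring n\<^esub> ?u" "?v \<in> PIdl\<^bsub>point_ring n\<^esub> ?v"
      using uv R.cgenideal_self by auto
    moreover have "0 \<in> PIdl\<^bsub>point_ring n\<^esub> f" if "f \<in> carrier (point_ring n)" for f
      using additive_subgroup.zero_closed[OF ideal.axioms(1)[OF R.cgenideal_ideal[OF that]]]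
      by (simp only: point_ring_simps(4))
    ultimately have "?u + 0 \<in> ?P" "0 + ?v \<in> ?P"
      using uv unfolding set_add_def' point_ring_simps(5) by blast+
    then show ?thesis
      by simp
  qed
  ultimately have "pair_ideal n i j \<subseteq> ?P"
    unfolding pair_ideal_def by (rule R.genideal_minimal)
  also have "\<dots> \<subseteq> {?u * A + ?v * B | A B. True}"
  proof
    fix f assume "f \<in> ?P"
    then obtain A B where "f = A * ?u + B * ?v"
      by (auto simp: set_add_def' cgenideal_def)
    then have "f = ?u * A + ?v * B"
      by (simp only: mult.commute)
    then show "f \<in> {?u * A + ?v * B | A B. True}"
      by blast
  qed
  finally show ?thesis .
qed

lemma pair_ideal_subset':
  assumes "i \<le> n" "j \<le> n"
  shows "pair_ideal n i j \<subseteq> {xdiff j i * A + ydiff j i * B | A B. True}"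
proof
  fix f assume "f \<in> pair_ideal n i j"
  then obtain A B where "f = xdiff i j * A + ydiff i j * B"
    using pair_ideal_subset[OF assms] by blast
  then have "f = xdiff j i * (- A) + ydiff j i * (- B)"
    by (simp add: left_diff_distrib)
  then show "f \<in> {xdiff j i * A + ydiff j i * B | A B. True}"
    by blast
qed

lemma ideal_power_in_pair_power:
  assumes "I \<subseteq> {xdiff j i * A + ydiff j i * B | A B. True}"
    and "f \<in> I [^]\<^bsub>ideals_set (point_ring n)\<^esub> r"
  shows "in_pair_power i j r f"
  using assms(2)
proof (induction r arbitrary: f)
  case 0
  show ?case by (rule in_pair_power_0)
next
  case (Suc r)
  from Suc.prems have "f \<in> ideal_prod (point_ring n) (I [^]\<^bsub>ideals_set (point_ring n)\<^esub> r) I"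
    by (simp add: nat_pow_def ideals_set_def)
  then show ?case
  proof (induction rule: ideal_prod.induct)
    case (prod g h)
    then obtain A B where "h = xdiff j i * A + ydiff j i * B"
      using assms(1) by blast
    then show ?case
      using in_pair_power_Suc[OF Suc.IH[OF prod(1)], of A B] by simp
  next
    case (sum g h)
    then show ?case
      by (simp add: in_pair_power_add)
  qed
qed

lemma ideal_power_carrier:
  fixes r :: nat
  assumes "I \<subseteq> carrier (point_ring n)"
  shows "I [^]\<^bsub>ideals_set (point_ring n)\<^esub> r \<subseteq> carrier (point_ring n)"
proof (induction r)
  case 0
  show ?case by (simp add: nat_pow_def ideals_set_def)
next
  case (Suc r)
  interpret R: cring "point_ring n" by (rule cring_point_ring)
  show ?case
  proof
    fix f assume "f \<in> I [^]\<^bsub>ideals_set (point_ring n)\<^esub> Suc r"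
    then have "f \<in> ideal_prod (point_ring n) (I [^]\<^bsub>ideals_set (point_ring n)\<^esub> r) I"
      by (simp add: nat_pow_def ideals_set_def)
    then show "f \<in> carrier (point_ring n)"
    proof (induction rule: ideal_prod.induct)
      case (prod g h)
      then show ?case
        using assms Suc.IH by (intro R.m_closed) blast+
    next
      case (sum g h)
      then show ?case
        by (intro R.add.m_closed)
    qed
  qed
qed

lemma ideal_power_prod_mem:
  fixes d :: nat
  assumes "\<And>s. s < d \<Longrightarrow> f s \<in> I" "c \<in> carrier (point_ring n)"
  shows "c * (\<Prod>s<d. f s) \<in> I [^]\<^bsub>ideals_set (point_ring n)\<^esub> d"
  using assms(1)
proof (induction d)
  case 0
  then show ?case
    using assms(2) by (simp add: nat_pow_def ideals_set_def)
next
  case (Suc d)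
  have "(c * (\<Prod>s<d. f s)) \<otimes>\<^bsub>point_ring n\<^esub> f d \<in>
      ideal_prod (point_ring n) (I [^]\<^bsub>ideals_set (point_ring n)\<^esub> d) I"
    using Suc by (intro ideal_prod.prod) auto
  then show ?case
    by (simp add: nat_pow_def ideals_set_def mult.assoc)
qed

section \<open>Constraints on leading monomials\<close>

lemma cscale_mult_right: "cscale c (f * g) = f * cscale c g"
  by (simp add: cscale_def mult_map_scale_conv_mult mult.left_commute)

lemma cscale_half_double: "cscale (1/2) (f + f) = f"
proof (rule poly_mapping_eqI)
  fix \<mu>
  show "lookup (cscale (1/2) (f + f)) \<mu> = lookup f \<mu>"
    unfolding lookup_cscale lookup_add by simp
qed

lemma cscale_neg_one_power: "cscale ((- 1) ^ s) f = (- 1) ^ s * f"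
proof -
  have "cscale (- 1) f = - f"
    by (rule poly_mapping_eqI) simp
  then show ?thesis
    by (cases "even s") simp_all
qed

text \<open>
  Suppose the coefficient were nonzero modulo the power \<open>e = d - (a\<^sub>j - a\<^sub>i)\<close> of \<open>y\<^sub>j - y\<^sub>i\<close>. Modulo
  this power, \<open>f\<close> is \<open>(x\<^sub>j - x\<^sub>i)\<^sup>c G\<close> with \<open>c = a\<^sub>j - a\<^sub>i + 1\<close>, where \<open>G\<close> can be taken invariant up to sign
  under the exchange of the two points. The leading x-monomial of \<open>G\<close> is then sorted, so that of
  \<open>f\<close> has exponents at \<open>j\<close> and \<open>i\<close> that differ by at least \<open>c\<close>, which is one too many.
\<close>

lemma ydiff_power_dvd_of_sign_symmetric:
  assumes "i < j" "permute_points (transpose i j) f = (- 1) ^ d * f"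
    and "in_pair_power i j d f" "lead f \<mu>" "lookup \<mu> (XVar i) \<le> lookup \<mu> (XVar j)"
  shows "ydiff j i ^ (d - (lookup \<mu> (XVar j) - lookup \<mu> (XVar i))) dvd x_coeff (x_part \<mu>) f"
proof (rule ccontr)
  let ?\<tau> = "transpose i j"
  define e where "e = d - (lookup \<mu> (XVar j) - lookup \<mu> (XVar i))"
  define c where "c = Suc d - e"
  assume "\<not> ydiff j i ^ (d - (lookup \<mu> (XVar j) - lookup \<mu> (XVar i))) dvd x_coeff (x_part \<mu>) f"
  then have nd: "\<not> ydiff j i ^ e dvd x_coeff (x_part \<mu>) f"
    unfolding e_def .
  then have "e \<noteq> 0"
    by (intro notI) simp
  then have c: "c = Suc (lookup \<mu> (XVar j) - lookup \<mu> (XVar i))" and "e \<le> Suc d"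
    unfolding c_def e_def by auto
  then obtain F G where FG: "f = ydiff j i ^ e * F + xdiff j i ^ c * G"
    using assms(3) unfolding in_pair_power_def c_def by blast
  \<comment> \<open>Averaging the decomposition with its image under the transposition makes the cofactors
    invariant up to sign; \<open>f + f\<close> takes the place of \<open>f\<close> to avoid denominators.\<close>
  define F' where "F' = F + (- 1) ^ (d + e) * permute_points ?\<tau> F"
  define G' where "G' = G + (- 1) ^ (d + c) * permute_points ?\<tau> G"
  have "f = (- 1) ^ d * permute_points ?\<tau> f"
    unfolding assms(2) by (simp only: neg_one_power_mult_self)
  also have "permute_points ?\<tau> f =
      (- 1) ^ e * ydiff j i ^ e * permute_points ?\<tau> F + (- 1) ^ c * xdiff j i ^ c * permute_points ?\<tau> G"
    unfolding FG
    by (simp only: permute_points_add permute_points_mult bij_transpose permute_transpose_diff_power)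
  finally have 2: "f = (- 1) ^ d * ((- 1) ^ e * ydiff j i ^ e * permute_points ?\<tau> F +
      (- 1) ^ c * xdiff j i ^ c * permute_points ?\<tau> G)" .
  have "f + f = ydiff j i ^ e * F' + xdiff j i ^ c * G'"
    unfolding arg_cong2[OF FG 2, of "(+)"] F'_def G'_def power_add
    by (simp only: distrib_left distrib_right ac_simps)
  moreover have "keys (f + f) = keys f"
    unfolding set_eq_iff in_keys_iff lookup_add by simp
  then have "lead (f + f) \<mu>"
    using assms(4) unfolding lead_def by (metis (no_types))
  moreover have "\<not> ydiff j i ^ e dvd x_coeff (x_part \<mu>) (f + f)"
  proof
    assume "ydiff j i ^ e dvd x_coeff (x_part \<mu>) (f + f)"
    then obtain h where "x_coeff (x_part \<mu>) f + x_coeff (x_part \<mu>) f = ydiff j i ^ e * h"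
      unfolding x_coeff_add ..
    then have "x_coeff (x_part \<mu>) f = ydiff j i ^ e * cscale (1/2) h"
      by (metis cscale_mult_right cscale_half_double)
    then show False
      using nd by simp
  qed
  ultimately obtain \<gamma> where \<gamma>: "lead_mod (ydiff j i ^ e) G' \<gamma>" "x_part \<mu> = \<gamma> + single (XVar j) c"
    using lead_mod_decomposition[OF assms(1)] by metis
  have "permute_points ?\<tau> G' = (- 1) ^ (d + c) * G'"
    unfolding G'_def
    by (simp only: permute_points_add permute_neg_one_power bij_transpose
        permute_transpose_transpose distrib_left neg_one_power_mult_self add.commute)
  then have "lookup \<gamma> (XVar i) \<le> lookup \<gamma> (XVar j)"
    by (rule lead_mod_antisymmetric_sorted[OF assms(1) \<gamma>(1)])
  moreover have "lookup \<mu> (XVar i) = lookup \<gamma> (XVar i)"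
    using arg_cong[OF \<gamma>(2), of "\<lambda>\<alpha>. lookup \<alpha> (XVar i)"] assms(1)
    by (simp add: lookup_add lookup_single)
  moreover have "lookup \<mu> (XVar j) = lookup \<gamma> (XVar j) + c"
    using arg_cong[OF \<gamma>(2), of "\<lambda>\<alpha>. lookup \<alpha> (XVar j)"] by (simp add: lookup_add)
  ultimately show False
    using c assms(5) by simp
qed

text \<open>
  Without symmetry, the factor \<open>(x\<^sub>j - x\<^sub>i)\<^sup>c\<close> still bounds the exponent of \<open>x\<^sub>j\<close> in the leading
  x-monomial from below by \<open>c\<close>. For \<open>i = 0\<close> this is the divisibility that comes from the ideal \<open>I\<close>.
\<close>

lemma ydiff_power_dvd:
  assumes "i < j" "in_pair_power i j k f" "lead f \<mu>"
  shows "ydiff j i ^ (k - lookup \<mu> (XVar j)) dvd x_coeff (x_part \<mu>) f"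
proof (rule ccontr)
  define e where "e = k - lookup \<mu> (XVar j)"
  define c where "c = Suc k - e"
  assume "\<not> ydiff j i ^ (k - lookup \<mu> (XVar j)) dvd x_coeff (x_part \<mu>) f"
  then have nd: "\<not> ydiff j i ^ e dvd x_coeff (x_part \<mu>) f"
    unfolding e_def .
  then have "e \<noteq> 0"
    by (intro notI) simp
  then have c: "c = Suc (lookup \<mu> (XVar j))" and "e \<le> Suc k"
    unfolding c_def e_def by auto
  then obtain F G where FG: "f = ydiff j i ^ e * F + xdiff j i ^ c * G"
    using assms(2) unfolding in_pair_power_def c_def by blast
  obtain \<gamma> where \<gamma>: "x_part \<mu> = \<gamma> + single (XVar j) c"
    using lead_mod_decomposition[OF assms(1,3) FG nd] .
  have "lookup \<mu> (XVar j) = lookup \<gamma> (XVar j) + c"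
    using arg_cong[OF \<gamma>, of "\<lambda>\<alpha>. lookup \<alpha> (XVar j)"] by (simp add: lookup_add)
  then show False
    using c by simp
qed

text \<open>
  The coefficient of the leading x-monomial is \<open>(y\<^sub>j - y\<^sub>i)\<^sup>d h\<close>. The transposition fixes this x-monomial
  and multiplies both the coefficient and \<open>(y\<^sub>j - y\<^sub>i)\<^sup>d\<close> by \<open>(-1)\<^sup>d\<close>, so \<open>h\<close> is symmetric and its
  leading monomial is sorted.
\<close>

lemma lead_YVar_difference:
  assumes "i < j" "permute_points (transpose i j) f = (- 1) ^ d * f"
    and "in_pair_power i j d f" "lead f \<mu>" "lookup \<mu> (XVar i) = lookup \<mu> (XVar j)"
  shows "lookup \<mu> (YVar i) + d \<le> lookup \<mu> (YVar j)"
proof -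
  let ?\<tau> = "transpose i j"
  define p where "p = x_coeff (x_part \<mu>) f"
  have p: "lead p (y_part \<mu>)"
    unfolding p_def by (rule lead_x_coeff[OF assms(4)])
  have "ydiff j i ^ d dvd p"
    using ydiff_power_dvd_of_sign_symmetric[OF assms(1-4)] assms(5) by (simp add: p_def)
  then obtain h where h: "p = ydiff j i ^ d * h" ..
  then have "h \<noteq> 0"
    using lead_nonzero[OF p] by auto
  then obtain \<nu> where \<nu>: "lead h \<nu>"
    using lead_exists by blast
  have v: "lead (ydiff j i ^ d) (single (YVar j) d)"
    using assms(1) by (intro lead_power lead_diff_pvar) simp
  have eq: "y_part \<mu> = single (YVar j) d + \<nu>"
    using lead_unique[OF p] lead_mult[OF v \<nu>] unfolding h by blast
  have "permute_mon ?\<tau> (x_part \<mu>) = x_part \<mu>"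
    using assms(5) by (intro mon_eqI_XY) (auto simp: lookup_permute_mon transpose_def)
  then have "permute_points ?\<tau> p = x_coeff (x_part \<mu>) ((- 1) ^ d * f)"
    unfolding p_def by (metis assms(2) bij_transpose x_coeff_permute)
  also have "\<dots> = (- 1) ^ d * p"
    unfolding cscale_neg_one_power[symmetric] p_def by (rule x_coeff_cscale)
  finally have "(- 1) ^ d * (ydiff j i ^ d * permute_points ?\<tau> h) = (- 1) ^ d * (ydiff j i ^ d * h)"
    unfolding h by (simp only: permute_points_mult bij_transpose permute_transpose_diff_power mult.assoc)
  then have "ydiff j i ^ d * permute_points ?\<tau> h = ydiff j i ^ d * h"
    by (metis neg_one_power_mult_self)
  then have "permute_points ?\<tau> h = h"
    using lead_nonzero[OF v] by (simp only: mult_cancel_left) blast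
  then have "permute_points ?\<tau> h = cscale 1 h"
    by simp
  from lead_sorted(2)[OF this assms(1) \<nu>]
  have "lookup \<nu> (YVar i) \<le> lookup \<nu> (YVar j)"
    using arg_cong[OF eq, of "\<lambda>\<alpha>. lookup \<alpha> (XVar i)"] arg_cong[OF eq, of "\<lambda>\<alpha>. lookup \<alpha> (XVar j)"]
    by (simp add: lookup_add lookup_single)
  moreover have "lookup \<mu> (YVar i) = lookup \<nu> (YVar i)" "lookup \<mu> (YVar j) = d + lookup \<nu> (YVar j)"
    using arg_cong[OF eq, of "\<lambda>\<alpha>. lookup \<alpha> (YVar i)"] arg_cong[OF eq, of "\<lambda>\<alpha>. lookup \<alpha> (YVar j)"] assms(1)
    by (simp_all add: lookup_add lookup_single)
  ultimately show ?thesis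
    by simp
qed

lemma lead_YVar_lower_bound:
  assumes "lead f \<mu>" "\<And>i. i < j \<Longrightarrow> ydiff j i ^ e i dvd x_coeff (x_part \<mu>) f"
  shows "(\<Sum>i<j. e i) \<le> lookup \<mu> (YVar j)"
proof -
  define p where "p = x_coeff (x_part \<mu>) f"
  have p: "lead p (y_part \<mu>)"
    unfolding p_def by (rule lead_x_coeff[OF assms(1)])
  have "(\<Prod>w\<in>YVar ` {..<j}. (pvar (YVar j) - pvar w) ^ (case w of YVar i \<Rightarrow> e i | XVar i \<Rightarrow> 0)) dvd p"
    using assms(2) by (intro prod_diff_pvar_dvd) (auto simp: p_def)
  also have "(\<Prod>w\<in>YVar ` {..<j}. (pvar (YVar j) - pvar w) ^ (case w of YVar i \<Rightarrow> e i | XVar i \<Rightarrow> 0)) =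
      (\<Prod>i<j. ydiff j i ^ e i)"
    by (subst prod.reindex) (auto simp: inj_on_def)
  finally obtain h where h: "p = (\<Prod>i<j. ydiff j i ^ e i) * h" ..
  then have "h \<noteq> 0"
    using lead_nonzero[OF p] by auto
  then obtain \<nu> where \<nu>: "lead h \<nu>"
    using lead_exists by blast
  have "lead (\<Prod>i<j. ydiff j i ^ e i) (\<Sum>i<j. single (YVar j) (e i))"
    by (intro lead_prod lead_power lead_diff_pvar) simp
  then have "y_part \<mu> = (\<Sum>i<j. single (YVar j) (e i)) + \<nu>"
    using lead_unique[OF p] lead_mult \<nu> unfolding h by blast
  from arg_cong[OF this, of "\<lambda>\<alpha>. lookup \<alpha> (YVar j)"] show ?thesis
    by (simp add: lookup_add lookup_sum)
qed

text \<open>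
  The exponents of the extra variables, which have index \<open>0\<close>, are unconstrained.
\<close>

definition P_monomials :: "nat \<Rightarrow> nat \<Rightarrow> nat \<Rightarrow> mon set" where
  "P_monomials n r k = {\<mu>. keys \<mu> \<subseteq> coords n \<and>
     ((\<lambda>i\<in>{1..n}. lookup \<mu> (XVar i)), (\<lambda>i\<in>{1..n}. lookup \<mu> (YVar i))) \<in> P_set n r k}"

text \<open>
  Once \<open>a\<close> is known to be weakly increasing, every maximum with \<open>0\<close> is a truncated subtraction of
  natural numbers.
\<close>

lemma P_set_restrict_iff:
  "((\<lambda>i\<in>{1..n}. a i), (\<lambda>i\<in>{1..n}. b i)) \<in> P_set n r k \<longleftrightarrow>
    (\<forall>j\<in>{1..<n}. a j \<le> a (j + 1)) \<and>
    (\<forall>j\<in>{1..<n}. a j = a (j + 1) \<longrightarrow> b j + r \<le> b (j + 1)) \<and>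
    (\<forall>j\<in>{1..n}. (k - a j) + (\<Sum>i\<in>{1..<j}. r - (a j - a i)) \<le> b j)"
proof -
  define A where "A = (\<lambda>i\<in>{1..n}. a i)"
  define B where "B = (\<lambda>i\<in>{1..n}. b i)"
  have PiE: "A \<in> {1..n} \<rightarrow>\<^sub>E UNIV" "B \<in> {1..n} \<rightarrow>\<^sub>E UNIV"
    by (simp_all add: A_def B_def)
  have AB: "A j = a j" "B j = b j" if "1 \<le> j" "j \<le> n" for j
    using that by (simp_all add: A_def B_def)
  have "(A, B) \<in> P_set n r k \<longleftrightarrow>
    (\<forall>j\<in>{1..<n}. A j \<le> A (j + 1)) \<and>
    (\<forall>j\<in>{1..<n}. A j = A (j + 1) \<longrightarrow> B (j + 1) \<ge> B j + r) \<and>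
    (\<forall>j\<in>{1..n}. int (B j) \<ge> max (int k - int (A j)) 0 +
      (\<Sum>i\<in>{1..<j}. max (int r - (int (A j) - int (A i))) 0))"
    using PiE by (simp only: P_set_def mem_Collect_eq prod.case simp_thms)
  also have "\<dots> \<longleftrightarrow> (\<forall>j\<in>{1..<n}. a j \<le> a (j + 1)) \<and>
    (\<forall>j\<in>{1..<n}. a j = a (j + 1) \<longrightarrow> b j + r \<le> b (j + 1)) \<and>
    (\<forall>j\<in>{1..n}. max (int k - int (a j)) 0 +
      (\<Sum>i\<in>{1..<j}. max (int r - (int (a j) - int (a i))) 0) \<le> int (b j))"
    by (intro arg_cong2[of _ _ _ _ "(\<and>)"] ball_cong refl) (simp_all add: AB)
  finally have P: "((\<lambda>i\<in>{1..n}. a i), (\<lambda>i\<in>{1..n}. b i)) \<in> P_set n r k \<longleftrightarrow> \<dots>"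
    by (simp only: A_def B_def)
  show ?thesis
  proof (cases "\<forall>j\<in>{1..<n}. a j \<le> a (j + 1)")
    case True
    have mono: "a i \<le> a j" if "1 \<le> i" "i \<le> j" "j \<le> n" for i j
      using that(2,3)
    proof (induction j rule: dec_induct)
      case (step j)
      then have "a j \<le> a (j + 1)"
        using True that(1) by auto
      then show ?case
        using step by simp
    qed simp
    have "max (int k - int (a j)) 0 + (\<Sum>i\<in>{1..<j}. max (int r - (int (a j) - int (a i))) 0) \<le> int (b j)
        \<longleftrightarrow> (k - a j) + (\<Sum>i\<in>{1..<j}. r - (a j - a i)) \<le> b j" if "j \<in> {1..n}" for j
    proof -
      have "max (int r - (int (a j) - int (a i))) 0 = int (r - (a j - a i))" if "i \<in> {1..<j}" for i
        using mono[of i j] that \<open>j \<in> {1..n}\<close> by auto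
      then have "max (int k - int (a j)) 0 + (\<Sum>i\<in>{1..<j}. max (int r - (int (a j) - int (a i))) 0)
          = int (k - a j) + (\<Sum>i\<in>{1..<j}. int (r - (a j - a i)))"
        by (intro arg_cong2[of _ _ _ _ "(+)"] sum.cong) auto
      also have "\<dots> = int ((k - a j) + (\<Sum>i\<in>{1..<j}. r - (a j - a i)))"
        by simp
      finally show ?thesis
        by (simp only: of_nat_le_iff)
    qed
    then show ?thesis
      unfolding P by simp
  next
    case False
    then show ?thesis
      unfolding P by blast
  qed
qed

theorem lead_in_P_monomials:
  assumes f: "f \<in> nested_hilb_sections n m k" and "lead f \<mu>"
  shows "\<mu> \<in> P_monomials n (m + k) k"
proof -
  define d where "d = m + k"
  define a where "a = (\<lambda>i. lookup \<mu> (XVar i))"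
  define b where "b = (\<lambda>i. lookup \<mu> (YVar i))"
  have fJ: "f \<in> J_ideal n [^]\<^bsub>ideals_set (point_ring n)\<^esub> d"
    and fI: "f \<in> I_ideal n [^]\<^bsub>ideals_set (point_ring n)\<^esub> k"
    and fsym: "\<And>\<sigma>. \<sigma> permutes {1..n} \<Longrightarrow> permute_points \<sigma> f = cscale (sgn_char d \<sigma>) f"
    using f by (auto simp: nested_hilb_sections_def sgn_component_def d_def)
  have sym: "permute_points (transpose i j) f = (- 1) ^ d * f" if "1 \<le> i" "i < j" "j \<le> n" for i j
  proof -
    have "sgn_char d (transpose i j) = (- 1) ^ d"
      using that by (simp add: sgn_char_def sign_swap_id)
    moreover have "transpose i j permutes {1..n}"
      using that by (intro permutes_swap_id) auto
    ultimately show ?thesis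
      using fsym[of "transpose i j"] by (simp add: cscale_neg_one_power)
  qed
  have Jpow: "in_pair_power i j d f" if "1 \<le> i" "i < j" "j \<le> n" for i j
  proof (rule ideal_power_in_pair_power[OF _ fJ])
    have "J_ideal n \<subseteq> pair_ideal n i j"
      using that by (auto simp: J_ideal_def)
    then show "J_ideal n \<subseteq> {xdiff j i * A + ydiff j i * B | A B. True}"
      using pair_ideal_subset'[of i n j] that by fastforce
  qed
  have Ipow: "in_pair_power 0 j k f" if "1 \<le> j" "j \<le> n" for j
  proof (rule ideal_power_in_pair_power[OF _ fI])
    have "I_ideal n \<subseteq> pair_ideal n j 0"
      using that by (auto simp: I_ideal_def)
    then show "I_ideal n \<subseteq> {xdiff j 0 * A + ydiff j 0 * B | A B. True}"
      using pair_ideal_subset[of j n 0] that by fastforce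
  qed
  have sorted: "a i \<le> a j" if "1 \<le> i" "i < j" "j \<le> n" for i j
    using lead_sorted(1)[OF _ that(2) assms(2)] sym[OF that]
    unfolding a_def cscale_neg_one_power[symmetric] by blast
  have "a j = a (j + 1) \<Longrightarrow> b j + d \<le> b (j + 1)" if "j \<in> {1..<n}" for j
    unfolding a_def b_def
    using that by (intro lead_YVar_difference[OF _ sym Jpow assms(2)]) auto
  moreover have "(k - a j) + (\<Sum>i\<in>{1..<j}. d - (a j - a i)) \<le> b j" if j: "j \<in> {1..n}" for j
  proof -
    \<comment> \<open>The extra point is treated as an additional point with index \<open>0\<close>, so that both terms of the
      bound come from the factors \<open>ydiff j i\<close> with \<open>i < j\<close>.\<close>
    define e where "e = (\<lambda>i. if i = 0 then k - a j else d - (a j - a i))"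
    have "ydiff j i ^ e i dvd x_coeff (x_part \<mu>) f" if "i < j" for i
    proof (cases "i = 0")
      case True
      then show ?thesis
        using ydiff_power_dvd[OF that Ipow[of j, folded True] assms(2)] j
        by (simp add: e_def a_def)
    next
      case False
      then show ?thesis
        using ydiff_power_dvd_of_sign_symmetric[OF that sym Jpow assms(2)] sorted[of i j] j that
        by (simp add: e_def a_def)
    qed
    then have "(\<Sum>i<j. e i) \<le> b j"
      unfolding b_def by (rule lead_YVar_lower_bound[OF assms(2)])
    moreover have "{..<j} = insert 0 {1..<j}"
      using j by auto
    ultimately show ?thesis
      by (simp add: e_def)
  qed
  moreover have "keys \<mu> \<subseteq> coords n"
  proof -
    have "f \<in> carrier (point_ring n)"
      using ideal_power_carrier[of "J_ideal n" n d] fJ unfolding J_ideal_def by blast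
    then show ?thesis
      using assms(2) by (simp add: lead_def)
  qed
  ultimately show ?thesis
    using sorted unfolding P_monomials_def d_def[symmetric] mem_Collect_eq P_set_restrict_iff a_def b_def
    by (auto simp: a_def b_def)
qed

section \<open>Splitting a lattice point\<close>

text \<open>
  Hermite's identity. Raising \<open>x\<close> by one drops the term \<open>x div d\<close> and adds \<open>(x + d) div d\<close>.
\<close>

lemma sum_div_shift:
  fixes x d :: nat
  assumes "0 < d"
  shows "(\<Sum>s<d. (x + s) div d) = x"
proof (induction x)
  case 0
  show ?case by simp
next
  case (Suc x)
  have "(\<Sum>s<d. (Suc x + s) div d) + x div d = (\<Sum>s<Suc d. (x + s) div d)"
    unfolding sum.lessThan_Suc_shift by simp
  also have "\<dots> = x + Suc (x div d)"
    using assms by (simp add: Suc.IH div_add_self2)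
  finally show ?case by simp
qed

text \<open>
  If \<open>y - x < d\<close>, the two quotients differ by at most one, and by Hermite's identity they differ
  for exactly \<open>y - x\<close> shifts.
\<close>

lemma sum_div_eq_div:
  fixes x y d :: nat
  assumes "0 < d" "x \<le> y"
  shows "(\<Sum>s<d. of_bool ((x + s) div d = (y + s) div d)) = d - (y - x)"
proof (cases "y - x < d")
  case True
  have "of_bool ((x + s) div d = (y + s) div d) + (y + s) div d = 1 + (x + s) div d" for s
  proof -
    have "(x + s) div d \<le> (y + s) div d"
      using assms(2) by (intro div_le_mono) simp
    moreover have "(y + s) div d \<le> (x + s + d) div d"
      using True by (intro div_le_mono) simp
    moreover have "(x + s + d) div d = Suc ((x + s) div d)"
      using assms(1) by (simp add: div_add_self2)
    ultimately have "(y + s) div d = (x + s) div d \<or> (y + s) div d = Suc ((x + s) div d)"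
      by linarith
    then show ?thesis by auto
  qed
  then have "(\<Sum>s<d. of_bool ((x + s) div d = (y + s) div d)) + (\<Sum>s<d. (y + s) div d) =
      (\<Sum>s<d. 1 + (x + s) div d)"
    by (simp only: sum.distrib[symmetric])
  also have "\<dots> = d + x"
    by (simp only: sum.distrib sum_div_shift[OF assms(1)]) simp
  finally have "(\<Sum>s<d. of_bool ((x + s) div d = (y + s) div d)) + y = d + x"
    by (simp only: sum_div_shift[OF assms(1)])
  then show ?thesis
    using assms(2) by linarith
next
  case False
  have "(x + s) div d \<noteq> (y + s) div d" for s
  proof -
    have "Suc ((x + s) div d) = (x + s + d) div d"
      using assms(1) by (simp add: div_add_self2)
    also have "\<dots> \<le> (y + s) div d"
      using False assms(2) by (intro div_le_mono) linarith
    finally show ?thesis by simp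
  qed
  then show ?thesis
    using False by simp
qed

lemma sum_div_eq_0:
  fixes x m k :: nat
  shows "(\<Sum>s<m + k. of_bool (m \<le> s \<and> (x + s) div (m + k) = 0)) = k - x"
proof -
  have "(\<Sum>s<m + k. of_bool (m \<le> s \<and> (x + s) div (m + k) = 0)) =
      card {s \<in> {..<m + k}. m \<le> s \<and> (x + s) div (m + k) = 0}"
    by (simp add: sum_of_bool_eq Int_def)
  also have "{s \<in> {..<m + k}. m \<le> s \<and> (x + s) div (m + k) = 0} = {m..<m + k - x}"
    by (auto simp: div_eq_0_iff)
  also have "card \<dots> = k - x"
    by simp
  finally show ?thesis .
qed

text \<open>
  For this shift \<open>x + s + 1\<close> is a multiple of \<open>d\<close>, so every \<open>y > x\<close> has a larger quotient: the
  shift separates \<open>x\<close> from all larger numbers.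
\<close>

lemma eq_of_div_eq:
  fixes x y d :: nat
  assumes "x \<le> y" "0 < d" "s = d - 1 - x mod d" "(x + s) div d = (y + s) div d"
  shows "x = y"
proof (rule ccontr)
  assume "x \<noteq> y"
  have "x mod d < d"
    using assms(2) by simp
  then have "x + s + 1 = (x div d + 1) * d"
    using assms(3) div_mult_mod_eq[of x d] unfolding add_mult_distrib by linarith
  then have "(x div d + 1) * d \<le> y + s" "x + s < (x div d + 1) * d"
    using assms(1) \<open>x \<noteq> y\<close> by linarith+
  then have "x div d + 1 \<le> (y + s) div d" "(x + s) div d < x div d + 1"
    using assms(2) by (simp_all only: less_eq_div_iff_mult_less_eq div_less_iff_less_mult)
  then show False
    using assms(4) by linarith
qed

text \<open>
  A point of \<open>P(m + k, k)\<close> with \<open>m + k > 0\<close>, with the bounds in truncated subtraction.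
\<close>

locale lattice_point =
  fixes n m k :: nat and a b :: "nat \<Rightarrow> nat"
  assumes pos: "0 < m + k"
    and a_mono: "\<And>j. j \<in> {1..<n} \<Longrightarrow> a j \<le> a (j + 1)"
    and b_step: "\<And>j. j \<in> {1..<n} \<Longrightarrow> a j = a (j + 1) \<Longrightarrow> b j + (m + k) \<le> b (j + 1)"
    and b_bound: "\<And>j. j \<in> {1..n} \<Longrightarrow> (k - a j) + (\<Sum>i\<in>{1..<j}. (m + k) - (a j - a i)) \<le> b j"
begin

definition excess :: "nat \<Rightarrow> nat" where
  "excess j = b j - ((k - a j) + (\<Sum>i\<in>{1..<j}. (m + k) - (a j - a i)))"

text \<open>
  The decomposition into \<open>m + k\<close> points, indexed by \<open>s < m + k\<close>; the last \<open>k\<close> of them are to avoid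
  the exponent pair \<open>(0, 0)\<close>. The first two terms of \<open>part_b\<close> are the lower bound for \<open>P(1, 1)\<close> if
  \<open>m \<le> s\<close> and for \<open>P(1, 0)\<close> otherwise. The excess of \<open>b\<^sub>j\<close> over its bound goes entirely to the part whose shift separates
  \<open>a\<^sub>j\<close> from all larger values; there the excess need only be increasing along indices with equal \<open>a\<^sub>j\<close>,
  and this is condition (ii).
\<close>

definition part_a :: "nat \<Rightarrow> nat \<Rightarrow> nat" where
  "part_a s j = (a j + s) div (m + k)"

definition part_b :: "nat \<Rightarrow> nat \<Rightarrow> nat" where
  "part_b s j = of_bool (m \<le> s \<and> part_a s j = 0) + (\<Sum>i\<in>{1..<j}. of_bool (part_a s i = part_a s j))
    + (if s = m + k - 1 - a j mod (m + k) then excess j else 0)"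

lemma a_le:
  assumes "1 \<le> i" "i \<le> j" "j \<le> n"
  shows "a i \<le> a j"
  using assms(2,3)
proof (induction j rule: dec_induct)
  case (step j)
  then have "a j \<le> a (j + 1)"
    using a_mono[of j] assms(1) by auto
  then show ?case
    using step by simp
qed simp

lemma sum_part_a: "(\<Sum>s<m + k. part_a s j) = a j"
  unfolding part_a_def by (rule sum_div_shift[OF pos])

lemma sum_part_b:
  assumes "j \<in> {1..n}"
  shows "(\<Sum>s<m + k. part_b s j) = b j"
proof -
  have "(\<Sum>s<m + k. \<Sum>i\<in>{1..<j}. of_bool (part_a s i = part_a s j)) =
      (\<Sum>i\<in>{1..<j}. \<Sum>s<m + k. of_bool (part_a s i = part_a s j))"
    by (rule sum.swap)
  also have "\<dots> = (\<Sum>i\<in>{1..<j}. (m + k) - (a j - a i))"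
    unfolding part_a_def using assms
    by (intro sum.cong refl sum_div_eq_div[OF pos] a_le) auto
  finally have "(\<Sum>s<m + k. \<Sum>i\<in>{1..<j}. of_bool (part_a s i = part_a s j)) =
      (\<Sum>i\<in>{1..<j}. (m + k) - (a j - a i))" .
  moreover have "(\<Sum>s<m + k. of_bool (m \<le> s \<and> part_a s j = 0)) = k - a j"
    unfolding part_a_def by (rule sum_div_eq_0)
  moreover have "m + k - 1 - a j mod (m + k) < m + k"
    using pos by simp
  then have "(\<Sum>s<m + k. if s = m + k - 1 - a j mod (m + k) then excess j else 0) = excess j"
    by simp
  ultimately have "(\<Sum>s<m + k. part_b s j) =
      (k - a j) + (\<Sum>i\<in>{1..<j}. (m + k) - (a j - a i)) + excess j"
    unfolding part_b_def sum.distrib by simp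
  then show ?thesis
    using b_bound[OF assms] by (simp add: excess_def)
qed

lemma excess_step:
  assumes "j \<in> {1..<n}" "a j = a (j + 1)"
  shows "excess j \<le> excess (j + 1)"
proof -
  have "{1..<j + 1} = insert j {1..<j}"
    using assms by auto
  then show ?thesis
    using b_step[OF assms] b_bound[of j] assms by (simp add: excess_def)
qed

lemma excess_mono:
  assumes "1 \<le> i" "i \<le> j" "j \<le> n" "a i = a j"
  shows "excess i \<le> excess j"
  using assms(2-4)
proof (induction j rule: dec_induct)
  case (step j)
  have "a i \<le> a j" "a j \<le> a (Suc j)"
    using step assms(1) a_le[of i j] a_le[of j "Suc j"] by simp_all
  then have "a j = a i" "a j = a (j + 1)"
    using step by auto
  then show ?case
    using step excess_step[of j] assms(1) by simp
qed simp

text \<open>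
  When \<open>part_a\<close> does not increase, the count of earlier equal entries goes up by at least one. The
  excess term does not decrease: if it is present at \<open>i\<close>, then \<open>part_a s i = part_a s j\<close> is only
  possible for \<open>a i = a j\<close>.
\<close>

lemma parts_sorted:
  assumes "1 \<le> i" "i < j" "j \<le> n"
  shows "(part_a s i, part_b s i) < (part_a s j, part_b s j)"
proof -
  have "part_a s i \<le> part_a s j"
    unfolding part_a_def using assms a_le[of i j] by (intro div_le_mono) simp
  moreover have "part_b s i < part_b s j" if eq: "part_a s i = part_a s j"
  proof -
    have "(\<Sum>l\<in>{1..<i}. of_bool (part_a s l = part_a s i)) <
        (\<Sum>l\<in>insert i {1..<i}. of_bool (part_a s l = part_a s i) :: nat)"
      by simp
    also have "\<dots> \<le> (\<Sum>l\<in>{1..<j}. of_bool (part_a s l = part_a s j))"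
      unfolding eq using assms by (intro sum_mono2) auto
    finally have "(\<Sum>l\<in>{1..<i}. of_bool (part_a s l = part_a s i)) <
      (\<Sum>l\<in>{1..<j}. of_bool (part_a s l = part_a s j) :: nat)" .
    moreover have "(if s = m + k - 1 - a i mod (m + k) then excess i else 0) \<le>
        (if s = m + k - 1 - a j mod (m + k) then excess j else 0)"
    proof (cases "s = m + k - 1 - a i mod (m + k)")
      case True
      then have "a i = a j"
        using eq a_le[of i j] assms pos unfolding part_a_def
        by (intro eq_of_div_eq[of "a i" "a j" "m + k" s]) auto
      then show ?thesis
        using True excess_mono[of i j] assms by simp
    qed simp
    ultimately show ?thesis
      unfolding part_b_def eq by linarith
  qed
  ultimately show ?thesis
    by (auto simp: less_prod_def')
qed

lemma part_nonzero: "m \<le> s \<Longrightarrow> part_a s j \<noteq> 0 \<or> part_b s j \<noteq> 0"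
  by (auto simp: part_b_def)

end

section \<open>Alternants\<close>

definition point_mon :: "nat \<Rightarrow> (nat \<Rightarrow> nat) \<Rightarrow> (nat \<Rightarrow> nat) \<Rightarrow> (nat \<Rightarrow> nat) \<Rightarrow> mon" where
  "point_mon n \<alpha> \<beta> \<sigma> = (\<Sum>j\<in>{1..n}. single (XVar (\<sigma> j)) (\<alpha> j) + single (YVar (\<sigma> j)) (\<beta> j))"

text \<open>
  Using differences to the extra point puts every nonconstant factor into the ideal
  \<open>(x\<^sub>l - x, y\<^sub>l - y)\<close> of its point \<open>l = \<sigma> j\<close>, and by the choice of the order it does not change
  leading monomials.
\<close>

definition point_prod :: "nat \<Rightarrow> (nat \<Rightarrow> nat) \<Rightarrow> (nat \<Rightarrow> nat) \<Rightarrow> (nat \<Rightarrow> nat) \<Rightarrow> cpoly" where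
  "point_prod n \<alpha> \<beta> \<sigma> = (\<Prod>j\<in>{1..n}. xdiff (\<sigma> j) 0 ^ \<alpha> j * ydiff (\<sigma> j) 0 ^ \<beta> j)"

text \<open>
  The projection of a product to the \<open>sgn(d)\<close>-component, up to a scalar: for odd \<open>d\<close> a determinant,
  for even \<open>d\<close> a permanent.
\<close>

definition alternant :: "nat \<Rightarrow> nat \<Rightarrow> (nat \<Rightarrow> nat) \<Rightarrow> (nat \<Rightarrow> nat) \<Rightarrow> cpoly" where
  "alternant d n \<alpha> \<beta> = (\<Sum>\<sigma> | \<sigma> permutes {1..n}. cscale (sgn_char d \<sigma>) (point_prod n \<alpha> \<beta> \<sigma>))"

lemma permutes_pos: "\<sigma> permutes {1..n} \<Longrightarrow> j \<in> {1..n} \<Longrightarrow> 0 < \<sigma> j"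
  for n :: nat
  using permutes_in_image[of \<sigma> "{1..n}" j] by simp

lemma lead_point_prod:
  assumes "\<sigma> permutes {1..n}"
  shows "lead (point_prod n \<alpha> \<beta> \<sigma>) (point_mon n \<alpha> \<beta> \<sigma>)"
  unfolding point_prod_def point_mon_def
  using permutes_pos[OF assms]
  by (intro lead_prod lead_mult lead_power lead_diff_pvar) auto

lemma permute_point_prod:
  assumes "\<tau> permutes {1..n}"
  shows "permute_points \<tau> (point_prod n \<alpha> \<beta> \<sigma>) = point_prod n \<alpha> \<beta> (\<tau> \<circ> \<sigma>)"
proof -
  have "bij \<tau>" "\<tau> 0 = 0"
    using permutes_bij[OF assms] permutes_not_in[OF assms, of 0] by simp_all
  then show ?thesis
    unfolding point_prod_def
    by (simp add: permute_points_prod permute_points_mult permute_points_power permute_points_diff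
        permute_points_pvar)
qed

lemma permute_point_mon:
  assumes "\<tau> permutes {1..n}"
  shows "permute_mon \<tau> (point_mon n \<alpha> \<beta> \<sigma>) = point_mon n \<alpha> \<beta> (\<tau> \<circ> \<sigma>)"
  using permutes_bij[OF assms] unfolding point_mon_def
  by (simp add: permute_mon_sum permute_mon_add permute_mon_single)

lemma sgn_char_comp:
  assumes "\<sigma> permutes {1..n}" "\<tau> permutes {1..n}"
  shows "sgn_char d (\<sigma> \<circ> \<tau>) = sgn_char d \<sigma> * sgn_char d \<tau>"
  using assms by (simp add: sgn_char_def sign_compose permutation_permutes[of _] )
    (metis finite_atLeastAtMost of_int_mult permutation_permutes sign_compose)

lemma sgn_char_square: "sgn_char d \<sigma> * sgn_char d \<sigma> = 1"
  by (simp add: sgn_char_def sign_def)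

text \<open>
  Reindexing by \<open>\<sigma> \<mapsto> \<tau> \<circ> \<sigma>\<close> exhibits the alternant as its own image under \<open>\<tau>\<close>, up to the character
  value, whose square is \<open>1\<close>.
\<close>

lemma permute_alternant:
  assumes "\<tau> permutes {1..n}"
  shows "permute_points \<tau> (alternant d n \<alpha> \<beta>) = cscale (sgn_char d \<tau>) (alternant d n \<alpha> \<beta>)"
proof -
  let ?p = "point_prod n \<alpha> \<beta>"
  have b: "bij \<tau>"
    using assms by (rule permutes_bij)
  have "alternant d n \<alpha> \<beta> =
      (\<Sum>\<sigma> | \<sigma> permutes {1..n}. cscale (sgn_char d (\<tau> \<circ> \<sigma>)) (?p (\<tau> \<circ> \<sigma>)))"
    unfolding alternant_def by (rule setum_permutations_compose_left[OF assms])
  also have "\<dots> = (\<Sum>\<sigma> | \<sigma> permutes {1..n}.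
      cscale (sgn_char d \<tau>) (permute_points \<tau> (cscale (sgn_char d \<sigma>) (?p \<sigma>))))"
    using assms b
    by (intro sum.cong refl) (simp add: sgn_char_comp permute_points_cscale permute_point_prod)
  also have "\<dots> = cscale (sgn_char d \<tau>) (permute_points \<tau> (alternant d n \<alpha> \<beta>))"
    unfolding alternant_def permute_points_sum[OF b] by (rule cpoly.scale_sum_right[symmetric])
  finally have "cscale (sgn_char d \<tau>) (alternant d n \<alpha> \<beta>) =
      cscale (sgn_char d \<tau> * sgn_char d \<tau>) (permute_points \<tau> (alternant d n \<alpha> \<beta>))"
    by (metis cpoly.scale_scale)
  then show ?thesis
    by (simp add: sgn_char_square)
qed

lemma lookup_point_mon:
  assumes "\<sigma> permutes {1..n}" "j \<in> {1..n}"
  shows "lookup (point_mon n \<alpha> \<beta> \<sigma>) (XVar (\<sigma> j)) = \<alpha> j"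
    and "lookup (point_mon n \<alpha> \<beta> \<sigma>) (YVar (\<sigma> j)) = \<beta> j"
proof -
  have "\<sigma> i = \<sigma> j \<longleftrightarrow> i = j" for i
    using permutes_inj[OF assms(1)] by (auto dest: injD)
  then show "lookup (point_mon n \<alpha> \<beta> \<sigma>) (XVar (\<sigma> j)) = \<alpha> j"
    and "lookup (point_mon n \<alpha> \<beta> \<sigma>) (YVar (\<sigma> j)) = \<beta> j"
    using assms(2) by (simp_all add: point_mon_def lookup_sum lookup_add lookup_single when_def)
qed

text \<open>
  A monomial that is maximal in its orbit is sorted, since otherwise a transposition would raise it.
  A sequence has only one sorted rearrangement, so it is the given one.
\<close>

lemma point_mon_max:
  assumes sorted: "\<And>i j. 1 \<le> i \<Longrightarrow> i < j \<Longrightarrow> j \<le> n \<Longrightarrow> (\<alpha> i, \<beta> i) \<le> (\<alpha> j, \<beta> j)"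
    and "\<sigma> permutes {1..n}"
  shows "point_mon n \<alpha> \<beta> \<sigma> \<le> point_mon n \<alpha> \<beta> id"
proof -
  let ?S = "point_mon n \<alpha> \<beta> ` {\<sigma>. \<sigma> permutes {1..n}}"
  have fin: "finite ?S"
    by (simp add: finite_permutations)
  have "Max ?S \<in> ?S"
    using fin permutes_id by (intro Max_in) blast+
  then obtain \<rho> where \<rho>: "\<rho> permutes {1..n}" "Max ?S = point_mon n \<alpha> \<beta> \<rho>"
    by blast
  have max: "point_mon n \<alpha> \<beta> \<tau> \<le> point_mon n \<alpha> \<beta> \<rho>" if "\<tau> permutes {1..n}" for \<tau>
    using fin that unfolding \<rho>(2)[symmetric] by (intro Max_ge) auto
  define g where "g = (\<lambda>j. (\<alpha> j, \<beta> j))"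
  define \<pi> where "\<pi> = inv \<rho>"
  have \<pi>: "\<pi> permutes {1..n}"
    unfolding \<pi>_def using \<rho>(1) by (rule permutes_inv)
  have lk: "lookup (point_mon n \<alpha> \<beta> \<rho>) (XVar l) = \<alpha> (\<pi> l)"
    "lookup (point_mon n \<alpha> \<beta> \<rho>) (YVar l) = \<beta> (\<pi> l)" if "l \<in> {1..n}" for l
  proof -
    have "\<rho> (\<pi> l) = l" "\<pi> l \<in> {1..n}"
      using \<rho>(1) \<pi> that by (simp_all only: \<pi>_def permutes_inverses permutes_in_image)
    then show "lookup (point_mon n \<alpha> \<beta> \<rho>) (XVar l) = \<alpha> (\<pi> l)"
      "lookup (point_mon n \<alpha> \<beta> \<rho>) (YVar l) = \<beta> (\<pi> l)"
      using lookup_point_mon[OF \<rho>(1), of "\<pi> l"] by simp_all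
  qed
  have "g (\<pi> i) \<le> g (\<pi> j)" if ij: "1 \<le> i" "i < j" "j \<le> n" for i j
  proof (rule ccontr)
    assume "\<not> g (\<pi> i) \<le> g (\<pi> j)"
    then have "point_mon n \<alpha> \<beta> \<rho> < permute_mon (transpose i j) (point_mon n \<alpha> \<beta> \<rho>)"
      using ij by (intro mon_less_transpose) (auto simp: lk g_def less_eq_prod_def)
    also have "\<dots> = point_mon n \<alpha> \<beta> (transpose i j \<circ> \<rho>)"
      using ij by (intro permute_point_mon permutes_swap_id) auto
    also have "\<dots> \<le> point_mon n \<alpha> \<beta> \<rho>"
      using ij by (intro max permutes_compose[OF \<rho>(1)] permutes_swap_id) auto
    finally show False by simp
  qed
  then have s1: "sorted (map (g \<circ> \<pi>) [1..<Suc n])"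
    by (auto simp: sorted_iff_nth_mono_less simp del: upt_Suc)
  have s2: "sorted (map g [1..<Suc n])"
    using sorted by (auto simp: sorted_iff_nth_mono_less g_def simp del: upt_Suc)
  have "mset (map (g \<circ> \<pi>) [1..<Suc n]) = image_mset g (image_mset \<pi> (mset_set {1..n}))"
    by (simp only: mset_map mset_upt atLeastLessThanSuc_atLeastAtMost image_mset.compositionality)
  also have "image_mset \<pi> (mset_set {1..n}) = mset_set {1..n}"
    using \<pi> by (simp add: image_mset_mset_set permutes_inj_on permutes_image)
  also have "image_mset g (mset_set {1..n}) = mset (map g [1..<Suc n])"
    by (simp only: mset_map mset_upt atLeastLessThanSuc_atLeastAtMost)
  finally have "map (g \<circ> \<pi>) [1..<Suc n] = map g [1..<Suc n]"
    using s1 s2 by (metis sorted_sort_id properties_for_sort)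
  then have g\<pi>: "g (\<pi> l) = g l" if "l \<in> {1..n}" for l
    using that by (auto simp: map_eq_conv simp del: upt_Suc)
  let ?h = "\<lambda>l. single (XVar l) (\<alpha> (\<pi> l)) + single (YVar l) (\<beta> (\<pi> l))"
  have "point_mon n \<alpha> \<beta> \<rho> = sum (?h \<circ> \<rho>) {1..n}"
    using \<rho>(1) by (simp add: point_mon_def \<pi>_def permutes_inverses)
  also have "\<dots> = sum ?h {1..n}"
    using \<rho>(1) by (rule sum.permute[symmetric])
  also have "\<dots> = point_mon n \<alpha> \<beta> id"
    unfolding point_mon_def using g\<pi> by (intro sum.cong) (auto simp: g_def)
  finally show ?thesis
    using max[OF assms(2)] by simp
qed

text \<open>
  All terms with leading monomial equal to the maximal one have the same coefficient there, and by
  the assumption on stabilizers they enter with the same sign. Other terms do not contain that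
  monomial.
\<close>

lemma lead_alternant:
  assumes sorted: "\<And>i j. 1 \<le> i \<Longrightarrow> i < j \<Longrightarrow> j \<le> n \<Longrightarrow> (\<alpha> i, \<beta> i) \<le> (\<alpha> j, \<beta> j)"
    and stab: "\<And>\<sigma>. \<sigma> permutes {1..n} \<Longrightarrow> point_mon n \<alpha> \<beta> \<sigma> = point_mon n \<alpha> \<beta> id \<Longrightarrow> sgn_char d \<sigma> = 1"
  shows "lead (alternant d n \<alpha> \<beta>) (point_mon n \<alpha> \<beta> id)"
proof -
  let ?\<mu> = "point_mon n \<alpha> \<beta>" and ?p = "point_prod n \<alpha> \<beta>"
  let ?S = "{\<sigma>. \<sigma> permutes {1..n}}"
  define c where "c = lookup (?p id) (?\<mu> id)"
  have c: "c \<noteq> 0"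
    using lead_point_prod[OF permutes_id] by (auto simp: c_def lead_def in_keys_iff)
  have max: "?\<mu> \<sigma> \<le> ?\<mu> id" if "\<sigma> \<in> ?S" for \<sigma>
    using point_mon_max[of n \<alpha> \<beta> \<sigma>] sorted that by blast
  have le: "\<nu> \<le> ?\<mu> id" if "\<sigma> \<in> ?S" "\<nu> \<in> keys (?p \<sigma>)" for \<sigma> \<nu>
  proof -
    have "\<nu> \<le> ?\<mu> \<sigma>"
      using lead_point_prod[of \<sigma> n \<alpha> \<beta>] that by (simp add: lead_def)
    then show ?thesis
      using max[OF that(1)] by simp
  qed
  have "lookup (?p \<sigma>) (?\<mu> id) = (if ?\<mu> \<sigma> = ?\<mu> id then c else 0)" if \<sigma>: "\<sigma> \<in> ?S" for \<sigma>
  proof (cases "?\<mu> \<sigma> = ?\<mu> id")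
    case True
    have "lookup (permute_points \<sigma> (?p id)) (permute_mon \<sigma> (?\<mu> id)) = c"
      using \<sigma> unfolding c_def by (intro lookup_permute_points_mon permutes_bij) auto
    then show ?thesis
      using \<sigma> True by (simp add: permute_point_prod permute_point_mon)
  next
    case False
    then have "?\<mu> \<sigma> < ?\<mu> id"
      using max[OF \<sigma>] by simp
    then have "?\<mu> id \<notin> keys (?p \<sigma>)"
      using lead_point_prod[of \<sigma> n \<alpha> \<beta>] \<sigma> by (auto simp: lead_def)
    then show ?thesis
      using False by (simp add: in_keys_iff)
  qed
  then have "lookup (alternant d n \<alpha> \<beta>) (?\<mu> id) = (\<Sum>\<sigma>\<in>?S. if ?\<mu> \<sigma> = ?\<mu> id then c else 0)"
    unfolding alternant_def lookup_sum lookup_cscale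
    by (intro sum.cong refl) (use stab in auto)
  also have "\<dots> = of_nat (card {\<sigma>\<in>?S. ?\<mu> \<sigma> = ?\<mu> id}) * c"
    by (simp add: sum.If_cases finite_permutations Int_def)
  also have "\<dots> \<noteq> 0"
  proof -
    have "id \<in> {\<sigma>\<in>?S. ?\<mu> \<sigma> = ?\<mu> id}"
      by (simp add: permutes_id)
    moreover have "finite {\<sigma>\<in>?S. ?\<mu> \<sigma> = ?\<mu> id}"
      by (simp add: finite_permutations)
    ultimately have "card {\<sigma>\<in>?S. ?\<mu> \<sigma> = ?\<mu> id} \<noteq> 0"
      by (metis (no_types, lifting) card_0_eq empty_iff)
    then show ?thesis
      using c by simp
  qed
  finally have "?\<mu> id \<in> keys (alternant d n \<alpha> \<beta>)"
    by (simp add: in_keys_iff)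
  moreover have "\<nu> \<le> ?\<mu> id" if "\<nu> \<in> keys (alternant d n \<alpha> \<beta>)" for \<nu>
  proof -
    have "(\<Sum>\<sigma>\<in>?S. sgn_char d \<sigma> * lookup (?p \<sigma>) \<nu>) \<noteq> 0"
      using that by (simp add: alternant_def lookup_sum in_keys_iff)
    then obtain \<sigma> where "\<sigma> \<in> ?S" "lookup (?p \<sigma>) \<nu> \<noteq> 0"
      by (metis (no_types, lifting) mult_zero_right sum.neutral)
    then show ?thesis
      using le by (simp add: in_keys_iff)
  qed
  ultimately show ?thesis
    by (simp add: lead_def)
qed

lemma lead_alternant_strict:
  assumes sorted: "\<And>i j. 1 \<le> i \<Longrightarrow> i < j \<Longrightarrow> j \<le> n \<Longrightarrow> (\<alpha> i, \<beta> i) < (\<alpha> j, \<beta> j)"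
  shows "lead (alternant d n \<alpha> \<beta>) (point_mon n \<alpha> \<beta> id)"
proof (rule lead_alternant)
  show "(\<alpha> i, \<beta> i) \<le> (\<alpha> j, \<beta> j)" if "1 \<le> i" "i < j" "j \<le> n" for i j
    using sorted[OF that] by (rule less_imp_le)
  fix \<sigma> assume \<sigma>: "\<sigma> permutes {1..n}" "point_mon n \<alpha> \<beta> \<sigma> = point_mon n \<alpha> \<beta> id"
  have "\<sigma> j = j" for j
  proof (cases "j \<in> {1..n}")
    case True
    then have "\<sigma> j \<in> {1..n}"
      using permutes_in_image[OF \<sigma>(1)] by simp
    then have "(\<alpha> (\<sigma> j), \<beta> (\<sigma> j)) = (\<alpha> j, \<beta> j)"
      using lookup_point_mon[OF \<sigma>(1) True, of \<alpha> \<beta>] lookup_point_mon[OF permutes_id, of "\<sigma> j" n \<alpha> \<beta>]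
      by (simp add: \<sigma>(2))
    then show ?thesis
      using sorted[of j "\<sigma> j"] sorted[of "\<sigma> j" j] True \<open>\<sigma> j \<in> {1..n}\<close>
      by (metis atLeastAtMost_iff linorder_neqE_nat order_less_irrefl)
  next
    case False
    then show ?thesis
      using \<sigma>(1) by (simp add: permutes_not_in)
  qed
  then have "\<sigma> = id"
    by auto
  then show "sgn_char d \<sigma> = 1"
    by (simp add: sgn_char_def)
qed

section \<open>Membership of alternants in the ideals\<close>

lemma carrier_mult:
  assumes "f \<in> carrier (point_ring n)" "g \<in> carrier (point_ring n)"
  shows "f * g \<in> carrier (point_ring n)"
proof -
  interpret R: cring "point_ring n" by (rule cring_point_ring)
  show ?thesis
    using R.m_closed[OF assms] by (simp only: point_ring_simps(2))
qed

lemma carrier_add: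
  assumes "f \<in> carrier (point_ring n)" "g \<in> carrier (point_ring n)"
  shows "f + g \<in> carrier (point_ring n)"
proof -
  interpret R: cring "point_ring n" by (rule cring_point_ring)
  show ?thesis
    using R.add.m_closed[OF assms] by (simp only: point_ring_simps(5))
qed

lemma carrier_const: "single 0 c \<in> carrier (point_ring n)"
  by simp

lemma carrier_one: "1 \<in> carrier (point_ring n)"
  by simp

lemma carrier_zero: "0 \<in> carrier (point_ring n)"
  by simp

lemma carrier_power: "f \<in> carrier (point_ring n) \<Longrightarrow> f ^ e \<in> carrier (point_ring n)"
  by (induction e) (simp_all only: power_0 power_Suc carrier_one carrier_mult)

lemma carrier_prod:
  "(\<And>i. i \<in> S \<Longrightarrow> f i \<in> carrier (point_ring n)) \<Longrightarrow> (\<Prod>i\<in>S. f i) \<in> carrier (point_ring n)"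
  by (induction S rule: infinite_finite_induct)
    (simp_all add: carrier_one carrier_mult del: point_ring_simps)

lemma carrier_sum:
  "(\<And>i. i \<in> S \<Longrightarrow> f i \<in> carrier (point_ring n)) \<Longrightarrow> (\<Sum>i\<in>S. f i) \<in> carrier (point_ring n)"
  by (induction S rule: infinite_finite_induct)
    (simp_all add: carrier_zero carrier_add del: point_ring_simps)

lemma cscale_conv_mult: "cscale c f = single 0 c * f"
  by (simp add: cscale_def mult_map_scale_conv_mult)

lemma carrier_cscale: "f \<in> carrier (point_ring n) \<Longrightarrow> cscale c f \<in> carrier (point_ring n)"
  unfolding cscale_conv_mult by (intro carrier_mult carrier_const)

lemma permute_coord_coords:
  assumes "\<sigma> permutes {1..n}" "v \<in> coords n"
  shows "permute_coord \<sigma> v \<in> coords n"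
proof -
  have "\<sigma> i \<le> n" if "i \<le> n" for i
    using that assms(1) permutes_in_image[OF assms(1), of i] by (cases "i = 0") (auto simp: permutes_def)
  then show ?thesis
    using assms(2) by (auto simp: coords_def)
qed

lemma carrier_permute:
  assumes \<sigma>: "\<sigma> permutes {1..n}" and f: "f \<in> carrier (point_ring n)"
  shows "permute_points \<sigma> f \<in> carrier (point_ring n)"
  unfolding point_ring_simps
proof
  fix \<mu> assume \<mu>: "\<mu> \<in> keys (permute_points \<sigma> f)"
  have b: "bij \<sigma>"
    using \<sigma> by (rule permutes_bij)
  obtain \<nu> where \<nu>: "\<mu> = permute_mon \<sigma> \<nu>"
    using permute_mon_surj[OF b] .
  then have "\<nu> \<in> keys f"
    using \<mu> b by (simp add: in_keys_iff lookup_permute_points_mon)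
  then have sub: "keys \<nu> \<subseteq> coords n"
    using f by simp
  show "keys \<mu> \<subseteq> coords n"
  proof
    fix v assume "v \<in> keys \<mu>"
    then have "permute_coord (inv \<sigma>) v \<in> coords n"
      using sub b by (auto simp: \<nu> in_keys_iff lookup_permute_mon)
    then show "v \<in> coords n"
      using permute_coord_coords[OF \<sigma>] b by (metis permute_coord_inv(2))
  qed
qed

text \<open>
  The polynomial ring is generated by constants and variables. The induction along monomials keeps
  the smaller factor inside the ring, which is what multiplicativity arguments need.
\<close>

lemma carrier_induct [consumes 1, case_names const pvar add]:
  assumes f: "f \<in> carrier (point_ring n)"
    and const: "\<And>c. P (single 0 c)"
    and pvar: "\<And>v g. v \<in> coords n \<Longrightarrow> g \<in> carrier (point_ring n) \<Longrightarrow> P g \<Longrightarrow> P (pvar v * g)"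
    and add: "\<And>g h. P g \<Longrightarrow> P h \<Longrightarrow> P (g + h)"
  shows "P f"
proof -
  have mon: "P (single (\<Sum>v\<in>A. single v (e v)) c) \<and> single (\<Sum>v\<in>A. single v (e v)) c \<in> carrier (point_ring n)"
    if "finite A" "A \<subseteq> coords n" for A e and c :: complex
    using that
  proof (induction A)
    case empty
    show ?case
      using const carrier_const by simp
  next
    case (insert v A)
    let ?r = "single (\<Sum>v\<in>A. single v (e v)) c"
    have v: "v \<in> coords n" and r: "P ?r" "?r \<in> carrier (point_ring n)"
      using insert by auto
    have "P (pvar v ^ j * ?r) \<and> pvar v ^ j * ?r \<in> carrier (point_ring n)" for j
    proof (induction j)
      case 0
      show ?case using r by (simp only: power_0 mult_1_left simp_thms)
    next
      case (Suc j)
      then show ?case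
        using pvar[OF v] carrier_mult[OF pvar_carrier[OF v]] by (simp only: power_Suc mult.assoc simp_thms)
    qed
    moreover have "pvar v ^ e v * ?r = single (\<Sum>v\<in>insert v A. single v (e v)) c"
      using insert.hyps by (simp add: pvar_power mult_single)
    ultimately show ?case
      by metis
  qed
  have s: "P (single \<mu> (lookup f \<mu>))" if "\<mu> \<in> keys f" for \<mu>
    using mon[of "keys \<mu>" "lookup \<mu>" "lookup f \<mu>"] f that by (simp flip: sum_singles)
  have "P (\<Sum>\<mu>\<in>S. single \<mu> (lookup f \<mu>))" if "finite S" "S \<subseteq> keys f" for S
    using that
  proof (induction S)
    case empty
    show ?case using const[of 0] by simp
  qed (use s add in auto)
  from this[of "keys f"] show ?thesis
    by (simp flip: sum_singles)
qed

lemma ideal_pair_ideal: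
  assumes "i \<le> n" "j \<le> n"
  shows "ideal (pair_ideal n i j) (point_ring n)"
proof -
  interpret R: cring "point_ring n" by (rule cring_point_ring)
  have "{xdiff i j, ydiff i j} \<subseteq> carrier (point_ring n)"
    using diff_pvar_carrier[of j n i] assms by blast
  then show ?thesis
    unfolding pair_ideal_def by (rule R.genideal_ideal)
qed

lemma pair_ideal_gens:
  assumes "i \<le> n" "j \<le> n"
  shows "xdiff i j \<in> pair_ideal n i j" "ydiff i j \<in> pair_ideal n i j"
proof -
  interpret R: cring "point_ring n" by (rule cring_point_ring)
  have "{xdiff i j, ydiff i j} \<subseteq> carrier (point_ring n)"
    using diff_pvar_carrier[of j n i] assms by blast
  then have "{xdiff i j, ydiff i j} \<subseteq> pair_ideal n i j"
    unfolding pair_ideal_def by (rule R.genideal_self)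
  then show "xdiff i j \<in> pair_ideal n i j" "ydiff i j \<in> pair_ideal n i j"
    by auto
qed

lemma pair_ideal_mult:
  assumes "i \<le> n" "j \<le> n" "f \<in> pair_ideal n i j" "g \<in> carrier (point_ring n)"
  shows "g * f \<in> pair_ideal n i j" "f * g \<in> pair_ideal n i j"
proof -
  show "g * f \<in> pair_ideal n i j"
    using ideal.I_l_closed[OF ideal_pair_ideal[OF assms(1,2)] assms(3,4)] by (simp only: point_ring_simps(2))
  then show "f * g \<in> pair_ideal n i j"
    by (simp only: mult.commute)
qed

lemma pair_ideal_add:
  assumes "i \<le> n" "j \<le> n" "f \<in> pair_ideal n i j" "g \<in> pair_ideal n i j"
  shows "f + g \<in> pair_ideal n i j"
  using additive_subgroup.a_closed[OF ideal.axioms(1)[OF ideal_pair_ideal[OF assms(1,2)]] assms(3,4)]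
  by (simp only: point_ring_simps(5))

lemma pair_ideal_zero:
  assumes "i \<le> n" "j \<le> n"
  shows "0 \<in> pair_ideal n i j"
  using additive_subgroup.zero_closed[OF ideal.axioms(1)[OF ideal_pair_ideal[OF assms]]]
  by (simp only: point_ring_simps(4))

lemma pair_ideal_sum:
  assumes "i \<le> n" "j \<le> n" "\<And>s. s \<in> S \<Longrightarrow> f s \<in> pair_ideal n i j"
  shows "(\<Sum>s\<in>S. f s) \<in> pair_ideal n i j"
  using assms(3)
  by (induction S rule: infinite_finite_induct)
    (auto intro: pair_ideal_zero pair_ideal_add assms(1,2))

text \<open>
  Modulo the ideal of the pair \<open>i\<close>, \<open>j\<close> the two points coincide, so their exchange acts as the
  identity on the quotient.
\<close>

lemma minus_transpose_in_pair_ideal: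
  assumes "1 \<le> i" "i < j" "j \<le> n" "f \<in> carrier (point_ring n)"
  shows "f - permute_points (transpose i j) f \<in> pair_ideal n i j"
  using assms(4)
proof (induction rule: carrier_induct)
  case (const c)
  show ?case
    using pair_ideal_zero[of i n j] assms by (simp add: permute_points_single)
next
  case (pvar v g)
  let ?\<tau> = "transpose i j"
  have ij: "i \<le> n" "j \<le> n"
    using assms by auto
  have \<tau>: "?\<tau> permutes {1..n}"
    using assms by (intro permutes_swap_id) auto
  have neg: "- f \<in> pair_ideal n i j" if "f \<in> pair_ideal n i j" for f
    using pair_ideal_mult(1)[OF ij that carrier_const[of "-1"]] by (simp add: single_uminus)
  have v: "pvar v - pvar (permute_coord ?\<tau> v) \<in> pair_ideal n i j"
  proof (cases v)
    case (XVar l)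
    then show ?thesis
      using pair_ideal_gens(1)[OF ij] neg[OF pair_ideal_gens(1)[OF ij]] pair_ideal_zero[OF ij]
      by (simp add: transpose_def)
  next
    case (YVar l)
    then show ?thesis
      using pair_ideal_gens(2)[OF ij] neg[OF pair_ideal_gens(2)[OF ij]] pair_ideal_zero[OF ij]
      by (simp add: transpose_def)
  qed
  have "pvar v * g - permute_points ?\<tau> (pvar v * g) =
      pvar v * (g - permute_points ?\<tau> g) + (pvar v - pvar (permute_coord ?\<tau> v)) * permute_points ?\<tau> g"
    by (simp add: permute_points_mult permute_points_pvar right_diff_distrib left_diff_distrib)
  also have "\<dots> \<in> pair_ideal n i j"
    using pvar v by (intro pair_ideal_add pair_ideal_mult ij carrier_permute[OF \<tau>] pvar_carrier)
  finally show ?case .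
next
  case (add g h)
  have "g + h - permute_points (transpose i j) (g + h) =
      (g - permute_points (transpose i j) g) + (h - permute_points (transpose i j) h)"
    by (simp add: permute_points_add)
  also have "\<dots> \<in> pair_ideal n i j"
    using assms add by (intro pair_ideal_add) auto
  finally show ?case .
qed

lemma point_prod_carrier:
  assumes "\<sigma> permutes {1..n}"
  shows "point_prod n \<alpha> \<beta> \<sigma> \<in> carrier (point_ring n)"
  unfolding point_prod_def
proof (intro carrier_prod carrier_mult carrier_power diff_pvar_carrier)
  fix j assume "j \<in> {1..n}"
  then show "\<sigma> j \<le> n" "\<sigma> j \<le> n"
    using permutes_in_image[OF assms, of j] by auto
qed auto

lemma alternant_carrier: "alternant d n \<alpha> \<beta> \<in> carrier (point_ring n)"
  unfolding alternant_def by (intro carrier_sum carrier_cscale point_prod_carrier) simp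

text \<open>
  For antisymmetric \<open>f\<close> the difference of \<open>f\<close> and its image under a transposition is \<open>2 f\<close>.
\<close>

lemma alternant_in_J_ideal: "alternant 1 n \<alpha> \<beta> \<in> J_ideal n"
  unfolding J_ideal_def
proof (intro IntI INT_I alternant_carrier)
  fix i j assume ij: "i \<in> {1..n}" "j \<in> {i<..n}"
  let ?f = "alternant 1 n \<alpha> \<beta>"
  have "permute_points (transpose i j) ?f = cscale (sgn_char 1 (transpose i j)) ?f"
    using ij by (intro permute_alternant permutes_swap_id) auto
  also have "\<dots> = - ?f"
    using ij cscale_neg_one_power[of 1 ?f] by (simp add: sgn_char_def sign_swap_id)
  finally have "?f + ?f \<in> pair_ideal n i j"
    using minus_transpose_in_pair_ideal[of i j n ?f] ij alternant_carrier by simp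
  then have "cscale (1/2) (?f + ?f) \<in> pair_ideal n i j"
    unfolding cscale_conv_mult using ij by (intro pair_ideal_mult carrier_const) auto
  moreover have "cscale (1/2) (?f + ?f) = ?f"
    by (rule cscale_half_double)
  ultimately show "?f \<in> pair_ideal n i j"
    by simp
qed

text \<open>
  In each term of the alternant the factor that involves the point \<open>i\<close> is a product of
  \<open>x\<^sub>i - x\<close> and \<open>y\<^sub>i - y\<close> with at least one factor.
\<close>

lemma alternant_in_I_ideal:
  assumes "\<And>j. j \<in> {1..n} \<Longrightarrow> \<alpha> j \<noteq> 0 \<or> \<beta> j \<noteq> 0"
  shows "alternant d n \<alpha> \<beta> \<in> I_ideal n"
  unfolding I_ideal_def
proof (intro IntI INT_I alternant_carrier)
  fix i assume i: "i \<in> {1..n}"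
  then have i0: "i \<le> n" "0 \<le> n" by auto
  have "point_prod n \<alpha> \<beta> \<sigma> \<in> pair_ideal n i 0" if \<sigma>: "\<sigma> permutes {1..n}" for \<sigma>
  proof -
    define j where "j = inv \<sigma> i"
    have j: "\<sigma> j = i" "j \<in> {1..n}"
      using \<sigma> i permutes_in_image[OF permutes_inv[OF \<sigma>], of i] by (auto simp: j_def permutes_inverses)
    let ?F = "\<lambda>j. xdiff (\<sigma> j) 0 ^ \<alpha> j * ydiff (\<sigma> j) 0 ^ \<beta> j"
    have c: "xdiff (\<sigma> l) 0 ^ e \<in> carrier (point_ring n)" "ydiff (\<sigma> l) 0 ^ e \<in> carrier (point_ring n)"
      if "l \<in> {1..n}" for l e
      using that permutes_in_image[OF \<sigma>, of l] by (intro carrier_power diff_pvar_carrier; simp)+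
    have F: "?F j \<in> pair_ideal n i 0"
    proof (cases "\<alpha> j = 0")
      case False
      then have "xdiff (\<sigma> j) 0 ^ \<alpha> j = xdiff (\<sigma> j) 0 ^ (\<alpha> j - 1) * xdiff i 0"
        using j by (metis power_minus_mult gr0I)
      moreover have "xdiff (\<sigma> j) 0 ^ (\<alpha> j - 1) * xdiff i 0 \<in> pair_ideal n i 0"
        by (intro pair_ideal_mult(1) pair_ideal_gens i0 c j)
      ultimately have "xdiff (\<sigma> j) 0 ^ \<alpha> j \<in> pair_ideal n i 0"
        by metis
      then show ?thesis
        by (intro pair_ideal_mult(2) i0 c j)
    next
      case True
      then have "\<beta> j \<noteq> 0"
        using assms[OF j(2)] by simp
      then have "ydiff (\<sigma> j) 0 ^ \<beta> j = ydiff (\<sigma> j) 0 ^ (\<beta> j - 1) * ydiff i 0"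
        using j by (metis power_minus_mult gr0I)
      moreover have "ydiff (\<sigma> j) 0 ^ (\<beta> j - 1) * ydiff i 0 \<in> pair_ideal n i 0"
        by (intro pair_ideal_mult(1) pair_ideal_gens i0 c j)
      ultimately have "ydiff (\<sigma> j) 0 ^ \<beta> j \<in> pair_ideal n i 0"
        by metis
      then show ?thesis
        by (intro pair_ideal_mult(1) i0 c j)
    qed
    have eq: "point_prod n \<alpha> \<beta> \<sigma> = ?F j * (\<Prod>l\<in>{1..n} - {j}. ?F l)"
      unfolding point_prod_def using j by (intro prod.remove) auto
    have "(\<Prod>l\<in>{1..n} - {j}. ?F l) \<in> carrier (point_ring n)"
      by (intro carrier_prod carrier_mult c) auto
    then show ?thesis
      unfolding eq by (rule pair_ideal_mult(2)[OF i0 F])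
  qed
  then show "alternant d n \<alpha> \<beta> \<in> pair_ideal n i 0"
    unfolding alternant_def cscale_conv_mult
    by (intro pair_ideal_sum pair_ideal_mult(1) i0 carrier_const) auto
qed

section \<open>Bihomogeneity\<close>

lemma xdeg_superset:
  assumes "finite S" "keys \<mu> \<subseteq> S"
  shows "xdeg \<mu> = (\<Sum>v\<in>S. case v of XVar _ \<Rightarrow> lookup \<mu> v | YVar _ \<Rightarrow> 0)"
  unfolding xdeg_def using assms
  by (intro sum.mono_neutral_left) (auto simp: in_keys_iff split: coord.splits)

lemma ydeg_superset:
  assumes "finite S" "keys \<mu> \<subseteq> S"
  shows "ydeg \<mu> = (\<Sum>v\<in>S. case v of XVar _ \<Rightarrow> 0 | YVar _ \<Rightarrow> lookup \<mu> v)"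
  unfolding ydeg_def using assms
  by (intro sum.mono_neutral_left) (auto simp: in_keys_iff split: coord.splits)

lemma deg_add: "xdeg (\<mu> + \<nu>) = xdeg \<mu> + xdeg \<nu>" "ydeg (\<mu> + \<nu>) = ydeg \<mu> + ydeg \<nu>"
proof -
  let ?S = "keys \<mu> \<union> keys \<nu>"
  have S: "finite ?S" "keys \<mu> \<subseteq> ?S" "keys \<nu> \<subseteq> ?S" "keys (\<mu> + \<nu>) \<subseteq> ?S"
    using Poly_Mapping.keys_add[of \<mu> \<nu>] by auto
  show "xdeg (\<mu> + \<nu>) = xdeg \<mu> + xdeg \<nu>"
    unfolding S(2-4)[THEN xdeg_superset[OF S(1)]] sum.distrib[symmetric]
    by (intro sum.cong) (auto simp: lookup_add split: coord.splits)
  show "ydeg (\<mu> + \<nu>) = ydeg \<mu> + ydeg \<nu>"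
    unfolding S(2-4)[THEN ydeg_superset[OF S(1)]] sum.distrib[symmetric]
    by (intro sum.cong) (auto simp: lookup_add split: coord.splits)
qed

lemma bihomogeneous_mult:
  assumes "f \<in> bihomogeneous i j" "g \<in> bihomogeneous i' j'"
  shows "f * g \<in> bihomogeneous (i + i') (j + j')"
  using assms Poly_Mapping.keys_mult[of f g]
  unfolding bihomogeneous_def by (fastforce simp: deg_add)

lemma bihomogeneous_one: "1 \<in> bihomogeneous 0 0"
  by (simp add: bihomogeneous_def xdeg_def ydeg_def)

lemma bihomogeneous_power: "f \<in> bihomogeneous i j \<Longrightarrow> f ^ e \<in> bihomogeneous (e * i) (e * j)"
  by (induction e) (auto simp: bihomogeneous_one bihomogeneous_mult)

lemma bihomogeneous_prod:
  "(\<And>s. s \<in> S \<Longrightarrow> f s \<in> bihomogeneous (i s) (j s)) \<Longrightarrow>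
    (\<Prod>s\<in>S. f s) \<in> bihomogeneous (\<Sum>s\<in>S. i s) (\<Sum>s\<in>S. j s)"
  by (induction S rule: infinite_finite_induct) (auto simp: bihomogeneous_one bihomogeneous_mult)

lemma subspace_bihomogeneous: "cpoly.subspace (bihomogeneous i j)"
proof (rule cpoly.subspaceI)
  fix f g assume "f \<in> bihomogeneous i j" "g \<in> bihomogeneous i j"
  then show "f + g \<in> bihomogeneous i j"
    using Poly_Mapping.keys_add[of f g] by (auto simp: bihomogeneous_def)
next
  fix c f assume "f \<in> bihomogeneous i j"
  then show "cscale c f \<in> bihomogeneous i j"
    by (auto simp: bihomogeneous_def in_keys_iff)
qed (simp add: bihomogeneous_def)

lemma bihomogeneous_pvar: "pvar (XVar i) \<in> bihomogeneous 1 0" "pvar (YVar i) \<in> bihomogeneous 0 1"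
  by (simp_all add: bihomogeneous_def xdeg_def ydeg_def)

lemma bihomogeneous_diff_pvar: "xdiff j i \<in> bihomogeneous 1 0" "ydiff j i \<in> bihomogeneous 0 1"
  by (intro cpoly.subspace_diff[OF subspace_bihomogeneous] bihomogeneous_pvar)+

lemma bihomogeneous_alternant:
  "alternant d n \<alpha> \<beta> \<in> bihomogeneous (\<Sum>j=1..n. \<alpha> j) (\<Sum>j=1..n. \<beta> j)"
proof -
  have "xdiff (\<sigma> j) 0 ^ \<alpha> j * ydiff (\<sigma> j) 0 ^ \<beta> j \<in> bihomogeneous (\<alpha> j) (\<beta> j)" for \<sigma> j
  proof -
    have "xdiff (\<sigma> j) 0 ^ \<alpha> j * ydiff (\<sigma> j) 0 ^ \<beta> j \<in>
        bihomogeneous (\<alpha> j * 1 + \<beta> j * 0) (\<alpha> j * 0 + \<beta> j * 1)"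
      by (intro bihomogeneous_mult bihomogeneous_power bihomogeneous_diff_pvar)
    then show ?thesis by simp
  qed
  then have "point_prod n \<alpha> \<beta> \<sigma> \<in> bihomogeneous (\<Sum>j=1..n. \<alpha> j) (\<Sum>j=1..n. \<beta> j)" for \<sigma>
    unfolding point_prod_def by (intro bihomogeneous_prod)
  then show ?thesis
    unfolding alternant_def
    by (intro cpoly.subspace_sum[OF subspace_bihomogeneous] cpoly.subspace_scale[OF subspace_bihomogeneous])
qed

section \<open>Realizing the lattice points\<close>

lemma lookup_point_mon_id:
  "lookup (point_mon n \<alpha> \<beta> id) (XVar i) = (if i \<in> {1..n} then \<alpha> i else 0)"
  "lookup (point_mon n \<alpha> \<beta> id) (YVar i) = (if i \<in> {1..n} then \<beta> i else 0)"
  by (auto simp: point_mon_def lookup_sum lookup_add lookup_single when_def)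

lemma sgn_char_power: "sgn_char 1 \<sigma> ^ d = sgn_char d \<sigma>"
  by (cases "evenperm \<sigma>"; cases "even d") (auto simp: sgn_char_def sign_def)

lemma cscale_mult_cscale: "cscale c f * cscale c' g = cscale (c * c') (f * g)"
proof -
  have "single 0 (c * c') = single 0 c * (single 0 c' :: cpoly)"
    by (simp add: mult_single)
  then show ?thesis
    unfolding cscale_conv_mult by (simp only: ac_simps)
qed

lemma cscale_prod: "finite S \<Longrightarrow> (\<Prod>s\<in>S. cscale c (f s)) = cscale (c ^ card S) (\<Prod>s\<in>S. f s)"
  by (induction S rule: finite_induct) (simp_all add: cscale_mult_cscale)

lemma prod_lessThan_add:
  "(\<Prod>s<m + k. f s) = (\<Prod>s<m. f s) * (\<Prod>s<k. f (m + s))" for f :: "nat \<Rightarrow> 'a::comm_monoid_mult"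
  by (induction k) (simp_all add: mult.assoc)

text \<open>
  For \<open>m + k > 0\<close> the witness is the product of the antisymmetric alternants of the parts of the
  lattice point with a monomial in the extra variables. For \<open>m + k = 0\<close> there are no parts, and a
  symmetrized product serves instead.
\<close>

theorem P_monomials_attained:
  assumes \<mu>: "\<mu> \<in> P_monomials n (m + k) k"
  shows "\<exists>f\<in>nested_hilb_sections n m k. lead f \<mu> \<and> f \<in> bihomogeneous (xdeg \<mu>) (ydeg \<mu>)"
proof -
  define a where "a = (\<lambda>i. lookup \<mu> (XVar i))"
  define b where "b = (\<lambda>i. lookup \<mu> (YVar i))"
  define d where "d = m + k"
  have keys: "keys \<mu> \<subseteq> coords n"
    and a: "\<And>j. j \<in> {1..<n} \<Longrightarrow> a j \<le> a (j + 1)"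
    and b: "\<And>j. j \<in> {1..<n} \<Longrightarrow> a j = a (j + 1) \<Longrightarrow> b j + d \<le> b (j + 1)"
    and bd: "\<And>j. j \<in> {1..n} \<Longrightarrow> (k - a j) + (\<Sum>i\<in>{1..<j}. d - (a j - a i)) \<le> b j"
    using \<mu> unfolding P_monomials_def mem_Collect_eq P_set_restrict_iff a_def b_def d_def by blast+
  define c where "c = pvar (XVar 0) ^ a 0 * pvar (YVar 0) ^ b 0"
  have c_carrier: "c \<in> carrier (point_ring n)"
    unfolding c_def by (intro carrier_mult carrier_power pvar_carrier) (auto simp: coords_def)
  have c_lead: "lead c (single (XVar 0) (a 0) + single (YVar 0) (b 0))"
    unfolding c_def by (intro lead_mult lead_power) (simp_all add: lead_def)
  have c_bihom: "c \<in> bihomogeneous (a 0 * 1 + b 0 * 0) (a 0 * 0 + b 0 * 1)"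
    unfolding c_def by (intro bihomogeneous_mult bihomogeneous_power bihomogeneous_pvar)
  have c_perm: "permute_points \<sigma> c = c" if "\<sigma> permutes {1..n}" for \<sigma>
  proof -
    have "bij \<sigma>" "\<sigma> 0 = 0"
      using permutes_bij[OF that] permutes_not_in[OF that, of 0] by simp_all
    then show ?thesis
      by (simp add: c_def permute_points_mult permute_points_power permute_points_pvar)
  qed
  have ab: "lookup \<mu> (XVar i) = a i" "lookup \<mu> (YVar i) = b i" for i
    by (simp_all add: a_def b_def)
  have zero: "a i = 0" "b i = 0" if "i > n" for i
    using keys that by (auto simp: a_def b_def coords_def not_in_keys_iff_lookup_eq_zero[symmetric])
  have *: ?thesis if f: "f \<in> nested_hilb_sections n m k" "lead f \<mu>" "f \<in> bihomogeneous i j" for f i j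
  proof -
    have "xdeg \<mu> = i" "ydeg \<mu> = j"
      using f(2,3) by (auto simp: lead_def bihomogeneous_def)
    then show ?thesis
      using f by auto
  qed
  show ?thesis
  proof (cases "d = 0")
    case True
    have le: "a i \<le> a j \<and> (a i = a j \<longrightarrow> b i \<le> b j)" if "1 \<le> i" "i \<le> j" "j \<le> n" for i j
      using that(2,3)
    proof (induction j rule: dec_induct)
      case (step j)
      then show ?case
        using a[of j] b[of j] that(1) by fastforce
    qed simp
    let ?f = "alternant 0 n a b"
    have "lead ?f (point_mon n a b id)"
      using le by (intro lead_alternant) (auto simp: less_eq_prod_def sgn_char_def le_less)
    then have "lead (c * ?f) (single (XVar 0) (a 0) + single (YVar 0) (b 0) + point_mon n a b id)"
      by (intro lead_mult c_lead)
    also have "single (XVar 0) (a 0) + single (YVar 0) (b 0) + point_mon n a b id = \<mu>"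
      using zero by (intro mon_eqI_XY)
        (auto simp: lookup_add lookup_single lookup_point_mon_id ab when_def)
    finally have "lead (c * ?f) \<mu>" .
    moreover have "c * ?f \<in> nested_hilb_sections n m k"
    proof -
      have "c * ?f \<in> carrier (point_ring n)"
        by (intro carrier_mult c_carrier alternant_carrier)
      moreover have "permute_points \<sigma> (c * ?f) = cscale (sgn_char 0 \<sigma>) (c * ?f)" if "\<sigma> permutes {1..n}" for \<sigma>
        using that by (simp add: permute_points_mult permutes_bij c_perm permute_alternant cscale_mult_right)
      moreover have "m = 0" "k = 0"
        using True by (auto simp: d_def)
      ultimately show ?thesis
        by (simp add: nested_hilb_sections_def sgn_component_def nat_pow_def ideals_set_def del: point_ring_simps)
    qed
    moreover note bihomogeneous_mult[OF c_bihom bihomogeneous_alternant[of 0 n a b]]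
    ultimately show ?thesis
      by (intro *)
  next
    case False
    interpret lattice_point n m k a b
      using False a b bd unfolding d_def by unfold_locales auto
    let ?g = "\<lambda>s. alternant 1 n (part_a s) (part_b s)"
    define f where "f = c * (\<Prod>s<d. ?g s)"
    have X: "(\<Sum>s<d. lookup (point_mon n (part_a s) (part_b s) id) (XVar i)) =
        (if i \<in> {1..n} then a i else 0)" for i
      by (cases "i \<in> {1..n}") (simp_all add: lookup_point_mon_id d_def sum_part_a del: atLeastAtMost_iff)
    have Y: "(\<Sum>s<d. lookup (point_mon n (part_a s) (part_b s) id) (YVar i)) =
        (if i \<in> {1..n} then b i else 0)" for i
      by (cases "i \<in> {1..n}") (simp_all add: lookup_point_mon_id d_def sum_part_b del: atLeastAtMost_iff)
    have "lead f (single (XVar 0) (a 0) + single (YVar 0) (b 0) +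
        (\<Sum>s<d. point_mon n (part_a s) (part_b s) id))"
      unfolding f_def by (intro lead_mult c_lead lead_prod lead_alternant_strict parts_sorted)
    also have "single (XVar 0) (a 0) + single (YVar 0) (b 0) +
        (\<Sum>s<d. point_mon n (part_a s) (part_b s) id) = \<mu>"
      using zero by (intro mon_eqI_XY)
        (auto simp: lookup_add lookup_single lookup_sum X Y when_def ab)
    finally have "lead f \<mu>" .
    moreover have "f \<in> nested_hilb_sections n m k"
    proof -
      have "f \<in> J_ideal n [^]\<^bsub>ideals_set (point_ring n)\<^esub> d"
        unfolding f_def by (intro ideal_power_prod_mem c_carrier alternant_in_J_ideal)
      moreover have "f \<in> I_ideal n [^]\<^bsub>ideals_set (point_ring n)\<^esub> k"
      proof -
        have "(\<Prod>s<d. ?g s) = (\<Prod>s<m. ?g s) * (\<Prod>s<k. ?g (m + s))"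
          unfolding d_def by (rule prod_lessThan_add)
        then have "f = (c * (\<Prod>s<m. ?g s)) * (\<Prod>s<k. ?g (m + s))"
          by (simp add: f_def mult.assoc)
        also have "\<dots> \<in> I_ideal n [^]\<^bsub>ideals_set (point_ring n)\<^esub> k"
          by (intro ideal_power_prod_mem alternant_in_I_ideal carrier_mult carrier_prod
              c_carrier alternant_carrier part_nonzero) simp
        finally show ?thesis .
      qed
      moreover have "permute_points \<sigma> f = cscale (sgn_char d \<sigma>) f" if "\<sigma> permutes {1..n}" for \<sigma>
        using that unfolding f_def
        by (simp add: permute_points_mult permute_points_prod permutes_bij c_perm permute_alternant
            cscale_prod sgn_char_power[unfolded One_nat_def] cscale_mult_right)
      ultimately show ?thesis
        by (simp add: nested_hilb_sections_def sgn_component_def d_def)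
    qed
    moreover have "f \<in> bihomogeneous (a 0 * 1 + b 0 * 0 + (\<Sum>s<d. \<Sum>j=1..n. part_a s j))
        (a 0 * 0 + b 0 * 1 + (\<Sum>s<d. \<Sum>j=1..n. part_b s j))"
      unfolding f_def by (intro bihomogeneous_mult c_bihom bihomogeneous_prod bihomogeneous_alternant)
    ultimately show ?thesis
      by (intro *)
  qed
qed

section \<open>Dimensions and leading monomials\<close>

lemma independent_distinct_leads:
  assumes "finite L" "\<And>\<mu>. \<mu> \<in> L \<Longrightarrow> lead (g \<mu>) \<mu>"
  shows "cpoly.independent (g ` L)" "inj_on g L"
proof -
  show inj: "inj_on g L"
    by (rule inj_onI) (metis assms(2) lead_unique)
  show "cpoly.independent (g ` L)"
  proof (rule cpoly.independent_if_scalars_zero)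
    fix c f assume sum: "(\<Sum>f\<in>g ` L. cscale (c f) f) = 0" and f: "f \<in> g ` L"
    have sum': "(\<Sum>\<mu>\<in>L. cscale (c (g \<mu>)) (g \<mu>)) = 0"
      using sum by (simp add: sum.reindex[OF inj])
    show "c f = 0"
    proof (rule ccontr)
      assume "c f \<noteq> 0"
      \<comment> \<open>The largest leading monomial with a nonzero scalar occurs in only one term of the relation.\<close>
      define S where "S = {\<mu> \<in> L. c (g \<mu>) \<noteq> 0}"
      have S: "finite S" "S \<noteq> {}"
        using assms(1) f \<open>c f \<noteq> 0\<close> by (auto simp: S_def)
      define \<nu> where "\<nu> = Max S"
      have \<nu>: "\<nu> \<in> S" "\<And>\<mu>. \<mu> \<in> S \<Longrightarrow> \<mu> \<le> \<nu>"
        using S by (simp_all add: \<nu>_def)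
      have "c (g \<mu>) * lookup (g \<mu>) \<nu> = (if \<mu> = \<nu> then c (g \<nu>) * lookup (g \<nu>) \<nu> else 0)" if "\<mu> \<in> L" for \<mu>
      proof (cases "\<mu> \<in> S \<and> \<mu> \<noteq> \<nu>")
        case True
        then have "\<not> \<nu> \<le> \<mu>"
          using \<nu>(2)[of \<mu>] by auto
        then have "\<nu> \<notin> keys (g \<mu>)"
          using assms(2)[OF that] by (auto simp: lead_def)
        then show ?thesis
          using True by (simp add: in_keys_iff)
      qed (use that in \<open>auto simp: S_def\<close>)
      then have "lookup (\<Sum>\<mu>\<in>L. cscale (c (g \<mu>)) (g \<mu>)) \<nu> =
          (\<Sum>\<mu>\<in>L. if \<mu> = \<nu> then c (g \<nu>) * lookup (g \<nu>) \<nu> else 0)"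
        by (simp add: lookup_sum cong: sum.cong)
      also have "\<dots> = c (g \<nu>) * lookup (g \<nu>) \<nu>"
        using assms(1) \<nu>(1) by (simp add: S_def)
      also have "\<dots> \<noteq> 0"
        using \<nu>(1) assms(2)[of \<nu>] by (simp add: S_def lead_def in_keys_iff)
      finally show False
        using sum' by simp
    qed
  qed (use assms(1) in simp)
qed

text \<open>
  Polynomials with distinct leading monomials are independent, and subtracting a multiple of the one
  with the same leading monomial lowers the leading monomial, so one polynomial for each leading
  monomial gives a basis.
\<close>

lemma dim_eq_card_leads:
  assumes W: "cpoly.subspace W" and L: "finite L" "L = {\<mu>. \<exists>f\<in>W. lead f \<mu>}"
  shows "cpoly.dim W = card L"
proof -
  have "\<forall>\<mu>\<in>L. \<exists>f. f \<in> W \<and> lead f \<mu>"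
    using L(2) by auto
  then obtain g where g: "\<And>\<mu>. \<mu> \<in> L \<Longrightarrow> g \<mu> \<in> W \<and> lead (g \<mu>) \<mu>"
    by metis
  have ind: "cpoly.independent (g ` L)" "inj_on g L"
    using independent_distinct_leads[OF L(1)] g by blast+
  have span: "f \<in> cpoly.span (g ` L)" if "f \<in> W" "lead f \<mu>" for f \<mu>
    using that
  proof (induction "card {\<nu>\<in>L. \<nu> < \<mu>}" arbitrary: f \<mu> rule: less_induct)
    case less
    have \<mu>: "\<mu> \<in> L"
      using less.prems L(2) by auto
    define c where "c = lookup f \<mu> / lookup (g \<mu>) \<mu>"
    define f' where "f' = f - cscale c (g \<mu>)"
    have nz: "lookup (g \<mu>) \<mu> \<noteq> 0"
      using g[OF \<mu>] by (simp add: lead_def in_keys_iff)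
    have f': "f' \<in> W"
      unfolding f'_def using W less.prems g[OF \<mu>]
      by (intro cpoly.subspace_diff cpoly.subspace_scale) auto
    have span_g: "cscale c (g \<mu>) \<in> cpoly.span (g ` L)"
      using \<mu> by (intro cpoly.span_scale cpoly.span_base) simp
    have "f' \<in> cpoly.span (g ` L)"
    proof (cases "f' = 0")
      case True
      then show ?thesis by (simp add: cpoly.span_zero)
    next
      case False
      then obtain \<nu> where \<nu>: "lead f' \<nu>"
        using lead_exists by blast
      have "lookup f' \<mu> = 0"
        using nz by (simp add: f'_def c_def lookup_minus)
      then have "\<nu> \<noteq> \<mu>"
        using \<nu> by (auto simp: lead_def in_keys_iff)
      moreover have "\<nu> \<in> keys f \<or> \<nu> \<in> keys (g \<mu>)"
        using \<nu> by (auto simp: lead_def f'_def in_keys_iff lookup_minus)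
      then have "\<nu> \<le> \<mu>"
        using less.prems(2) g[OF \<mu>] by (auto simp: lead_def)
      ultimately have "\<nu> < \<mu>"
        by simp
      moreover have "\<nu> \<in> L"
        using \<nu> f' L(2) by auto
      ultimately have "{\<kappa>\<in>L. \<kappa> < \<nu>} \<subset> {\<kappa>\<in>L. \<kappa> < \<mu>}"
        by auto
      then have "card {\<kappa>\<in>L. \<kappa> < \<nu>} < card {\<kappa>\<in>L. \<kappa> < \<mu>}"
        using L(1) by (intro psubset_card_mono) auto
      then show ?thesis
        using less.hyps f' \<nu> by blast
    qed
    then have "f' + cscale c (g \<mu>) \<in> cpoly.span (g ` L)"
      using span_g by (rule cpoly.span_add)
    then show ?case
      by (simp add: f'_def)
  qed
  have "W \<subseteq> cpoly.span (g ` L)"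
  proof
    fix f assume "f \<in> W"
    then show "f \<in> cpoly.span (g ` L)"
      using span lead_exists[of f] by (cases "f = 0") (auto simp: cpoly.span_zero)
  qed
  moreover have "g ` L \<subseteq> W"
    using g by auto
  ultimately have "cpoly.dim W = card (g ` L)"
    using ind(1) by (intro cpoly.dim_unique) auto
  then show ?thesis
    using ind(2) by (simp add: card_image)
qed

lemma subspace_carrier: "cpoly.subspace (carrier (point_ring n))"
  by (intro cpoly.subspaceI carrier_zero carrier_add carrier_cscale)

lemma subspace_pair_ideal:
  assumes "i \<le> n" "j \<le> n"
  shows "cpoly.subspace (pair_ideal n i j)"
  using assms unfolding cpoly.subspace_def cscale_conv_mult
  by (auto intro: pair_ideal_zero pair_ideal_add pair_ideal_mult(1)[OF _ _ _ carrier_const])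

lemma subspace_J_ideal: "cpoly.subspace (J_ideal n)"
  unfolding J_ideal_def
  by (intro cpoly.subspace_inter subspace_carrier cpoly.subspace_Int subspace_pair_ideal) auto

lemma subspace_I_ideal: "cpoly.subspace (I_ideal n)"
  unfolding I_ideal_def
  by (intro cpoly.subspace_inter subspace_carrier cpoly.subspace_Int subspace_pair_ideal) auto

lemma subspace_ideal_power:
  fixes r :: nat
  assumes "cpoly.subspace I"
  shows "cpoly.subspace (I [^]\<^bsub>ideals_set (point_ring n)\<^esub> r)"
proof (induction r)
  case 0
  show ?case
    using subspace_carrier by (simp add: nat_pow_def ideals_set_def)
next
  case (Suc r)
  let ?K = "I [^]\<^bsub>ideals_set (point_ring n)\<^esub> r"
  have "cpoly.subspace (ideal_prod (point_ring n) ?K I)"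
  proof (rule cpoly.subspaceI)
    have "0 \<otimes>\<^bsub>point_ring n\<^esub> 0 \<in> ideal_prod (point_ring n) ?K I"
      using Suc assms by (intro ideal_prod.prod cpoly.subspace_0)
    then show "0 \<in> ideal_prod (point_ring n) ?K I"
      by simp
  next
    fix f g assume "f \<in> ideal_prod (point_ring n) ?K I" "g \<in> ideal_prod (point_ring n) ?K I"
    then show "f + g \<in> ideal_prod (point_ring n) ?K I"
      using ideal_prod.sum[of f "point_ring n" ?K I g] by simp
  next
    fix c f assume "f \<in> ideal_prod (point_ring n) ?K I"
    then show "cscale c f \<in> ideal_prod (point_ring n) ?K I"
    proof (induction rule: ideal_prod.induct)
      case (prod g h)
      then have "g \<otimes>\<^bsub>point_ring n\<^esub> cscale c h \<in> ideal_prod (point_ring n) ?K I"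
        using assms by (intro ideal_prod.prod cpoly.subspace_scale)
      then show ?case
        by (simp add: cscale_mult_right)
    next
      case (sum g h)
      then show ?case
        using ideal_prod.sum[of "cscale c g" "point_ring n" ?K I "cscale c h"]
        by (simp add: cpoly.scale_right_distrib)
    qed
  qed
  then show ?case
    by (simp add: nat_pow_def ideals_set_def)
qed

lemma subspace_sgn_component:
  assumes "cpoly.subspace V"
  shows "cpoly.subspace (sgn_component n d V)"
proof (rule cpoly.subspaceI)
  show "0 \<in> sgn_component n d V"
    using assms by (auto simp: sgn_component_def permutes_bij cpoly.subspace_0)
next
  fix f g assume "f \<in> sgn_component n d V" "g \<in> sgn_component n d V"
  then show "f + g \<in> sgn_component n d V"
    using assms
    by (auto simp: sgn_component_def permutes_bij permute_points_add cpoly.scale_right_distrib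
        cpoly.subspace_add)
next
  fix c f assume "f \<in> sgn_component n d V"
  then show "cscale c f \<in> sgn_component n d V"
    using assms
    by (auto simp: sgn_component_def permutes_bij permute_points_cscale cpoly.subspace_scale
        mult.commute)
qed

lemma subspace_nested_hilb_sections: "cpoly.subspace (nested_hilb_sections n m k)"
  unfolding nested_hilb_sections_def
  by (intro subspace_sgn_component cpoly.subspace_inter subspace_ideal_power
      subspace_J_ideal subspace_I_ideal)

section \<open>Counting monomials\<close>

lemma deg_coords:
  assumes "keys \<mu> \<subseteq> coords n"
  shows "xdeg \<mu> = lookup \<mu> (XVar 0) + (\<Sum>l=1..n. lookup \<mu> (XVar l))"
    and "ydeg \<mu> = lookup \<mu> (YVar 0) + (\<Sum>l=1..n. lookup \<mu> (YVar l))"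
proof -
  have fin: "finite (coords n)" and disj: "XVar ` {0..n} \<inter> YVar ` {0..n} = {}"
    by (auto simp: coords_def)
  have "xdeg \<mu> = (\<Sum>l=0..n. lookup \<mu> (XVar l))"
    unfolding xdeg_superset[OF fin assms] coords_def
    by (subst sum.union_disjoint[OF _ _ disj]) (auto simp: sum.reindex inj_on_def)
  then show "xdeg \<mu> = lookup \<mu> (XVar 0) + (\<Sum>l=1..n. lookup \<mu> (XVar l))"
    by (simp add: sum.atLeast_Suc_atMost)
  have "ydeg \<mu> = (\<Sum>l=0..n. lookup \<mu> (YVar l))"
    unfolding ydeg_superset[OF fin assms] coords_def
    by (subst sum.union_disjoint[OF _ _ disj]) (auto simp: sum.reindex inj_on_def)
  then show "ydeg \<mu> = lookup \<mu> (YVar 0) + (\<Sum>l=1..n. lookup \<mu> (YVar l))"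
    by (simp add: sum.atLeast_Suc_atMost)
qed

text \<open>
  A monomial is determined by the exponents of the two extra variables, which take the share
  \<open>(i', j')\<close> of the bidegree, and by the lattice point formed by the remaining exponents.
\<close>

lemma card_P_monomials:
  shows "finite {\<mu> \<in> P_monomials n r k. xdeg \<mu> = i \<and> ydeg \<mu> = j}"
    and "card {\<mu> \<in> P_monomials n r k. xdeg \<mu> = i \<and> ydeg \<mu> = j} =
      (\<Sum>i'\<le>i. \<Sum>j'\<le>j. card {(a, b) \<in> P_set n r k.
        (\<Sum>l=1..n. a l) = i - i' \<and> (\<Sum>l=1..n. b l) = j - j'})"
proof -
  define c' where "c' = (\<lambda>i j. {(a, b) \<in> P_set n r k. (\<Sum>l=1..n. a l) = i \<and> (\<Sum>l=1..n. b l) = j})"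
  let ?L = "{\<mu> \<in> P_monomials n r k. xdeg \<mu> = i \<and> ydeg \<mu> = j}"
  define T where "T = (SIGMA p : {..i} \<times> {..j}. c' (i - fst p) (j - snd p))"
  define \<phi> where "\<phi> = (\<lambda>\<mu> :: mon. ((lookup \<mu> (XVar 0), lookup \<mu> (YVar 0)),
    (\<lambda>l\<in>{1..n}. lookup \<mu> (XVar l)), (\<lambda>l\<in>{1..n}. lookup \<mu> (YVar l))))"
  define \<psi> where "\<psi> = (\<lambda>((i', j'), (a, b)).
    single (XVar 0) i' + single (YVar 0) j' + point_mon n a b id)"
  have lk: "lookup (\<psi> ((i', j'), (a, b))) (XVar l) = (if l = 0 then i' else if l \<le> n then a l else 0)"
    "lookup (\<psi> ((i', j'), (a, b))) (YVar l) = (if l = 0 then j' else if l \<le> n then b l else 0)" for i' j' a b l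
    by (auto simp: \<psi>_def lookup_add lookup_single lookup_point_mon_id)
  have bij: "bij_betw \<phi> ?L T"
  proof (rule bij_betw_byWitness[where f' = \<psi>])
    show "\<forall>\<mu>\<in>?L. \<psi> (\<phi> \<mu>) = \<mu>"
    proof
      fix \<mu> assume "\<mu> \<in> ?L"
      then have "keys \<mu> \<subseteq> coords n"
        by (simp add: P_monomials_def)
      then have z: "lookup \<mu> (XVar l) = 0" "lookup \<mu> (YVar l) = 0" if "\<not> l \<le> n" for l
        using that by (auto simp: coords_def not_in_keys_iff_lookup_eq_zero[symmetric])
      show "\<psi> (\<phi> \<mu>) = \<mu>"
        using z by (intro mon_eqI_XY) (auto simp: \<phi>_def lk)
    qed
    have \<phi>\<psi>: "\<phi> (\<psi> ((i', j'), (a, b))) = ((i', j'), (a, b))"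
      if "(a, b) \<in> P_set n r k" for i' j' a b
    proof -
      have ab: "a \<in> {1..n} \<rightarrow>\<^sub>E UNIV" "b \<in> {1..n} \<rightarrow>\<^sub>E UNIV"
        using that by (auto simp: P_set_def)
      have "(\<lambda>l\<in>{1..n}. if l = 0 then i' else if l \<le> n then a l else 0) = a"
        "(\<lambda>l\<in>{1..n}. if l = 0 then j' else if l \<le> n then b l else 0) = b"
        using PiE_arb[OF ab(1)] PiE_arb[OF ab(2)] by (auto simp: restrict_def fun_eq_iff)
      then show ?thesis
        by (simp add: \<phi>_def lk del: restrict_apply)
    qed
    show "\<forall>t\<in>T. \<phi> (\<psi> t) = t"
      using \<phi>\<psi> by (auto simp: T_def c'_def)
    show "\<phi> ` ?L \<subseteq> T"
    proof
      fix t assume "t \<in> \<phi> ` ?L"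
      then obtain \<mu> where \<mu>: "\<mu> \<in> P_monomials n r k" "xdeg \<mu> = i" "ydeg \<mu> = j" "t = \<phi> \<mu>"
        by auto
      have "keys \<mu> \<subseteq> coords n"
        using \<mu>(1) by (simp add: P_monomials_def)
      from deg_coords[OF this] show "t \<in> T"
        using \<mu> by (auto simp: T_def c'_def \<phi>_def P_monomials_def)
    qed
    show "\<psi> ` T \<subseteq> ?L"
    proof
      fix \<mu> assume "\<mu> \<in> \<psi> ` T"
      then obtain i' j' a b where t: "i' \<le> i" "j' \<le> j" "(a, b) \<in> P_set n r k"
        "(\<Sum>l=1..n. a l) = i - i'" "(\<Sum>l=1..n. b l) = j - j'" "\<mu> = \<psi> ((i', j'), (a, b))"
        by (auto simp: T_def c'_def)
      have keys: "keys \<mu> \<subseteq> coords n"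
      proof
        fix v assume "v \<in> keys \<mu>"
        then show "v \<in> coords n"
          by (cases v) (auto simp: t(6) in_keys_iff lk coords_def split: if_splits)
      qed
      have "((\<lambda>l\<in>{1..n}. lookup \<mu> (XVar l)), (\<lambda>l\<in>{1..n}. lookup \<mu> (YVar l))) \<in> P_set n r k"
        using \<phi>\<psi>[OF t(3), of i' j'] t(3) by (simp add: t(6) \<phi>_def del: restrict_apply)
      moreover have "xdeg \<mu> = i" "ydeg \<mu> = j"
        using t unfolding deg_coords[OF keys] by (simp_all add: lk)
      ultimately show "\<mu> \<in> ?L"
        using keys by (simp add: P_monomials_def)
    qed
  qed
  have fin: "finite (c' i' j')" for i' j'
    unfolding c'_def by (rule finite_P_set_fibre)
  have "finite T"
    unfolding T_def using fin by (intro finite_SigmaI) auto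
  then show "finite ?L"
    using bij_betw_finite[OF bij] by simp
  have "card ?L = card T"
    using bij by (rule bij_betw_same_card)
  also have "\<dots> = (\<Sum>i'\<le>i. \<Sum>j'\<le>j. card (c' (i - i') (j - j')))"
    unfolding T_def using fin
    by (subst card_SigmaI) (auto simp: sum.cartesian_product split_def)
  finally show "card ?L = (\<Sum>i'\<le>i. \<Sum>j'\<le>j. card {(a, b) \<in> P_set n r k.
        (\<Sum>l=1..n. a l) = i - i' \<and> (\<Sum>l=1..n. b l) = j - j'})"
    unfolding c'_def .
qed

section \<open>The Hilbert series\<close>

lemma bivariate_series_partial_sums:
  assumes "\<And>i j. c i j = (\<Sum>i'\<le>i. \<Sum>j'\<le>j. c' (i - i') (j - j'))"
  shows "bivariate_series c = 1 / ((1 - qser) * (1 - tser)) * bivariate_series c'"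
proof -
  \<comment> \<open>\<open>G\<close> and \<open>g\<close> are the geometric series in \<open>t\<close> and \<open>q\<close>, and multiplying by them takes partial sums.\<close>
  define G where "G = (Abs_fps (\<lambda>_. 1) :: rat fps fps)"
  define g where "g = (Abs_fps (\<lambda>_. 1) :: rat fps)"
  have "(1 - fps_X) * g = 1" "(1 - fps_X) * G = 1"
    by (simp_all add: fps_eq_iff left_diff_distrib g_def G_def)
  then have inv: "(1 - tser) * G = 1" "(1 - qser) * fps_const g = 1"
    unfolding tser_def qser_def
    by (simp_all flip: fps_const_1_eq_1 add: fps_const_sub fps_const_mult)
  have eq: "bivariate_series c = fps_const g * (G * bivariate_series c')"
  proof (rule fps_ext, rule fps_ext)
    fix j i
    have "fps_nth (fps_nth (fps_const g * (G * bivariate_series c')) j) i =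
        (\<Sum>i'=0..i. \<Sum>j'=0..j. of_nat (c' (i - i') (j - j')))"
      unfolding fps_mult_left_const_nth fps_mult_nth[of G] fps_mult_nth[of g]
      by (simp add: fps_sum_nth g_def G_def bivariate_series_def)
    also have "\<dots> = of_nat (c i j)"
      by (simp add: assms atLeast0AtMost)
    finally show "fps_nth (fps_nth (bivariate_series c) j) i =
        fps_nth (fps_nth (fps_const g * (G * bivariate_series c')) j) i"
      by (simp add: bivariate_series_def)
  qed
  have "(1 - qser) * (1 - tser) * bivariate_series c =
      ((1 - qser) * fps_const g) * (((1 - tser) * G) * bivariate_series c')"
    unfolding eq by (simp only: ac_simps)
  then have "(1 - qser) * (1 - tser) * bivariate_series c = bivariate_series c'"
    by (simp add: inv)
  then have "1 / ((1 - qser) * (1 - tser)) * bivariate_series c' =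
      (1 / ((1 - qser) * (1 - tser)) * ((1 - qser) * (1 - tser))) * bivariate_series c"
    by (simp only: mult.assoc)
  then show ?thesis
    by (simp only: inverse_one_minus_q_one_minus_t mult_1_left)
qed

theorem corollary1p5:
  fixes n m k :: nat
  assumes "n \<ge> 1"
  shows "hilbert_series (nested_hilb_sections n m k) =
    1 / ((1 - qser) * (1 - tser)) * lattice_series n (P_set n (m + k) k)"
  unfolding hilbert_series_def lattice_series_def
proof (rule bivariate_series_partial_sums)
  fix i j
  let ?W = "nested_hilb_sections n m k \<inter> bihomogeneous i j"
  let ?L = "{\<mu> \<in> P_monomials n (m + k) k. xdeg \<mu> = i \<and> ydeg \<mu> = j}"
  have "?L = {\<mu>. \<exists>f\<in>?W. lead f \<mu>}"
  proof (rule equalityI; rule subsetI)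
    fix \<mu> assume "\<mu> \<in> ?L"
    then show "\<mu> \<in> {\<mu>. \<exists>f\<in>?W. lead f \<mu>}"
      using P_monomials_attained by fastforce
  next
    fix \<mu> assume "\<mu> \<in> {\<mu>. \<exists>f\<in>?W. lead f \<mu>}"
    then obtain f where "f \<in> nested_hilb_sections n m k" "f \<in> bihomogeneous i j" "lead f \<mu>"
      by auto
    then show "\<mu> \<in> ?L"
      using lead_in_P_monomials by (auto simp: lead_def bihomogeneous_def)
  qed
  then have "cpoly.dim ?W = card ?L"
    using card_P_monomials(1)
    by (intro dim_eq_card_leads cpoly.subspace_inter subspace_nested_hilb_sections subspace_bihomogeneous)
  then show "cpoly.dim ?W = (\<Sum>i'\<le>i. \<Sum>j'\<le>j.
      card {(a, b) \<in> P_set n (m + k) k. (\<Sum>l=1..n. a l) = i - i' \<and> (\<Sum>l=1..n. b l) = j - j'})"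
    by (simp only: card_P_monomials(2))
qed

end
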